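(* Let $n\ge 2$, $N=2n-1$, and let $[p_0:\cdots:p_N]$ be homogeneous coordinates on $\mathbb{P}^N$ over $\mathbb{C}$. For $1\le r\le n-1$ put $$F_r(p_0,\dots,p_N)=\sum_{j=0}^r(-1)^j p_{r-j}\,p_{N-r+j}.$$ (1) The type $C_n$ boundary, i.e. the reduced complement $\mathbb{P}^N\setminus\eta(S)$ of the type $C_n$ open Richardson locus $\eta(S)$ defined in the context, is the reduced anticanonical divisor $$D_C=\operatorname{div}\bigl(p_0\,p_N\,F_1F_2\cdots F_{n-1}\bigr)_{\mathrm{red}}.$$ (2) Let $q\in\mathbb{C}^*$. On the dual-side Lusztig torus $(\mathbb{C}^* )^{2n-1}$ associated with the reduced word $(1,2,\dots,n-1,n,n-1,\dots,1)$, with coordinates $(a_1,\dots,a_{n-1},b,c_{n-1},\dots,c_1)$, the Lie-theoretical superpotential (defined in the context) is $$W_{\mathrm{Lus}}^{(2n-1)}=a_1+\cdots+a_{n-1}+b+c_{n-1}+\cdots+c_1+\frac{q\,(a_1+c_1)}{a_1\cdots a_{n-1}\,b^2\,c_{n-1}\cdots c_1}.$$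
   Context: All varieties are over $\mathbb{C}$. Type $C_n$ open locus. Let $V=\mathbb{C}^{N+1}$ with ordered basis $e_0,\dots,e_N$, $N=2n-1$, and let $J$ be the skew matrix with $J_{i,N-i}=(-1)^i$ and $J_{ij}=0$ if $i+j\ne N$. Let $G=Sp(V,J)=\{g\in GL(V): g^tJg=J\}\cong Sp_{2n}$, let $U_+\subset G$ be the subgroup of upper unitriangular matrices and $B_-\subset G$ the subgroup of lower triangular matrices. Let $P=P_1$ be the stabilizer of the row line $\mathbb{C}e_N^t$, so $P\backslash G\cong\mathbb{P}^N$ via $Pg\mapsto[e_N^tg]$. Take $\dot w_0=J$, and let $M=\dot w_P\dot w_0^{-1}$ be the signed permutation matrix with nonzero entries $M_{0N}=-1$, $M_{N0}=1$, $M_{ii}=-1$ for $1\le i\le N-1$ (here $w_P$ is the longest element of the parabolic Weyl group $\langle s_2,\dots,s_n\rangle$). Put $S=B_-\cap U_+MU_+$ (which is identified with the open Richardson variety $(B_+\dot w_PB_-\cap B_-\dot w_0B_-)/B_-$ by $b\mapsto b\dot w_0B_-$), and $$\eta:S\to\mathbb{P}^N,\qquad b\mapsto[e_N^t\,b\,\dot w_0].$$ The type $C_n$ open locus is $\eta(S)$. A divisor in $\mathbb{P}^N$ is anticanonical if it is cut out by a form of degree $N+1$. Dual side. Let $N'=2n+1$, let $\mathbb{C}^{N'}$ have basis $e_1,\dots,e_{N'}$, and let $J^\vee$ be the symmetric matrix with $J^\vee_{i,N'+1-i}=(-1)^{i-1}$ and $J^\vee_{ij}=0$ if $i+j\neq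 N'+1$. Let $G^\vee=\{g\in SL_{N'}(\mathbb{C}): g^tJ^\vee g=J^\vee\}\cong SO_{2n+1}$, with $U_+^\vee$ its upper unitriangular matrices and $B_-^\vee$ its lower triangular matrices. With $E_{ij}$ the matrix units set $e_i^\vee=E_{i,i+1}+E_{N'-i,N'+1-i}$ for $1\le i\le n-1$, $e_n^\vee=\sqrt2(E_{n,n+1}+E_{n+1,n+2})$, and $x_i(s)=\exp(se_i^\vee)$. For $u\in U_+^\vee$ define the simple-root coordinates $\varepsilon_i(u)=u_{i,i+1}$ for $1\le i<n$ and $\varepsilon_n(u)=\tfrac1{\sqrt2}u_{n,n+1}$. Let $t(q)=\operatorname{diag}(q,1,\dots,1,q^{-1})$ and let $M^\vee$ be the signed permutation matrix with nonzero entries $M^\vee_{1,N'}=1$, $M^\vee_{N',1}=1$, $M^\vee_{ii}=-1$ for $2\le i\le N'-1$. The Rietsch mirror fibre is $Z^q=B_-^\vee\cap U_+^\vee t(q)M^\vee U_+^\vee$, and the superpotential on it is $$W_{\mathrm{Lie}}(u_1t(q)M^\vee u_2)=\sum_{i=1}^n\varepsilon_i(u_1)+\sum_{i=1}^n\varepsilon_i(u_2),\qquad u_1,u_2\in U_+^\vee,\ u_1t(q)M^\vee u_2\in B_-^\vee.$$ The Lusztig torus for the reduced word $(1,\dots,n-1,n,n-1,\dots,1)$ consists of the elements $$u_2=x_1(a_1)\cdots x_{n-1}(a_{n-1})\,x_n(b)\,x_{n-1}(c_{n-1})\cdots x_1(c_1),$$ with all parameters in $\mathbb{C}^*$. The superpotential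 on the Lusztig torus is the function $(a,b,c)\mapsto W_{\mathrm{Lie}}(u_1t(q)M^\vee u_2)$, where $u_2$ is as displayed and $u_1\in U_+^\vee$ is the unique element with $u_1t(q)M^\vee u_2\in B_-^\vee$. *)

theory Defs
  imports
    Complex_Main
    "HOL-Library.Poly_Mapping"
    "HOL-Computational_Algebra.Factorial_Ring"
    "Jordan_Normal_Form.Matrix"
    "Jordan_Normal_Form.Determinant"
begin

section \<open>Projective space, forms and divisors\<close>

text \<open>A point of the projective space of dimension \<open>N\<close> is the class of a nonzero vector up
  to nonzero scalars.\<close>

definition proj_pt :: "complex vec \<Rightarrow> complex vec set" where
  "proj_pt v = {c \<cdot>\<^sub>v v | c. c \<noteq> 0}"

definition proj_space :: "nat \<Rightarrow> complex vec set set" where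
  "proj_space N = proj_pt ` {v \<in> carrier_vec (N + 1). v \<noteq> 0\<^sub>v (N + 1)}"

text \<open>Polynomials in variables \<open>p\<^sub>0, p\<^sub>1, p\<^sub>2, \<dots>\<close>; a polynomial maps each exponent vector to a
  coefficient. Only \<open>p\<^sub>0, \<dots>, p\<^sub>N\<close> may occur in a form on the projective space of dimension \<open>N\<close>.
  All factors of a nonzero form are forms in the same variables, so divisibility and
  irreducibility do not depend on whether the further variables are present.\<close>

type_synonym cpoly = "(nat \<Rightarrow>\<^sub>0 nat) \<Rightarrow>\<^sub>0 complex"

definition pvar :: "nat \<Rightarrow> cpoly" where
  "pvar i = Poly_Mapping.single (Poly_Mapping.single i 1) 1"

definition peval :: "cpoly \<Rightarrow> (nat \<Rightarrow> complex) \<Rightarrow> complex" where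
  "peval f x = (\<Sum>m\<in>Poly_Mapping.keys f. Poly_Mapping.lookup f m *
     (\<Prod>i\<in>Poly_Mapping.keys m. x i ^ Poly_Mapping.lookup m i))"

definition is_form :: "nat \<Rightarrow> nat \<Rightarrow> cpoly \<Rightarrow> bool" where
  "is_form N d f \<longleftrightarrow> (\<forall>m\<in>Poly_Mapping.keys f. Poly_Mapping.keys m \<subseteq> {..N} \<and>
     (\<Sum>i\<in>Poly_Mapping.keys m. Poly_Mapping.lookup m i) = d)"

definition zero_locus :: "nat \<Rightarrow> cpoly \<Rightarrow> complex vec set set" where
  "zero_locus N f = {L \<in> proj_space N. \<forall>v\<in>L. peval f (\<lambda>i. v $ i) = 0}"

text \<open>A prime divisor is the hypersurface cut out by an irreducible form, which is determined up
  to a scalar. An effective divisor is given by its multiplicity along each prime divisor; as a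
  function on polynomials it takes the same value on proportional irreducible forms, and \<open>0\<close> on
  everything that is not an irreducible form.\<close>

type_synonym divisor = "cpoly \<Rightarrow> nat"

definition prime_form :: "nat \<Rightarrow> cpoly \<Rightarrow> bool" where
  "prime_form N p \<longleftrightarrow> irreducible p \<and> (\<exists>d. is_form N d p)"

text \<open>To be used for nonzero forms \<open>f\<close> only.\<close>

definition form_divisor :: "nat \<Rightarrow> cpoly \<Rightarrow> divisor" where
  "form_divisor N f = (\<lambda>p. if prime_form N p then (GREATEST k. p ^ k dvd f) else 0)"

definition reduced_divisor :: "divisor \<Rightarrow> divisor" where
  "reduced_divisor D = (\<lambda>p. min 1 (D p))"

definition divisor_support :: "nat \<Rightarrow> divisor \<Rightarrow> complex vec set set" where
  "divisor_support N D = (\<Union>p\<in>{p. prime_form N p \<and> D p > 0}. zero_locus N p)"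

definition anticanonical :: "nat \<Rightarrow> divisor \<Rightarrow> bool" where
  "anticanonical N D \<longleftrightarrow> (\<exists>g. g \<noteq> 0 \<and> is_form N (N + 1) g \<and> D = form_divisor N g)"

section \<open>Triangular matrices\<close>

definition upper_unitriangular :: "complex mat \<Rightarrow> bool" where
  "upper_unitriangular g \<longleftrightarrow> upper_triangular g \<and> (\<forall>i<dim_row g. g $$ (i, i) = 1)"

definition lower_triangular :: "complex mat \<Rightarrow> bool" where
  "lower_triangular g \<longleftrightarrow> upper_triangular (transpose_mat g)"

section \<open>The type C open locus\<close>

text \<open>Here \<open>V = \<complex>\<^bsup>2n\<^esup>\<close> and rows and columns are numbered \<open>0, \<dots>, N\<close> with \<open>N = 2n - 1\<close>.\<close>

definition J_C :: "nat \<Rightarrow> complex mat" where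
  "J_C n = mat (2*n) (2*n) (\<lambda>(i, j). if i + j = 2*n - 1 then (-1) ^ i else 0)"

definition Sp_group :: "nat \<Rightarrow> complex mat set" where
  "Sp_group n = {g \<in> carrier_mat (2*n) (2*n).
     invertible_mat g \<and> transpose_mat g * J_C n * g = J_C n}"

definition U_plus :: "nat \<Rightarrow> complex mat set" where
  "U_plus n = {g \<in> Sp_group n. upper_unitriangular g}"

definition B_minus :: "nat \<Rightarrow> complex mat set" where
  "B_minus n = {g \<in> Sp_group n. lower_triangular g}"

definition M_C :: "nat \<Rightarrow> complex mat" where
  "M_C n = mat (2*n) (2*n) (\<lambda>(i, j).
     if i = 0 \<and> j = 2*n - 1 then -1
     else if i = 2*n - 1 \<and> j = 0 then 1
     else if i = j \<and> 1 \<le> i \<and> i \<le> 2*n - 2 then -1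
     else 0)"

definition S_C :: "nat \<Rightarrow> complex mat set" where
  "S_C n = B_minus n \<inter> {u * M_C n * u' | u u'. u \<in> U_plus n \<and> u' \<in> U_plus n}"

text \<open>The representative of the longest Weyl group element is the matrix \<open>J_C n\<close>; multiplying by
  the row vector \<open>e\<^sub>N\<^sup>t\<close> from the left extracts row \<open>N\<close>.\<close>

definition eta_C :: "nat \<Rightarrow> complex mat \<Rightarrow> complex vec set" where
  "eta_C n b = proj_pt (row (b * J_C n) (2*n - 1))"

definition open_locus_C :: "nat \<Rightarrow> complex vec set set" where
  "open_locus_C n = eta_C n ` S_C n"

definition F_C :: "nat \<Rightarrow> nat \<Rightarrow> cpoly" where
  "F_C N r = (\<Sum>j=0..r. (-1) ^ j * pvar (r - j) * pvar (N - r + j))"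

definition D_C :: "nat \<Rightarrow> divisor" where
  "D_C n = (let N = 2*n - 1 in
     reduced_divisor (form_divisor N (pvar 0 * pvar N * (\<Prod>r=1..n-1. F_C N r))))"

section \<open>The dual side\<close>

text \<open>Matrices of size \<open>N' = 2n + 1\<close>, with rows and columns numbered \<open>1, \<dots>, N'\<close> in the defining
  formulas: \<open>mat1 d f\<close> has the entry \<open>f i j\<close> in row \<open>i\<close> and column \<open>j\<close> of this numbering,
  and \<open>entry1\<close> reads it off.\<close>

definition mat1 :: "nat \<Rightarrow> (nat \<Rightarrow> nat \<Rightarrow> complex) \<Rightarrow> complex mat" where
  "mat1 d f = mat d d (\<lambda>(i, j). f (i + 1) (j + 1))"

definition entry1 :: "complex mat \<Rightarrow> nat \<Rightarrow> nat \<Rightarrow> complex" where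
  "entry1 A i j = A $$ (i - 1, j - 1)"

definition mat_unit :: "nat \<Rightarrow> nat \<Rightarrow> nat \<Rightarrow> complex mat" where
  "mat_unit d k l = mat1 d (\<lambda>i j. if i = k \<and> j = l then 1 else 0)"

text \<open>The exponential series, taken entrywise.\<close>

definition mat_exp :: "complex mat \<Rightarrow> complex mat" where
  "mat_exp A = mat (dim_row A) (dim_row A) 
     (\<lambda>(i, j). suminf (\<lambda>k. (A ^\<^sub>m k) $$ (i, j) / fact k))"

definition J_dual :: "nat \<Rightarrow> complex mat" where
  "J_dual n = mat1 (2*n + 1) (\<lambda>i j. if i + j = 2*n + 2 then (-1) ^ (i - 1) else 0)"

definition SO_group :: "nat \<Rightarrow> complex mat set" where
  "SO_group n = {g \<in> carrier_mat (2*n + 1) (2*n + 1).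
     det g = 1 \<and> transpose_mat g * J_dual n * g = J_dual n}"

definition U_dual :: "nat \<Rightarrow> complex mat set" where
  "U_dual n = {g \<in> SO_group n. upper_unitriangular g}"

definition B_dual :: "nat \<Rightarrow> complex mat set" where
  "B_dual n = {g \<in> SO_group n. lower_triangular g}"

definition e_dual :: "nat \<Rightarrow> nat \<Rightarrow> complex mat" where
  "e_dual n i = (let d = 2*n + 1 in
     if i < n then mat_unit d i (i + 1) + mat_unit d (d - i) (d + 1 - i)
     else complex_of_real (sqrt 2) \<cdot>\<^sub>m (mat_unit d n (n + 1) + mat_unit d (n + 1) (n + 2)))"

definition x_dual :: "nat \<Rightarrow> nat \<Rightarrow> complex \<Rightarrow> complex mat" where
  "x_dual n i s = mat_exp (s \<cdot>\<^sub>m e_dual n i)"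

definition eps_dual :: "nat \<Rightarrow> nat \<Rightarrow> complex mat \<Rightarrow> complex" where
  "eps_dual n i u = (if i < n then entry1 u i (i + 1)
     else 1 / complex_of_real (sqrt 2) * entry1 u n (n + 1))"

definition t_dual :: "nat \<Rightarrow> complex \<Rightarrow> complex mat" where
  "t_dual n q = mat1 (2*n + 1) (\<lambda>i j.
     if i \<noteq> j then 0 else if i = 1 then q else if i = 2*n + 1 then inverse q else 1)"

definition M_dual :: "nat \<Rightarrow> complex mat" where
  "M_dual n = mat1 (2*n + 1) (\<lambda>i j.
     if i = 1 \<and> j = 2*n + 1 \<or> i = 2*n + 1 \<and> j = 1 then 1
     else if i = j \<and> 2 \<le> i \<and> i \<le> 2*n then -1
     else 0)"

text \<open>The superpotential at a point \<open>z\<close> of the mirror fibre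
  \<open>B_dual n \<inter> U_dual n \<cdot> t(q)M \<cdot> U_dual n\<close>. The decomposition \<open>z = u\<^sub>1t(q)Mu\<^sub>2\<close> is not unique,
  but the sum is the same for all decompositions of \<open>z\<close>.\<close>

definition W_Lie :: "nat \<Rightarrow> complex \<Rightarrow> complex mat \<Rightarrow> complex" where
  "W_Lie n q z = (THE w. \<exists>u1\<in>U_dual n. \<exists>u2\<in>U_dual n.
     z = u1 * t_dual n q * M_dual n * u2 \<and>
     w = (\<Sum>i=1..n. eps_dual n i u1) + (\<Sum>i=1..n. eps_dual n i u2))"

text \<open>A point of the Lusztig torus has coordinates \<open>a i\<close> and \<open>c i\<close> for \<open>1 \<le> i \<le> n - 1\<close>, and
  \<open>b\<close>; other values of \<open>a\<close> and \<open>c\<close> are irrelevant.\<close>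

definition lusztig_u2 ::
    "nat \<Rightarrow> (nat \<Rightarrow> complex) \<Rightarrow> complex \<Rightarrow> (nat \<Rightarrow> complex) \<Rightarrow> complex mat" where
  "lusztig_u2 n a b c = foldr (*)
     (map (\<lambda>i. x_dual n i (a i)) [1..<n] @ [x_dual n n b] @
      map (\<lambda>i. x_dual n i (c i)) (rev [1..<n]))
     (1\<^sub>m (2*n + 1))"

definition W_Lus ::
    "nat \<Rightarrow> complex \<Rightarrow> (nat \<Rightarrow> complex) \<Rightarrow> complex \<Rightarrow> (nat \<Rightarrow> complex) \<Rightarrow> complex" where
  "W_Lus n q a b c = (let
       u2 = lusztig_u2 n a b c;
       u1 = (THE u1. u1 \<in> U_dual n \<and> u1 * t_dual n q * M_dual n * u2 \<in> B_dual n)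
     in W_Lie n q (u1 * t_dual n q * M_dual n * u2))"

end

theory Submission
  imports
    Defs
    "HOL-Computational_Algebra.Fundamental_Theorem_Algebra"
begin

text \<open>Write \<open>p\<close> for the point \<open>\<eta>(b)\<close> and \<open>Q\<^sub>k = \<Sum>\<^sub>i\<^sub>\<ge>\<^sub>k (-1)\<^sup>i p\<^sub>i p\<^sub>N\<^sub>-\<^sub>i\<close>. Up to sign the numbers
  \<open>Q\<^sub>1, \<dots>, Q\<^sub>N\<close> are \<open>p\<^sub>0 p\<^sub>N, F\<^sub>1, \<dots>, F\<^sub>n\<^sub>-\<^sub>1\<close>, because \<open>Q\<^sub>N\<^sub>+\<^sub>1\<^sub>-\<^sub>k = Q\<^sub>k\<close>. If \<open>b = u M u'\<close> lies in \<open>S\<close>, then the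
  truncation of \<open>p\<close> to the indices \<open>\<ge> k\<close> would be in the kernel of \<open>b\<close> if \<open>Q\<^sub>k\<close> vanished. Conversely, if
  all \<open>Q\<^sub>k\<close> are nonzero and \<open>p\<^sub>N = 1\<close>, then an explicit triangular matrix with entries rational in \<open>p\<close> is a
  preimage of \<open>p\<close>; that it is symplectic is a telescoping sum of \<open>1 / Q\<^sub>i\<^sub>+\<^sub>1 - 1 / Q\<^sub>i\<close>.
  The form \<open>p\<^sub>0 p\<^sub>N F\<^sub>1 \<cdots> F\<^sub>n\<^sub>-\<^sub>1\<close> is squarefree because it has \<open>2 n\<close> distinct zeros on a suitable line, and
  its divisor is therefore reduced of degree \<open>N + 1\<close>.

  On the dual side, the strictly upper triangular part of \<open>u\<^sub>2\<close> below the first row has rank one, with row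
  space spanned by the first row. Hence \<open>u\<^sub>1\<close> may be taken in the Heisenberg unipotent radical, and
  its only nonzero simple-root coordinate is \<open>\<epsilon>\<^sub>1(u\<^sub>1) = q (a\<^sub>1 + c\<^sub>1) / (u\<^sub>2)\<^sub>1\<^sub>,\<^sub>N\<^sub>'\<close>.\<close>

section \<open>Isometries of the antidiagonal form\<close>

text \<open>Both groups are isometry groups of one antidiagonal form with alternating signs, so
  inverses are given entrywise by a single adjoint formula that keeps triangularity visible. A
  preimage of a point comes from reading the factorization backwards: \<open>h\<close> is a
  symplectic unitriangular matrix with last column \<open>p\<close>, it plays the role of the
  inverse of \<open>u'\<close>, and \<open>b\<close> has to make \<open>b h M^-1\<close>
  unitriangular. Squarefreeness is tested on a line because a repeated prime factor keeps its degree
  on every line whose direction is not a zero of the form, and then leaves a double root there.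
  Describing the support requires a prime form through each zero; an induction on the degree yields
  it, and this rests on the fact that factors of forms are again forms. The superpotential is a
  definite description, so its value makes sense only because the sum of the simple-root coordinates
  is an additive character that is compatible with moving unipotent factors across
  \<open>t(q) M\<close>.\<close>

lemma mult_mat_entry:
  fixes A :: "'a :: semiring_0 mat"
  assumes "A \<in> carrier_mat d d'" "B \<in> carrier_mat d' e" "i < d" "j < e"
  shows "(A * B) $$ (i, j) = (\<Sum>k<d'. A $$ (i, k) * B $$ (k, j))"
  using assms by (simp add: scalar_prod_def lessThan_atLeast0)

text \<open>Common shape of \<open>J_C\<close> and \<open>J_dual\<close>: skew for even
  \<open>d\<close>, symmetric for odd \<open>d\<close>. The lemmas on its isometries serve both the
  symplectic and the orthogonal group.\<close>

definition anti_form :: "nat \<Rightarrow> complex mat" where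
  "anti_form d = mat d d (\<lambda>(i, j). if i + j + 1 = d then (-1) ^ i else 0)"

text \<open>This is \<open>J^-1 g^t J\<close> for \<open>J = anti_form d\<close>: the reflection of
  \<open>g\<close> in the antidiagonal with a checkerboard of signs.\<close>

definition form_adjoint :: "nat \<Rightarrow> complex mat \<Rightarrow> complex mat" where
  "form_adjoint d g = mat d d (\<lambda>(i, j). (-1) ^ (i + j) * g $$ (d - 1 - j, d - 1 - i))"

lemma J_C_eq: "J_C n = anti_form (2 * n)"
  by (rule eq_matI) (auto simp: J_C_def anti_form_def)

lemma J_dual_eq: "J_dual n = anti_form (2 * n + 1)"
  by (rule eq_matI) (auto simp: J_dual_def mat1_def anti_form_def)

lemma anti_form_carrier [simp]: "anti_form d \<in> carrier_mat d d"
  by (simp add: anti_form_def)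

lemma form_adjoint_carrier [simp]: "form_adjoint d g \<in> carrier_mat d d"
  by (simp add: form_adjoint_def)

lemma form_adjoint_dim [simp]: "dim_row (form_adjoint d g) = d" "dim_col (form_adjoint d g) = d"
  by (simp_all add: form_adjoint_def)

lemma form_adjoint_entry:
  "i < d \<Longrightarrow> j < d \<Longrightarrow> form_adjoint d g $$ (i, j) = (-1) ^ (i + j) * g $$ (d - 1 - j, d - 1 - i)"
  by (simp add: form_adjoint_def)

lemma minus_one_power_double [simp]: "(-1 :: complex) ^ (i + i) = 1" "(-1 :: complex) ^ i * (-1) ^ i = 1"
  by (simp_all flip: power_add)

lemma minus_one_power_flip:
  assumes "i < d" "j < d"
  shows "(-1 :: complex) ^ (d - 1 - i + (d - 1 - j)) = (-1) ^ (i + j)"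
proof -
  have "even (d - 1 - i + (d - 1 - j)) \<longleftrightarrow> even (i + j)"
  proof -
    have "(d - 1 - i + (d - 1 - j)) + (i + j) = 2 * (d - 1)" using assms by simp
    then show ?thesis by (metis dvd_triv_left even_add)
  qed
  then show ?thesis by (simp add: minus_one_power_iff)
qed

lemma form_adjoint_involution [simp]:
  assumes "g \<in> carrier_mat d d"
  shows "form_adjoint d (form_adjoint d g) = g"
proof (rule eq_matI)
  fix i j assume "i < dim_row g" "j < dim_col g"
  then have ij: "i < d" "j < d" using assms by auto
  have "form_adjoint d (form_adjoint d g) $$ (i, j) =
      ((-1) ^ (i + j) * (-1) ^ (d - 1 - j + (d - 1 - i))) * g $$ (i, j)"
    using ij by (simp add: form_adjoint_entry)
  also have "\<dots> = g $$ (i, j)"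
    unfolding minus_one_power_flip[OF ij(2,1)]
    by (simp add: add.commute[of j i])
  finally show "form_adjoint d (form_adjoint d g) $$ (i, j) = g $$ (i, j)" .
qed (use assms in auto)

lemma form_adjoint_mult:
  assumes g: "g \<in> carrier_mat d d" and h: "h \<in> carrier_mat d d"
  shows "form_adjoint d (g * h) = form_adjoint d h * form_adjoint d g"
proof (rule eq_matI)
  fix i j assume "i < dim_row (form_adjoint d h * form_adjoint d g)"
    "j < dim_col (form_adjoint d h * form_adjoint d g)"
  then have ij: "i < d" "j < d" by auto
  have "(form_adjoint d h * form_adjoint d g) $$ (i, j) =
      (\<Sum>k<d. form_adjoint d h $$ (i, k) * form_adjoint d g $$ (k, j))"
    using ij by (intro mult_mat_entry[where d = d and e = d]) auto
  also have "\<dots> = (\<Sum>k<d. (-1) ^ (i + j) * (g $$ (d - 1 - j, d - Suc k) * h $$ (d - Suc k, d - 1 - i)))"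
  proof (rule sum.cong)
    fix k assume k: "k \<in> {..<d}"
    have "(-1::complex) ^ (i + k) * (-1) ^ (k + j) = (-1) ^ (i + j)"
      by (simp add: power_add)
    then show "form_adjoint d h $$ (i, k) * form_adjoint d g $$ (k, j) =
      (-1) ^ (i + j) * (g $$ (d - 1 - j, d - Suc k) * h $$ (d - Suc k, d - 1 - i))"
      using ij k by (simp add: form_adjoint_entry)
  qed simp
  also have "\<dots> = (-1) ^ (i + j) * (\<Sum>k<d. g $$ (d - 1 - j, k) * h $$ (k, d - 1 - i))"
    unfolding sum_distrib_left[symmetric]
    by (subst sum.nat_diff_reindex[of "\<lambda>k. g $$ (d - 1 - j, k) * h $$ (k, d - 1 - i)"]) simp
  also have "(\<Sum>k<d. g $$ (d - 1 - j, k) * h $$ (k, d - 1 - i)) = (g * h) $$ (d - 1 - j, d - 1 - i)"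
    using ij by (intro mult_mat_entry[OF g h, symmetric]) auto
  finally show "form_adjoint d (g * h) $$ (i, j) = (form_adjoint d h * form_adjoint d g) $$ (i, j)"
    using ij by (simp add: form_adjoint_entry)
qed auto

lemma gram_entry:
  assumes g: "g \<in> carrier_mat d d" and jl: "j < d" "l < d"
  shows "(transpose_mat g * anti_form d * g) $$ (j, l) =
    (\<Sum>i<d. (-1) ^ i * g $$ (i, j) * g $$ (d - 1 - i, l))"
proof -
  have gT: "transpose_mat g \<in> carrier_mat d d" using g by simp
  have row: "(transpose_mat g * anti_form d) $$ (j, k) = g $$ (d - 1 - k, j) * (-1) ^ (d - 1 - k)"
    if k: "k < d" for k
  proof -
    have "(transpose_mat g * anti_form d) $$ (j, k) =
        (\<Sum>i<d. if i = d - 1 - k then g $$ (i, j) * (-1) ^ i else 0)"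
      unfolding mult_mat_entry[OF gT anti_form_carrier jl(1) k]
      using g jl k by (intro sum.cong) (auto simp: anti_form_def)
    then show ?thesis using k by simp
  qed
  have "(transpose_mat g * anti_form d * g) $$ (j, l) =
     (\<Sum>k<d. g $$ (d - 1 - k, j) * (-1) ^ (d - 1 - k) * g $$ (k, l))"
    using mult_mat_entry[OF mult_carrier_mat[OF gT anti_form_carrier] g jl] row by simp
  also have "\<dots> = (\<Sum>k<d. (\<lambda>i. (-1) ^ i * g $$ (i, j) * g $$ (d - 1 - i, l)) (d - Suc k))"
    by (rule sum.cong) auto
  also have "\<dots> = (\<Sum>i<d. (-1) ^ i * g $$ (i, j) * g $$ (d - 1 - i, l))"
    by (rule sum.nat_diff_reindex)
  finally show ?thesis .
qed

text \<open>Multiplying the Gram matrix by \<open>J^-1\<close> only reverses its rows and changes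
  signs. This turns preservation of the form into a statement about a left inverse.\<close>

lemma adjoint_mult_entry:
  assumes g: "g \<in> carrier_mat d d" and jl: "j < d" "l < d"
  shows "(form_adjoint d g * g) $$ (d - 1 - j, l) =
    (-1) ^ j * (transpose_mat g * anti_form d * g) $$ (j, l)"
proof -
  have sgn: "(-1::complex) ^ (d - 1 - j + (d - 1 - i)) = (-1) ^ j * (-1) ^ i" if "i < d" for i
    unfolding minus_one_power_flip[OF jl(1) that] by (rule power_add)
  have "(form_adjoint d g * g) $$ (d - 1 - j, l) =
      (\<Sum>k<d. form_adjoint d g $$ (d - 1 - j, k) * g $$ (k, l))"
    using jl by (intro mult_mat_entry[OF _ g]) auto
  also have "\<dots> = (\<Sum>k<d. (\<lambda>k. form_adjoint d g $$ (d - 1 - j, k) * g $$ (k, l)) (d - Suc k))"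
    by (rule sum.nat_diff_reindex[symmetric])
  also have "\<dots> = (\<Sum>i<d. (-1) ^ j * ((-1) ^ i * g $$ (i, j) * g $$ (d - 1 - i, l)))"
    using jl sgn by (intro sum.cong) (auto simp: form_adjoint_entry)
  also have "\<dots> = (-1) ^ j * (transpose_mat g * anti_form d * g) $$ (j, l)"
    unfolding gram_entry[OF g jl] sum_distrib_left ..
  finally show ?thesis .
qed

lemma preserves_form_iff:
  assumes g: "g \<in> carrier_mat d d"
  shows "transpose_mat g * anti_form d * g = anti_form d \<longleftrightarrow> form_adjoint d g * g = 1\<^sub>m d"
proof
  assume L: "transpose_mat g * anti_form d * g = anti_form d"
  show "form_adjoint d g * g = 1\<^sub>m d"
  proof (rule eq_matI)
    fix i l assume "i < dim_row (1\<^sub>m d)" "l < dim_col (1\<^sub>m d)"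
    then have il: "i < d" "l < d" by auto
    have "(form_adjoint d g * g) $$ (d - 1 - (d - 1 - i), l) = (-1) ^ (d - 1 - i) * anti_form d $$ (d - 1 - i, l)"
      using il by (subst adjoint_mult_entry[OF g]) (auto simp: L)
    then show "(form_adjoint d g * g) $$ (i, l) = 1\<^sub>m d $$ (i, l)"
      using il by (auto simp: anti_form_def)
  qed (use g in auto)
next
  assume R: "form_adjoint d g * g = 1\<^sub>m d"
  show "transpose_mat g * anti_form d * g = anti_form d"
  proof (rule eq_matI)
    fix j l assume "j < dim_row (anti_form d)" "l < dim_col (anti_form d)"
    then have jl: "j < d" "l < d" by (auto simp: anti_form_def)
    have "(-1) ^ j * (form_adjoint d g * g) $$ (d - 1 - j, l) =
      ((-1) ^ j * (-1) ^ j) * (transpose_mat g * anti_form d * g) $$ (j, l)"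
      unfolding adjoint_mult_entry[OF g jl] by (rule mult.assoc[symmetric])
    then have "(transpose_mat g * anti_form d * g) $$ (j, l) = (-1) ^ j * 1\<^sub>m d $$ (d - 1 - j, l)"
      by (simp add: R)
    then show "(transpose_mat g * anti_form d * g) $$ (j, l) = anti_form d $$ (j, l)"
      using jl by (auto simp: anti_form_def)
  qed (use g in \<open>auto simp: anti_form_def\<close>)
qed

definition isometries :: "nat \<Rightarrow> complex mat set" where
  "isometries d = {g \<in> carrier_mat d d. form_adjoint d g * g = 1\<^sub>m d}"

lemma isometries_carrier: "g \<in> isometries d \<Longrightarrow> g \<in> carrier_mat d d"
  by (simp add: isometries_def)

lemma isometries_left_inverse: "g \<in> isometries d \<Longrightarrow> form_adjoint d g * g = 1\<^sub>m d"
  by (simp add: isometries_def)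

lemma isometries_right_inverse: "g \<in> isometries d \<Longrightarrow> g * form_adjoint d g = 1\<^sub>m d"
  by (rule mat_mult_left_right_inverse[of _ d]) (auto simp: isometries_def)

lemma isometries_iff:
  "g \<in> isometries d \<longleftrightarrow> g \<in> carrier_mat d d \<and> transpose_mat g * anti_form d * g = anti_form d"
  using preserves_form_iff by (auto simp: isometries_def)

text \<open>The sum is the pairing of columns \<open>j\<close> and \<open>l\<close>. The matrices
  \<open>b\<close>, \<open>h\<close>, \<open>u1\<close> and \<open>dual_middle\<close> are verified
  through these pairings.\<close>

lemma isometriesI:
  assumes "g \<in> carrier_mat d d"
    and "\<And>j l. j < d \<Longrightarrow> l < d \<Longrightarrow> (\<Sum>i<d. (-1) ^ i * g $$ (i, j) * g $$ (d - 1 - i, l)) =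
       (if j + l + 1 = d then (-1) ^ j else 0)"
  shows "g \<in> isometries d"
  unfolding isometries_iff
proof (intro conjI eq_matI)
  fix j l assume "j < dim_row (anti_form d)" "l < dim_col (anti_form d)"
  then have "j < d" "l < d" by (auto simp: anti_form_def)
  then show "(transpose_mat g * anti_form d * g) $$ (j, l) = anti_form d $$ (j, l)"
    by (simp only: gram_entry[OF assms(1)] assms(2)) (simp add: anti_form_def)
qed (use assms in \<open>auto simp: anti_form_def\<close>)

lemma isometries_gram:
  assumes "g \<in> isometries d" "j < d" "l < d"
  shows "(\<Sum>i<d. (-1) ^ i * g $$ (i, j) * g $$ (d - 1 - i, l)) =
       (if j + l + 1 = d then (-1) ^ j else 0)"
proof -
  have "(\<Sum>i<d. (-1) ^ i * g $$ (i, j) * g $$ (d - 1 - i, l)) = anti_form d $$ (j, l)"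
    using assms gram_entry[of g d j l] by (simp add: isometries_iff)
  then show ?thesis using assms by (simp add: anti_form_def)
qed

lemma isometries_mult:
  assumes "g \<in> isometries d" "h \<in> isometries d"
  shows "g * h \<in> isometries d"
proof -
  have c: "g \<in> carrier_mat d d" "h \<in> carrier_mat d d"
    using assms by (auto dest: isometries_carrier)
  have "form_adjoint d (g * h) * (g * h) = form_adjoint d h * ((form_adjoint d g * g) * h)"
    unfolding form_adjoint_mult[OF c] using c
    by (simp add: assoc_mult_mat[of _ d d _ d _ d])
  then show ?thesis
    using assms c by (simp add: isometries_def)
qed

lemma isometries_adjoint:
  assumes "g \<in> isometries d"
  shows "form_adjoint d g \<in> isometries d"
  using assms isometries_right_inverse[OF assms] by (simp add: isometries_def)

section \<open>Triangular matrices among the isometries\<close>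

lemma upper_unitriangular_iff:
  assumes "g \<in> carrier_mat d d"
  shows "upper_unitriangular g \<longleftrightarrow>
    (\<forall>i<d. \<forall>j<i. g $$ (i, j) = 0) \<and> (\<forall>i<d. g $$ (i, i) = 1)"
  using assms by (auto simp: upper_unitriangular_def upper_triangular_def)

lemma lower_triangular_iff:
  assumes "g \<in> carrier_mat d d"
  shows "lower_triangular g \<longleftrightarrow> (\<forall>i<d. \<forall>j<d. i < j \<longrightarrow> g $$ (i, j) = 0)"
  using assms by (auto simp: lower_triangular_def upper_triangular_def)

text \<open>Reflection in the antidiagonal maps the diagonal and the region below it to themselves,
  so inverses of unitriangular isometries are unitriangular.\<close>

lemma upper_unitriangular_adjoint:
  assumes "g \<in> carrier_mat d d" "upper_unitriangular g"
  shows "upper_unitriangular (form_adjoint d g)"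
  using assms
  by (auto simp: upper_unitriangular_iff[of _ d] form_adjoint_entry)

lemma lower_triangular_adjoint:
  assumes "g \<in> carrier_mat d d" "lower_triangular g"
  shows "lower_triangular (form_adjoint d g)"
  using assms by (auto simp: lower_triangular_iff[of _ d] form_adjoint_entry)

lemma sum_eq_single:
  fixes f :: "'a \<Rightarrow> 'b :: comm_monoid_add"
  assumes "finite A" "k \<in> A" "\<And>i. i \<in> A \<Longrightarrow> i \<noteq> k \<Longrightarrow> f i = 0"
  shows "sum f A = f k"
  using assms sum.mono_neutral_right[of A "{k}" f] by auto

lemma sum_eq_pair:
  fixes f :: "'a \<Rightarrow> 'b :: comm_monoid_add"
  assumes "finite A" "k \<in> A" "l \<in> A" "k \<noteq> l" "\<And>i. i \<in> A \<Longrightarrow> i \<noteq> k \<Longrightarrow> i \<noteq> l \<Longrightarrow> f i = 0"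
  shows "sum f A = f k + f l"
  using assms sum.mono_neutral_right[of A "{k, l}" f] by auto

lemma upper_unitriangular_mult:
  assumes g: "g \<in> carrier_mat d d" "upper_unitriangular g"
    and h: "h \<in> carrier_mat d d" "upper_unitriangular h"
  shows "upper_unitriangular (g * h)"
  unfolding upper_unitriangular_iff[OF mult_carrier_mat[OF g(1) h(1)]]
proof (intro conjI allI impI)
  fix i j assume ij: "i < d" "j < i"
  have "g $$ (i, k) * h $$ (k, j) = 0" if "k < d" for k
    using assms ij that by (cases "k < i") (auto simp: upper_unitriangular_iff[of _ d])
  then show "(g * h) $$ (i, j) = 0"
    unfolding mult_mat_entry[OF g(1) h(1) ij(1) order.strict_trans[OF ij(2,1)]]
    by (intro sum.neutral) simp
next
  fix i assume i: "i < d"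
  have "(g * h) $$ (i, i) = (\<Sum>k<d. g $$ (i, k) * h $$ (k, i))"
    using i by (simp add: mult_mat_entry[OF g(1) h(1)])
  also have "\<dots> = g $$ (i, i) * h $$ (i, i)"
  proof (rule sum_eq_single)
    fix k assume "k \<in> {..<d}" "k \<noteq> i"
    then show "g $$ (i, k) * h $$ (k, i) = 0"
      using assms i by (cases "k < i") (auto simp: upper_unitriangular_iff[of _ d])
  qed (use i in auto)
  finally show "(g * h) $$ (i, i) = 1"
    using assms i by (simp add: upper_unitriangular_iff[of _ d])
qed

text \<open>Superdiagonal entries are additive characters; this makes the simple-root coordinates
  additive.\<close>

lemma upper_unitriangular_mult_superdiagonal:
  assumes g: "g \<in> carrier_mat d d" "upper_unitriangular g"
    and h: "h \<in> carrier_mat d d" "upper_unitriangular h" and i: "Suc i < d"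
  shows "(g * h) $$ (i, Suc i) = g $$ (i, Suc i) + h $$ (i, Suc i)"
proof -
  have "(g * h) $$ (i, Suc i) = (\<Sum>k<d. g $$ (i, k) * h $$ (k, Suc i))"
    using i by (simp add: mult_mat_entry[OF g(1) h(1)])
  also have "\<dots> = g $$ (i, i) * h $$ (i, Suc i) + g $$ (i, Suc i) * h $$ (Suc i, Suc i)"
  proof (rule sum_eq_pair)
    fix k assume "k \<in> {..<d}" "k \<noteq> i" "k \<noteq> Suc i"
    then show "g $$ (i, k) * h $$ (k, Suc i) = 0"
      using assms i by (cases "k < i") (auto simp: upper_unitriangular_iff[of _ d])
  qed (use i in auto)
  finally show ?thesis
    using assms i by (simp add: upper_unitriangular_iff[of _ d])
qed

lemma lower_triangular_mult:
  assumes g: "g \<in> carrier_mat d d" "lower_triangular g"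
    and h: "h \<in> carrier_mat d d" "lower_triangular h"
  shows "lower_triangular (g * h)"
  unfolding lower_triangular_iff[OF mult_carrier_mat[OF g(1) h(1)]]
proof (intro allI impI)
  fix i j assume ij: "i < d" "j < d" "i < j"
  have "g $$ (i, k) * h $$ (k, j) = 0" if "k < d" for k
    using assms ij that by (cases "k \<le> i") (auto simp: lower_triangular_iff[of _ d])
  then show "(g * h) $$ (i, j) = 0"
    unfolding mult_mat_entry[OF g(1) h(1) ij(1,2)]
    by (intro sum.neutral) simp
qed

text \<open>Opposite triangular groups meet trivially. This gives the uniqueness of
  \<open>u1\<close> and also verifies an inverse for \<open>x_dual n n\<close>.\<close>

lemma unitriangular_lower_eq_one:
  assumes "g \<in> carrier_mat d d" "upper_unitriangular g" "lower_triangular g"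
  shows "g = 1\<^sub>m d"
  using assms
  by (intro eq_matI) (auto simp: upper_unitriangular_iff[of _ d] lower_triangular_iff[of _ d] linorder_neq_iff)

lemma isometries_invertible:
  assumes "g \<in> isometries d"
  shows "invertible_mat g"
  unfolding invertible_mat_def inverts_mat_def
  using isometries_carrier[OF assms] isometries_left_inverse[OF assms] isometries_right_inverse[OF assms]
  by (auto intro!: exI[of _ "form_adjoint d g"])

lemma Sp_group_eq: "Sp_group n = isometries (2 * n)"
  by (auto simp: Sp_group_def J_C_eq isometries_iff isometries_invertible[of _ "2 * n"])

lemma SO_group_eq: "SO_group n = {g \<in> isometries (2 * n + 1). det g = 1}"
  by (auto simp: SO_group_def J_dual_eq isometries_iff)

section \<open>The type C open locus\<close>

lemma mult_mat_vec_entry: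
  fixes A :: "'a :: semiring_0 mat"
  assumes "A \<in> carrier_mat d d'" "v \<in> carrier_vec d'" "i < d"
  shows "(A *\<^sub>v v) $ i = (\<Sum>k<d'. A $$ (i, k) * v $ k)"
  using assms by (simp add: scalar_prod_def lessThan_atLeast0)

text \<open>Substitute \<open>d - 1 - i\<close> for \<open>i\<close>; the sign
  \<open>(-1) ^ (d - 1)\<close> records whether the form is skew or symmetric.\<close>

lemma gram_swap:
  fixes f g :: "nat \<Rightarrow> complex"
  shows "(\<Sum>i<d. (-1) ^ i * f i * g (d - 1 - i)) =
    (-1) ^ (d - 1) * (\<Sum>i<d. (-1) ^ i * g i * f (d - 1 - i))"
proof -
  have "(\<Sum>i<d. (-1) ^ i * f i * g (d - 1 - i)) =
      (\<Sum>i<d. (\<lambda>i. (-1) ^ i * f i * g (d - 1 - i)) (d - Suc i))"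
    by (rule sum.nat_diff_reindex[symmetric])
  also have "\<dots> = (\<Sum>i<d. (-1) ^ (d - 1) * ((-1) ^ i * g i * f (d - 1 - i)))"
  proof (rule sum.cong)
    fix i assume "i \<in> {..<d}"
    then have i: "i < d" by simp
    then have "d - 1 = (d - Suc i) + i" by simp
    then have "(-1 :: complex) ^ (d - 1) = (-1) ^ (d - Suc i) * (-1) ^ i" by (metis power_add)
    then show "(\<lambda>i. (-1) ^ i * f i * g (d - 1 - i)) (d - Suc i) =
        (-1) ^ (d - 1) * ((-1) ^ i * g i * f (d - 1 - i))"
      using i by simp
  qed simp
  finally show ?thesis by (simp add: sum_distrib_left)
qed

lemma gram_odd_self:
  fixes f :: "nat \<Rightarrow> complex"
  assumes "even d" "d > 0"
  shows "(\<Sum>i<d. (-1) ^ i * f i * f (d - 1 - i)) = 0"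
  using gram_swap[of f f d] assms by simp

text \<open>By \<open>gram_swap\<close> the pairings with \<open>j > l\<close> follow, which
  shortens the case distinctions for \<open>h\<close> and \<open>u1\<close>.\<close>

lemma isometriesI_le:
  assumes g: "g \<in> carrier_mat d d"
    and "\<And>j l. j \<le> l \<Longrightarrow> l < d \<Longrightarrow> (\<Sum>i<d. (-1) ^ i * g $$ (i, j) * g $$ (d - 1 - i, l)) =
       (if j + l + 1 = d then (-1) ^ j else 0)"
  shows "g \<in> isometries d"
proof (rule isometriesI[OF g])
  fix j l assume jl: "j < d" "l < d"
  show "(\<Sum>i<d. (-1) ^ i * g $$ (i, j) * g $$ (d - 1 - i, l)) = (if j + l + 1 = d then (-1) ^ j else 0)"
  proof (cases "j \<le> l")
    case False
    have "(\<Sum>i<d. (-1) ^ i * g $$ (i, j) * g $$ (d - 1 - i, l)) =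
        (-1) ^ (d - 1) * (if l + j + 1 = d then (-1) ^ l else 0)"
      using False jl assms(2)[of l j]
        gram_swap[of "\<lambda>i. g $$ (i, j)" "\<lambda>i. g $$ (i, l)" d] by simp
    moreover have "(-1 :: complex) ^ (d - 1) * (-1) ^ l = (-1) ^ j" if "l + j + 1 = d"
    proof -
      have "d - 1 = j + l" using that by simp
      then show ?thesis by (simp add: power_add)
    qed
    ultimately show ?thesis by (auto simp: add.commute)
  qed (use assms(2) jl in auto)
qed

section \<open>Tail pairings and their symmetry\<close>

definition tail_pairing :: "nat \<Rightarrow> (nat \<Rightarrow> complex) \<Rightarrow> nat \<Rightarrow> complex" where
  "tail_pairing N p k = (\<Sum>i=k..N. (-1) ^ i * p i * p (N - i))"

lemma tail_pairing_Suc: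
  "k \<le> N \<Longrightarrow> tail_pairing N p k = (-1) ^ k * p k * p (N - k) + tail_pairing N p (Suc k)"
  unfolding tail_pairing_def by (rule sum.atLeast_Suc_atMost)

lemma tail_pairing_self [simp]: "tail_pairing N p N = (-1) ^ N * p N * p 0"
  by (simp add: tail_pairing_def)

text \<open>The full sum pairs \<open>p\<close> with itself under a skew form.\<close>

lemma tail_pairing_zero:
  assumes "odd N"
  shows "tail_pairing N p 0 = 0"
proof -
  have "tail_pairing N p 0 = (\<Sum>i<Suc N. (-1) ^ i * p i * p (Suc N - 1 - i))"
    by (simp add: tail_pairing_def atLeast0AtMost lessThan_Suc_atMost)
  then show ?thesis
    using gram_odd_self[of "Suc N" p] assms by simp
qed

text \<open>As \<open>N\<close> is odd, the terms with indices \<open>k\<close> and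
  \<open>N - k\<close> are opposite, so the recursions from both ends run in parallel. They start
  from \<open>Q_0 = 0\<close> and from the empty sum at \<open>N + 1\<close>.\<close>

lemma tail_pairing_flip:
  assumes "odd N"
  shows "k \<le> N + 1 \<Longrightarrow> tail_pairing N p (N + 1 - k) = tail_pairing N p k"
proof (induction k)
  case 0
  then show ?case using tail_pairing_zero[OF assms] by (simp add: tail_pairing_def)
next
  case (Suc k)
  have "(N - k) + k = N" using Suc.prems by simp
  then have "even (N - k) \<longleftrightarrow> odd k" using assms by (metis even_add)
  then have sgn: "(-1 :: complex) ^ (N - k) = - ((-1) ^ k)" by (simp add: minus_one_power_iff)
  have "tail_pairing N p (N - k) = (-1) ^ (N - k) * p (N - k) * p k + tail_pairing N p (Suc (N - k))"
    using tail_pairing_Suc[of "N - k" N p] Suc.prems by simp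
  also have "Suc (N - k) = N + 1 - k" using Suc.prems by simp
  also have "tail_pairing N p (N + 1 - k) = tail_pairing N p k" using Suc by simp
  also have "\<dots> = (-1) ^ k * p k * p (N - k) + tail_pairing N p (Suc k)"
    using Suc.prems by (intro tail_pairing_Suc) simp
  finally show ?case using sgn by simp
qed

text \<open>The sum on the right is the value of \<open>F_C N r\<close> at \<open>p\<close>, so the
  tail pairings are the boundary forms up to sign.\<close>

lemma tail_pairing_alternating_sum:
  assumes "r \<le> N"
  shows "tail_pairing N p (N - r) = (-1) ^ (N - r) * (\<Sum>j=0..r. (-1) ^ j * p (r - j) * p (N - r + j))"
proof -
  define m where "m = N - r"
  have N: "N = r + m" using assms by (simp add: m_def)
  have "tail_pairing N p m = (\<Sum>j=0..r. (-1) ^ (j + m) * p (j + m) * p (N - (j + m)))"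
    unfolding tail_pairing_def N
    using sum.shift_bounds_cl_nat_ivl[of "\<lambda>i. (-1) ^ i * p i * p (r + m - i)" 0 m r] by simp
  also have "\<dots> = (\<Sum>j=0..r. (-1) ^ m * ((-1) ^ j * p (r - j) * p (m + j)))"
    by (intro sum.cong) (auto simp: power_add add.commute N)
  finally show ?thesis by (simp add: sum_distrib_left N)
qed

section \<open>The signed permutation matrix M\<close>

lemma M_C_carrier [simp]: "M_C n \<in> carrier_mat (2 * n) (2 * n)"
  by (simp add: M_C_def)

lemma M_C_entry:
  assumes "2 * n = Suc N" "i \<le> N" "j \<le> N"
  shows "M_C n $$ (i, j) = (if i = 0 \<and> j = N then -1 else if i = N \<and> j = 0 then 1
    else if i = j \<and> i \<noteq> 0 \<and> i \<noteq> N then -1 else 0)"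
proof -
  have "2 * n - 1 = N" "2 * n - 2 = N - 1" using assms by auto
  then show ?thesis using assms by (auto simp: M_C_def)
qed

lemma M_C_mult_entry:
  assumes X: "X \<in> carrier_mat (2 * n) (2 * n)" and N: "2 * n = Suc N" and ij: "i \<le> N" "j \<le> N"
  shows "(M_C n * X) $$ (i, j) =
    (if i = 0 then - X $$ (N, j) else if i = N then X $$ (0, j) else - X $$ (i, j))"
proof -
  define k where "k = (if i = 0 then N else if i = N then 0 else i)"
  have k: "k \<le> N" using ij by (simp add: k_def)
  have "N \<noteq> 0" using N by presburger
  have "(M_C n * X) $$ (i, j) = (\<Sum>k<2 * n. M_C n $$ (i, k) * X $$ (k, j))"
    using ij by (intro mult_mat_entry[OF M_C_carrier X]) (auto simp: N)
  also have "\<dots> = M_C n $$ (i, k) * X $$ (k, j)"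
  proof (rule sum_eq_single)
    fix l assume "l \<in> {..<2 * n}" "l \<noteq> k"
    then have "M_C n $$ (i, l) = 0"
      using ij by (subst M_C_entry[OF N]) (auto simp: k_def N split: if_splits)
    then show "M_C n $$ (i, l) * X $$ (l, j) = 0" by simp
  qed (use k N in auto)
  also have "M_C n $$ (i, k) = (if i = N then 1 else -1)"
    using \<open>N \<noteq> 0\<close> by (subst M_C_entry[OF N ij(1) k]) (cases "i = 0"; cases "i = N"; simp add: k_def)
  finally show ?thesis
    using \<open>N \<noteq> 0\<close> by (simp add: k_def)
qed

text \<open>Right multiplication by what turns out to be \<open>M^-1\<close>. It first shows that
  \<open>M_C\<close> is an isometry and later computes \<open>b h M^-1\<close>.\<close>

lemma mult_M_C_adjoint_entry:
  assumes X: "X \<in> carrier_mat (2 * n) (2 * n)" and N: "2 * n = Suc N" and ij: "i \<le> N" "j \<le> N"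
  shows "(X * form_adjoint (2 * n) (M_C n)) $$ (i, j) =
    (if j = 0 then - X $$ (i, N) else if j = N then X $$ (i, 0) else - X $$ (i, j))"
proof -
  define k where "k = (if j = 0 then N else if j = N then 0 else j)"
  have k: "k \<le> N" using ij by (simp add: k_def)
  have odd: "odd N" using N by presburger
  then have "N \<noteq> 0" by (auto dest: odd_pos)
  have adj: "form_adjoint (2 * n) (M_C n) $$ (l, j) = (if j = 0 \<and> l = N then -1
      else if j = N \<and> l = 0 then 1 else if l = j \<and> l \<noteq> 0 \<and> l \<noteq> N then -1 else 0)" if l: "l \<le> N" for l
  proof -
    have "form_adjoint (2 * n) (M_C n) $$ (l, j) = (-1) ^ (l + j) * M_C n $$ (N - j, N - l)"
      using l ij by (simp add: form_adjoint_entry N)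
    moreover have "N - j = 0 \<longleftrightarrow> j = N" "N - l = 0 \<longleftrightarrow> l = N" "N - j = N \<longleftrightarrow> j = 0"
        "N - l = N \<longleftrightarrow> l = 0" "N - j = N - l \<longleftrightarrow> j = l"
      using l ij \<open>N \<noteq> 0\<close> by auto
    moreover have "(-1 :: complex) ^ (l + j) = (if even (l + j) then 1 else -1)"
      by (simp add: minus_one_power_iff)
    ultimately show ?thesis
      using odd M_C_entry[OF N, of "N - j" "N - l"] by auto
  qed
  have "(X * form_adjoint (2 * n) (M_C n)) $$ (i, j) =
      (\<Sum>k<2 * n. X $$ (i, k) * form_adjoint (2 * n) (M_C n) $$ (k, j))"
    using ij by (intro mult_mat_entry[OF X form_adjoint_carrier]) (auto simp: N)
  also have "\<dots> = X $$ (i, k) * form_adjoint (2 * n) (M_C n) $$ (k, j)"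
  proof (rule sum_eq_single)
    fix l assume "l \<in> {..<2 * n}" "l \<noteq> k"
    then have "l \<le> N" by (simp add: N)
    have "form_adjoint (2 * n) (M_C n) $$ (l, j) = 0"
      using \<open>l \<noteq> k\<close> \<open>N \<noteq> 0\<close> unfolding adj[OF \<open>l \<le> N\<close>]
      by (cases "j = 0"; cases "j = N"; auto simp: k_def)
    then show "X $$ (i, l) * form_adjoint (2 * n) (M_C n) $$ (l, j) = 0" by simp
  qed (use k N in auto)
  also have "form_adjoint (2 * n) (M_C n) $$ (k, j) = (if j = N then 1 else -1)"
    using \<open>N \<noteq> 0\<close> by (subst adj[OF k]) (cases "j = 0"; cases "j = N"; simp add: k_def)
  finally show ?thesis
    using \<open>N \<noteq> 0\<close> by (simp add: k_def)
qed

lemma M_C_isometry: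
  assumes N: "2 * n = Suc N"
  shows "M_C n \<in> isometries (2 * n)"
proof -
  have "N \<noteq> 0" using N by presburger
  have "M_C n * form_adjoint (2 * n) (M_C n) = 1\<^sub>m (2 * n)"
  proof (rule eq_matI)
    fix i j assume "i < dim_row (1\<^sub>m (2 * n))" "j < dim_col (1\<^sub>m (2 * n))"
    then have ij: "i \<le> N" "j \<le> N" by (auto simp: N)
    then show "(M_C n * form_adjoint (2 * n) (M_C n)) $$ (i, j) = 1\<^sub>m (2 * n) $$ (i, j)"
      using \<open>N \<noteq> 0\<close> by (subst mult_M_C_adjoint_entry[OF M_C_carrier N]) (auto simp: M_C_entry[OF N] N)
  qed (auto simp: M_C_def)
  then show ?thesis
    by (auto simp: isometries_def intro: mat_mult_left_right_inverse)
qed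

lemma upper_unitriangular_last_row_mult:
  assumes "u \<in> carrier_mat d d" "upper_unitriangular u" "X \<in> carrier_mat d d" "j < d"
  shows "(u * X) $$ (d - 1, j) = X $$ (d - 1, j)"
proof -
  have "(u * X) $$ (d - 1, j) = (\<Sum>k<d. u $$ (d - 1, k) * X $$ (k, j))"
    using assms by (intro mult_mat_entry[of _ d d _ d]) auto
  also have "\<dots> = u $$ (d - 1, d - 1) * X $$ (d - 1, j)"
    by (rule sum_eq_single) (use assms in \<open>auto simp: upper_unitriangular_iff[of _ d]\<close>)
  finally show ?thesis using assms by (simp add: upper_unitriangular_iff[of _ d])
qed

lemma row_mult_J_C:
  assumes b: "b \<in> carrier_mat (2 * n) (2 * n)" and N: "2 * n = Suc N" and j: "j \<le> N"
  shows "row (b * J_C n) N $ j = (-1) ^ (N - j) * b $$ (N, N - j)"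
proof -
  have c: "J_C n \<in> carrier_mat (2 * n) (2 * n)" by (simp add: J_C_def)
  have J: "J_C n $$ (k, j) = (if k = N - j then (-1) ^ k else 0)" if "k \<le> N" for k
    using that j by (auto simp: J_C_def N)
  have "row (b * J_C n) N $ j = (b * J_C n) $$ (N, j)"
    using b c j N by (intro index_row) auto
  also have "\<dots> = (\<Sum>k<2 * n. b $$ (N, k) * J_C n $$ (k, j))"
    using j by (intro mult_mat_entry[OF b c]) (auto simp: N)
  also have "\<dots> = b $$ (N, N - j) * J_C n $$ (N - j, j)"
    by (rule sum_eq_single) (auto simp: N J)
  finally show ?thesis by (simp add: J)
qed

text \<open>Left multiplication by \<open>u\<close> keeps the last row, and the last row of
  \<open>M u'\<close> is row 0 of \<open>u'\<close>. Hence \<open>p\<close> is row 0 of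
  \<open>u'\<close> up to order and signs, and \<open>p N = 1\<close> comes from the diagonal of
  \<open>u'\<close>.\<close>

lemma open_locus_nonvanishing:
  assumes N: "2 * n = Suc N" and b: "b \<in> S_C n"
  defines "p \<equiv> (\<lambda>i. row (b * J_C n) N $ i)"
  shows "p N = 1" and "\<And>k. 1 \<le> k \<Longrightarrow> k \<le> N \<Longrightarrow> tail_pairing N p k \<noteq> 0"
proof -
  let ?d = "2 * n"
  have "N \<noteq> 0" using N by presburger
  obtain u u' where u: "u \<in> isometries ?d" "upper_unitriangular u"
    and u': "u' \<in> isometries ?d" "upper_unitriangular u'" and bu: "b = u * M_C n * u'"
    and bi: "b \<in> isometries ?d" and bl: "lower_triangular b"
    using b by (auto simp: S_C_def U_plus_def B_minus_def Sp_group_eq)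
  have c: "u \<in> carrier_mat ?d ?d" "u' \<in> carrier_mat ?d ?d" "b \<in> carrier_mat ?d ?d"
    using u u' bi by (auto dest: isometries_carrier)
  have u'_entry: "u' $$ (i, j) = 0" if "j < i" "i \<le> N" for i j
    using u'(2) c that by (auto simp: upper_unitriangular_iff[of _ ?d] N)
  have u_entry: "u $$ (i, j) = 0" if "j < i" "i \<le> N" for i j
    using u(2) c that by (auto simp: upper_unitriangular_iff[of _ ?d] N)
  have b_entry: "b $$ (i, j) = 0" if "i < j" "j \<le> N" for i j
    using bl c that by (auto simp: lower_triangular_iff[of _ ?d] N)
  have b_eq: "b = u * (M_C n * u')"
    unfolding bu using c by (intro assoc_mult_mat) auto
  have b_last: "b $$ (N, j) = u' $$ (0, j)" if "j \<le> N" for j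
  proof -
    have "b $$ (N, j) = (M_C n * u') $$ (N, j)"
    proof -
      have "j < ?d" using that N by simp
      from upper_unitriangular_last_row_mult[OF c(1) u(2) mult_carrier_mat[OF M_C_carrier c(2)] this]
      show ?thesis unfolding b_eq by (simp only: N diff_Suc_1)
    qed
    then show ?thesis using that \<open>N \<noteq> 0\<close> by (simp add: M_C_mult_entry[OF c(2) N])
  qed
  have p: "p j = (-1) ^ (N - j) * u' $$ (0, N - j)" if "j \<le> N" for j
    using that by (simp add: p_def row_mult_J_C[OF c(3) N] b_last)
  show pN: "p N = 1"
    using p[of N] u' c by (auto simp: upper_unitriangular_iff[of _ ?d] N)
  have row0: "u' $$ (0, j) = (-1) ^ j * p (N - j)" if "j \<le> N" for j
    using p[of "N - j"] that by (simp flip: mult.assoc)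
  \<comment> \<open>The adjoint turns row 0 into the last column, so \<open>p\<close> is the last
    column of the inverse of \<open>u'\<close>, and \<open>u'\<close> maps \<open>p\<close> to the
    last basis vector.\<close>
  have p_adj: "p j = form_adjoint ?d u' $$ (j, N)" if "j \<le> N" for j
  proof -
    have "(N - j) + (j + N) = 2 * N" using that by simp
    then have "even (N - j) \<longleftrightarrow> even (j + N)" by (metis dvd_triv_left even_add)
    then have "(-1 :: complex) ^ (N - j) = (-1) ^ (j + N)" by (simp add: minus_one_power_iff)
    then show ?thesis using p[OF that] that by (simp add: form_adjoint_entry N)
  qed
  have u'p: "(\<Sum>j<?d. u' $$ (i, j) * p j) = (if i = N then 1 else 0)" if "i \<le> N" for i
  proof -
    have "(u' * form_adjoint ?d u') $$ (i, N) = (\<Sum>j<?d. u' $$ (i, j) * form_adjoint ?d u' $$ (j, N))"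
      using that by (intro mult_mat_entry[OF c(2) form_adjoint_carrier]) (auto simp: N)
    also have "\<dots> = (\<Sum>j<?d. u' $$ (i, j) * p j)"
      by (intro sum.cong) (auto simp: p_adj N)
    finally show ?thesis
      using isometries_right_inverse[OF u'(1)] that by (simp add: N)
  qed
  fix k assume k: "1 \<le> k" "k \<le> N"
  show "tail_pairing N p k \<noteq> 0"
  proof
    assume Q: "tail_pairing N p k = 0"
    \<comment> \<open>The truncation of \<open>p\<close> to the indices \<open>\<ge> k\<close> lies in the kernel of the invertible matrix \<open>b\<close>.\<close>
    define w where "w = vec ?d (\<lambda>i. if i < k then 0 else p i)"
    have wc: "w \<in> carrier_vec ?d" by (simp add: w_def)
    have w: "w $ j = (if j < k then 0 else p j)" if "j \<le> N" for j
      using that by (simp add: w_def N)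
    have Mc: "M_C n * u' \<in> carrier_mat ?d ?d" by (rule mult_carrier_mat[OF M_C_carrier c(2)])
    \<comment> \<open>For \<open>k <= l < N\<close> the row \<open>l\<close> of the upper triangular
      \<open>u'\<close> sees only indices from \<open>k\<close> on, so the truncation changes
      nothing and \<open>u' p\<close> decides. Row \<open>N\<close> of \<open>M u'\<close> is row 0
      of \<open>u'\<close> and produces \<open>Q_k\<close>.\<close>
    have Mw: "((M_C n * u') *\<^sub>v w) $ l = 0" if l: "k \<le> l" "l \<le> N" for l
    proof -
      have "((M_C n * u') *\<^sub>v w) $ l = (\<Sum>j<?d. (M_C n * u') $$ (l, j) * w $ j)"
        using l by (intro mult_mat_vec_entry[OF Mc wc]) (simp add: N)
      also have "\<dots> = 0"
      proof (cases "l = N")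
        case True
        have "(\<Sum>j<?d. (M_C n * u') $$ (l, j) * w $ j) =
            (\<Sum>j<?d. if j \<in> {k..N} then (-1) ^ j * p j * p (N - j) else 0)"
          using True l \<open>N \<noteq> 0\<close> by (intro sum.cong) (auto simp: M_C_mult_entry[OF c(2) N] w row0 N)
        also have "\<dots> = (\<Sum>j\<in>{..<?d} \<inter> {k..N}. (-1) ^ j * p j * p (N - j))"
          by (subst sum.inter_restrict) auto
        also have "{..<?d} \<inter> {k..N} = {k..N}" by (auto simp: N)
        finally show ?thesis using Q by (simp add: tail_pairing_def)
      next
        case False
        have "(\<Sum>j<?d. (M_C n * u') $$ (l, j) * w $ j) = (\<Sum>j<?d. - (u' $$ (l, j) * p j))"
          using False l k by (intro sum.cong) (auto simp: M_C_mult_entry[OF c(2) N] w u'_entry N)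
        then show ?thesis using u'p[OF l(2)] False by (simp add: sum_negf)
      qed
      finally show ?thesis .
    qed
    \<comment> \<open>Rows above \<open>k\<close> vanish because \<open>b\<close> is lower
      triangular. The others vanish because \<open>u\<close> is upper triangular and
      \<open>M u' w\<close> is zero from \<open>k\<close> on.\<close>
    have bw: "(b *\<^sub>v w) $ i = 0" if i: "i \<le> N" for i
    proof (cases "i < k")
      case True
      have "(b *\<^sub>v w) $ i = (\<Sum>j<?d. b $$ (i, j) * w $ j)"
        using i by (intro mult_mat_vec_entry[OF c(3) wc]) (simp add: N)
      also have "\<dots> = 0"
        using True by (intro sum.neutral) (auto simp: w b_entry N)
      finally show ?thesis .
    next
      case False
      have "(b *\<^sub>v w) = u *\<^sub>v ((M_C n * u') *\<^sub>v w)"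
        unfolding b_eq by (rule assoc_mult_mat_vec[OF c(1) Mc wc])
      moreover have "(u *\<^sub>v ((M_C n * u') *\<^sub>v w)) $ i =
          (\<Sum>l<?d. u $$ (i, l) * ((M_C n * u') *\<^sub>v w) $ l)"
        using i by (intro mult_mat_vec_entry[OF c(1) mult_mat_vec_carrier[OF Mc wc]]) (simp add: N)
      moreover have "\<dots> = 0"
      proof (intro sum.neutral ballI)
        fix l assume "l \<in> {..<?d}"
        then show "u $$ (i, l) * ((M_C n * u') *\<^sub>v w) $ l = 0"
          using False Mw[of l] i by (cases "l < i") (auto simp: u_entry N)
      qed
      ultimately show ?thesis by simp
    qed
    have "b *\<^sub>v w = 0\<^sub>v ?d"
      by (rule eq_vecI) (use bw c in \<open>auto simp: N less_Suc_eq_le\<close>)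
    then have "form_adjoint ?d b *\<^sub>v (b *\<^sub>v w) = 0\<^sub>v ?d"
      by (intro eq_vecI) (auto simp: scalar_prod_def)
    moreover have "form_adjoint ?d b *\<^sub>v (b *\<^sub>v w) = w"
      using assoc_mult_mat_vec[OF form_adjoint_carrier[of ?d b] c(3) wc] isometries_left_inverse[OF bi] wc by simp
    ultimately have "w = 0\<^sub>v (Suc N)" by (simp add: N)
    then have "w $ N = 0" by simp
    then show False using pN k by (simp add: w)
  qed
qed

section \<open>Construction of a preimage\<close>

lemma sum_lessThan_Suc_upper_triangle:
  fixes f :: "nat \<Rightarrow> 'a :: comm_monoid_add"
  assumes "k \<le> N" "\<And>i. k < i \<Longrightarrow> i \<le> N \<Longrightarrow> f i = 0"
  shows "(\<Sum>i<Suc N. f i) = (\<Sum>i<k. f i) + f k"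
proof -
  have "(\<Sum>i<Suc N. f i) = (\<Sum>i<Suc k. f i)"
    using assms by (intro sum.mono_neutral_right) auto
  then show ?thesis by simp
qed

locale open_locus_point =
  fixes n N :: nat and p :: "nat \<Rightarrow> complex"
  assumes N: "2 * n = Suc N" and pN: "p N = 1"
    and nz: "\<And>k. 1 \<le> k \<Longrightarrow> k \<le> N \<Longrightarrow> tail_pairing N p k \<noteq> 0"
begin

lemma N_pos: "N \<noteq> 0" and odd_N: "odd N"
  using N by presburger+

text \<open>If \<open>b = u M u'\<close> and \<open>s\<close> is the last column of \<open>u\<close>, then \<open>b\<close> maps the truncation of \<open>p\<close> to the indices
  \<open>\<ge> k\<close> to \<open>Q k\<close> times the truncation of \<open>s\<close>; comparing \<open>k\<close> with \<open>k + 1\<close> forces the values of \<open>s\<close> and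
  of the diagonal \<open>D\<close> below, and the entries \<open>x k * s i\<close> of \<open>b\<close>.\<close>

definition x where "x i = (-1) ^ i * p (N - i)"
definition Q where "Q k = tail_pairing N p k"
definition s where "s i = (if i = 0 then 1 / x N else if i = N then 1 else - p i / Q (Suc i))"
definition D where "D i = (if i = 0 then 1 / x N else if i = N then x N else - Q i / Q (Suc i))"

definition b where
  "b = mat (Suc N) (Suc N) (\<lambda>(i, k). if i < k then 0 else if i = k then D i else x k * s i)"

text \<open>The element of the Heisenberg unipotent radical with last column \<open>p\<close>.\<close>

definition h where
  "h = mat (Suc N) (Suc N) (\<lambda>(i, j). if j = N then p i else if i = j then 1
     else if i = 0 then - x j else 0)"

lemma Q_nz: "1 \<le> k \<Longrightarrow> k \<le> N \<Longrightarrow> Q k \<noteq> 0"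
  unfolding Q_def by (rule nz)

lemma Q_step: "k \<le> N \<Longrightarrow> Q k = x k * p k + Q (Suc k)"
  unfolding Q_def x_def by (subst tail_pairing_Suc) (auto simp: mult_ac)

lemma Q_flip: "k \<le> Suc N \<Longrightarrow> Q (Suc N - k) = Q k"
  unfolding Q_def using tail_pairing_flip[OF odd_N, of k p] by simp

lemma Q_0: "Q 0 = 0"
  unfolding Q_def by (rule tail_pairing_zero[OF odd_N])

lemma x_0: "x 0 = 1"
  by (simp add: x_def pN)

lemma x_N: "x N = - p 0"
  using odd_N by (simp add: x_def)

lemma Q_N: "Q N = x N"
  by (simp add: Q_def x_def pN)

lemma Q_1: "Q 1 = x N"
  using Q_flip[of 1] Q_N by simp

lemma x_N_nz: "x N \<noteq> 0"
  using Q_nz[of N] N_pos Q_N by simp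

lemma p_eq: "k \<le> N \<Longrightarrow> p (N - k) = (-1) ^ k * x k"
  by (simp add: x_def flip: mult.assoc)

text \<open>Initial sums and tails add up to \<open>Q 0 = 0\<close>.\<close>

lemma sum_x_p: "i \<le> Suc N \<Longrightarrow> (\<Sum>k<i. x k * p k) = - Q i"
  by (induction i) (auto simp: Q_0 Q_step)

lemma b_carrier: "b \<in> carrier_mat (Suc N) (Suc N)"
  by (simp add: b_def)

lemma h_carrier: "h \<in> carrier_mat (Suc N) (Suc N)"
  by (simp add: h_def)

text \<open>Pairing of a diagonal with a subdiagonal entry: the end terms of the telescoping sum in
  \<open>b_isometry\<close>.\<close>

lemma D_s: 
  assumes "j < N"
  shows "(-1) ^ j * D j * s (N - j) = x j / Q (Suc j)"
proof (cases "j = 0")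
  case True
  then show ?thesis using N_pos Q_1 by (simp add: D_def s_def x_0)
next
  case False
  have "Suc (N - j) = Suc N - j" using assms by simp
  then have "Q (Suc (N - j)) = Q j" using Q_flip[of j] assms by simp
  moreover have "Q j \<noteq> 0" "Q (Suc j) \<noteq> 0" using Q_nz[of j] Q_nz[of "Suc j"] assms False by auto
  moreover have "N - j \<noteq> 0" "N - j \<noteq> N" using assms False by auto
  ultimately show ?thesis
    using False assms p_eq[of j] by (simp add: D_def s_def field_simps)
qed

text \<open>By \<open>Q_flip\<close> the quotients in \<open>D j\<close> and
  \<open>D (N - j)\<close> are reciprocal; at the two ends this is built into the definition of
  \<open>D\<close>.\<close>

lemma D_D:
  assumes "j \<le> N"
  shows "D j * D (N - j) = 1"
proof (cases "j = 0 \<or> j = N")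
  case True
  then show ?thesis using N_pos x_N_nz by (auto simp: D_def)
next
  case False
  have "Suc (N - j) = Suc N - j" using assms by simp
  then have "Q (Suc (N - j)) = Q j" using Q_flip[of j] assms by simp
  moreover have "Q (N - j) = Q (Suc j)" using Q_flip[of "Suc j"] assms by simp
  moreover have "Q j \<noteq> 0" "Q (Suc j) \<noteq> 0" using Q_nz[of j] Q_nz[of "Suc j"] assms False by auto
  moreover have "N - j \<noteq> 0" "N - j \<noteq> N" using assms False by auto
  ultimately show ?thesis using False by (simp add: D_def)
qed

text \<open>By \<open>Q_flip\<close> the two denominators are \<open>Q i\<close> and
  \<open>Q (Suc i)\<close>, and \<open>Q_step\<close> makes the numerator \<open>x i * p i\<close>
  their difference.\<close>

lemma s_s:
  assumes "1 \<le> i" "i < N"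
  shows "(-1) ^ i * s i * s (N - i) = 1 / Q (Suc i) - 1 / Q i"
proof -
  have "Suc (N - i) = Suc N - i" using assms by simp
  then have "Q (Suc (N - i)) = Q i" using Q_flip[of i] assms by simp
  moreover have nz: "Q i \<noteq> 0" "Q (Suc i) \<noteq> 0" using Q_nz[of i] Q_nz[of "Suc i"] assms by auto
  moreover have "N - i \<noteq> 0" "N - i \<noteq> N" using assms by auto
  ultimately have "(-1) ^ i * s i * s (N - i) = x i * p i / (Q (Suc i) * Q i)"
    using assms by (simp add: s_def p_eq field_simps)
  also have "x i * p i = Q i - Q (Suc i)" using Q_step[of i] assms by simp
  finally show ?thesis using nz by (simp add: field_simps)
qed

lemma b_entry: "i \<le> N \<Longrightarrow> k \<le> N \<Longrightarrow>
    b $$ (i, k) = (if i < k then 0 else if i = k then D i else x k * s i)"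
  by (simp add: b_def)

lemma b_isometry: "b \<in> isometries (Suc N)"
proof (rule isometriesI[OF b_carrier])
  fix j l assume "j < Suc N" "l < Suc N"
  then have jl: "j \<le> N" "l \<le> N" by auto
  let ?t = "\<lambda>i. (-1) ^ i * b $$ (i, j) * b $$ (N - i, l)"
  \<comment> \<open>Triangularity leaves the range \<open>j <= i <= N - l\<close>; whether it is
    empty, one point or longer gives the three cases.\<close>
  have t0: "?t i = 0" if "i \<le> N" "i < j \<or> N < i + l" for i
    using that jl by (auto simp: b_entry)
  consider "N < j + l" | "j + l = N" | "j + l < N" by linarith
  then have "(\<Sum>i<Suc N. ?t i) = (if j + l = N then (-1) ^ j else 0)"
  proof cases
    case 1
    have "?t i = 0" if "i < Suc N" for i
      using that 1 by (intro t0) linarith+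
    then show ?thesis using 1 by (simp add: sum.neutral del: sum.lessThan_Suc)
  next
    case 2
    have "?t i = 0" if "i < Suc N" "i \<noteq> j" for i
      using that 2 by (intro t0) linarith+
    then have "(\<Sum>i<Suc N. ?t i) = ?t j"
      using jl by (intro sum_eq_single) auto
    also have "\<dots> = (-1) ^ j * (D j * D (N - j))"
    proof -
      have "N - j = l" using 2 by simp
      then show ?thesis using jl by (simp add: b_entry)
    qed
    finally show ?thesis using 2 D_D[OF jl(1)] by simp
  next
    case 3
    define m where "m = N - l"
    have m: "j < m" "m \<le> N" "N - m = l" using 3 by (auto simp: m_def)
    have "(\<Sum>i<Suc N. ?t i) = (\<Sum>i\<in>{j..<Suc m}. ?t i)"
    proof (rule sum.mono_neutral_right)
      show "\<forall>i\<in>{..<Suc N} - {j..<Suc m}. ?t i = 0"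
        using m by (intro ballI t0) auto
    qed (use m in auto)
    \<comment> \<open>Each end term contains one diagonal entry; together they cancel the two ends
      of the telescoped interior sum.\<close>
    also have "\<dots> = ?t j + (\<Sum>i=Suc j..<m. ?t i) + ?t m"
      using m by (simp add: sum.atLeast_Suc_lessThan)
    also have "(\<Sum>i=Suc j..<m. ?t i) = (\<Sum>i=Suc j..<m. x j * x l * (1 / Q (Suc i) - 1 / Q i))"
    proof (rule sum.cong)
      fix i assume i: "i \<in> {Suc j..<m}"
      have "?t i = x j * x l * ((-1) ^ i * s i * s (N - i))"
      proof -
        have "i \<le> N" "j < i" "l < N - i" using i m by auto
        then show ?thesis using jl by (simp add: b_entry)
      qed
      also have "(-1) ^ i * s i * s (N - i) = 1 / Q (Suc i) - 1 / Q i"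
        using i m by (intro s_s) auto
      finally show "?t i = x j * x l * (1 / Q (Suc i) - 1 / Q i)" .
    qed simp
    also have "\<dots> = x j * x l * (1 / Q m - 1 / Q (Suc j))"
      using sum_Suc_diff'[of "Suc j" m "\<lambda>i. 1 / Q i"] m by (simp flip: sum_distrib_left)
    also have "?t j = x l * ((-1) ^ j * D j * s (N - j))"
    proof -
      have "l < N - j" using m by auto
      then show ?thesis using jl by (simp add: b_entry)
    qed
    also have "\<dots> = x j * x l / Q (Suc j)"
      using D_s[of j] m by simp
    also have "?t m = - x j * x l / Q m"
    proof -
      \<comment> \<open>As \<open>m + l = N\<close> is odd, the upper end term is the lower one with
        \<open>j\<close> and \<open>l\<close> exchanged and the opposite sign.\<close>
      have "even m \<longleftrightarrow> odd l" using odd_N m by (metis even_add le_add_diff_inverse)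
      then have "(-1 :: complex) ^ m = - ((-1) ^ l)" by (simp add: minus_one_power_iff)
      then have "?t m = - x j * ((-1) ^ l * D l * s (N - l))"
        using m jl by (simp add: b_entry m_def)
      also have "(-1) ^ l * D l * s (N - l) = x l / Q (Suc l)"
        using m by (intro D_s) linarith
      also have "Q (Suc l) = Q m"
        using Q_flip[of "Suc l"] m by (simp add: m_def)
      finally show ?thesis by simp
    qed
    finally have "(\<Sum>i<Suc N. ?t i) = 0"
      by (simp add: algebra_simps del: sum.lessThan_Suc)
    then show ?thesis using 3 by (simp del: sum.lessThan_Suc)
  qed
  then show "(\<Sum>i<Suc N. (-1) ^ i * b $$ (i, j) * b $$ (Suc N - 1 - i, l)) =
      (if j + l + 1 = Suc N then (-1) ^ j else 0)"
    by simp
qed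

lemma h_entry: "i \<le> N \<Longrightarrow> j \<le> N \<Longrightarrow> h $$ (i, j) = (if j = N then p i else if i = j then 1
     else if i = 0 then - x j else 0)"
  by (simp add: h_def)

text \<open>The columns are \<open>e_0\<close>, \<open>e_j - x_j e_0\<close> and \<open>p\<close>.
  The corrections \<open>x_j\<close> make the inner columns orthogonal to \<open>p\<close>, and
  \<open>p\<close> is isotropic because the form is skew.\<close>

lemma h_isometry: "h \<in> isometries (Suc N)"
proof (rule isometriesI_le[OF h_carrier])
  fix j l assume "j \<le> l" "l < Suc N"
  then have jl: "j \<le> l" "l \<le> N" by auto
  let ?t = "\<lambda>i. (-1) ^ i * h $$ (i, j) * h $$ (N - i, l)"
  have "(\<Sum>i<Suc N. ?t i) = (if j + l = N then (-1) ^ j else 0)"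
  proof (cases "j = N")
    case True
    then have "(\<Sum>i<Suc N. ?t i) = (\<Sum>i<Suc N. (-1) ^ i * p i * p (Suc N - 1 - i))"
    proof (intro sum.cong)
      fix i assume "i \<in> {..<Suc N}"
      moreover have "l = N" using True jl by simp
      ultimately show "?t i = (-1) ^ i * p i * p (Suc N - 1 - i)"
        unfolding True by (simp add: h_entry)
    qed simp
    also have "\<dots> = 0"
      using gram_odd_self[of "Suc N" p] odd_N by simp
    finally show ?thesis using True jl N_pos by simp
  next
    case False
    show ?thesis
    proof (cases "j = 0")
      case True
      then have "(\<Sum>i<Suc N. ?t i) = ?t 0"
        using N_pos by (intro sum_eq_single) (auto simp: h_entry)
      then show ?thesis using True jl N_pos by (simp add: h_entry pN)
    next
      case j0: False
      have "(\<Sum>i<Suc N. ?t i) = ?t 0 + ?t j"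
        using j0 False jl by (intro sum_eq_pair) (auto simp: h_entry)
      also have "\<dots> = - x j * h $$ (N, l) + (-1) ^ j * h $$ (N - j, l)"
        using j0 False jl by (simp add: h_entry)
      also have "\<dots> = (if j + l = N then (-1) ^ j else 0)"
      proof (cases "l = N")
        case True
        then show ?thesis using j0 jl by (simp add: h_entry pN x_def)
      next
        case l: False
        have "N - j = l \<longleftrightarrow> j + l = N" using jl by auto
        moreover have "N - j \<noteq> 0" using False jl by simp
        ultimately show ?thesis using l jl by (simp add: h_entry)
      qed
      finally show ?thesis .
    qed
  qed
  then show "(\<Sum>i<Suc N. (-1) ^ i * h $$ (i, j) * h $$ (Suc N - 1 - i, l)) =
      (if j + l + 1 = Suc N then (-1) ^ j else 0)"
    by simp
qed

lemma h_upper: "upper_unitriangular h"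
  using N_pos by (auto simp: upper_unitriangular_iff[OF h_carrier] h_entry pN)

lemma b_lower: "lower_triangular b"
  by (auto simp: lower_triangular_iff[OF b_carrier] b_entry)

text \<open>The last column becomes \<open>b p\<close>, evaluated by \<open>sum_x_p\<close>.
  Subtracting \<open>x j\<close> times column 0 from an inner column removes the rank-one part of
  \<open>b\<close> below the diagonal.\<close>

lemma bh_entry:
  assumes "i \<le> N" "j \<le> N"
  shows "(b * h) $$ (i, j) = (if j = N then s i * - Q i * (if i = 0 then 0 else 1) + D i * p i
     else if j = 0 then b $$ (i, 0) else b $$ (i, j) - x j * b $$ (i, 0))"
proof -
  have sum: "(b * h) $$ (i, j) = (\<Sum>k<Suc N. b $$ (i, k) * h $$ (k, j))"
    using assms by (intro mult_mat_entry[OF b_carrier h_carrier]) auto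
  consider "j = N" | "j = 0" | "j \<noteq> N" "j \<noteq> 0" by blast
  then show ?thesis
  proof cases
    case 1
    have "(\<Sum>k<Suc N. b $$ (i, k) * h $$ (k, j)) = (\<Sum>k<i. b $$ (i, k) * h $$ (k, j)) + b $$ (i, i) * h $$ (i, j)"
      using assms by (intro sum_lessThan_Suc_upper_triangle) (auto simp: b_entry)
    also have "(\<Sum>k<i. b $$ (i, k) * h $$ (k, j)) = (\<Sum>k<i. s i * (x k * p k))"
      using assms 1 by (intro sum.cong) (auto simp: b_entry h_entry)
    also have "\<dots> = s i * - Q i"
      using sum_x_p[of i] assms by (simp flip: sum_distrib_left)
    finally show ?thesis using sum 1 assms Q_0 by (auto simp: b_entry h_entry)
  next
    case 2
    have "(\<Sum>k<Suc N. b $$ (i, k) * h $$ (k, j)) = b $$ (i, 0) * h $$ (0, j)"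
      using 2 N_pos by (intro sum_eq_single) (auto simp: h_entry)
    then show ?thesis using sum 2 N_pos by (simp add: h_entry)
  next
    case 3
    have "(\<Sum>k<Suc N. b $$ (i, k) * h $$ (k, j)) = b $$ (i, 0) * h $$ (0, j) + b $$ (i, j) * h $$ (j, j)"
      using 3 assms by (intro sum_eq_pair) (auto simp: h_entry)
    then show ?thesis using sum 3 assms by (simp add: h_entry)
  qed
qed

text \<open>In \<open>b p\<close> the rank-one part and the diagonal cancel, except in row 0, where
  \<open>D 0 * p 0 = p 0 / x N = -1\<close>.\<close>

lemma last_column_bh:
  assumes "i \<le> N"
  shows "(b * h) $$ (i, N) = (if i = 0 then -1 else 0)"
proof -
  consider "i = 0" | "i = N" "i \<noteq> 0" | "i \<noteq> 0" "i < N" using assms by linarith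
  then show ?thesis
  proof cases
    case 1
    then show ?thesis using x_N x_N_nz by (simp add: bh_entry D_def divide_simps)
  next
    case 2
    then show ?thesis by (simp add: bh_entry D_def s_def Q_N pN)
  next
    case 3
    then show ?thesis by (simp add: bh_entry D_def s_def)
  qed
qed

text \<open>\<open>M^-1\<close> turns the last column \<open>- e_0\<close> of \<open>b h\<close>
  into the first column \<open>e_0\<close> and negates the inner columns. These vanish below the
  diagonal, where column \<open>j\<close> of \<open>b\<close> is \<open>x j\<close> times column
  0.\<close>

lemma bhM_upper: "upper_unitriangular (b * h * form_adjoint (Suc N) (M_C n))"
proof -
  have bh: "b * h \<in> carrier_mat (2 * n) (2 * n)"
    unfolding N by (rule mult_carrier_mat[OF b_carrier h_carrier])
  have E: "(b * h * form_adjoint (Suc N) (M_C n)) $$ (i, j) =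
      (if j = 0 then - (b * h) $$ (i, N) else if j = N then (b * h) $$ (i, 0) else - (b * h) $$ (i, j))"
    if "i \<le> N" "j \<le> N" for i j
    using mult_M_C_adjoint_entry[OF bh N that] by (simp only: N)
  have c: "b * h * form_adjoint (Suc N) (M_C n) \<in> carrier_mat (Suc N) (Suc N)"
    by (rule mult_carrier_mat[OF mult_carrier_mat[OF b_carrier h_carrier] form_adjoint_carrier])
  \<comment> \<open>This is \<open>Q_step\<close> divided by \<open>Q (Suc j)\<close>.\<close>
  have diag: "x j * s j - D j = 1" if "j \<noteq> 0" "j < N" for j
  proof -
    have "Q (Suc j) \<noteq> 0" using that by (intro Q_nz) auto
    then show ?thesis using that Q_step[of j] by (simp add: s_def D_def field_simps)
  qed
  show ?thesis
    unfolding upper_unitriangular_iff[OF c]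
  proof (intro conjI allI impI)
    fix i j assume ij: "i < Suc N" "j < i"
    then show "(b * h * form_adjoint (Suc N) (M_C n)) $$ (i, j) = 0"
      using last_column_bh[of i] by (cases "j = 0") (auto simp: E bh_entry b_entry x_0)
  next
    fix i assume "i < Suc N"
    then have i: "i \<le> N" by simp
    consider "i = 0" | "i = N" "i \<noteq> 0" | "i \<noteq> 0" "i < N" using i by linarith
    then show "(b * h * form_adjoint (Suc N) (M_C n)) $$ (i, i) = 1"
    proof cases
      case 1
      then show ?thesis using last_column_bh[of 0] by (simp add: E)
    next
      case 2
      then show ?thesis by (simp add: E bh_entry b_entry x_0 s_def)
    next
      case 3
      then show ?thesis using diag[of i] by (simp add: E bh_entry b_entry x_0)
    qed
  qed
qed

lemma b_in_S_C: "b \<in> S_C n"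
proof -
  define M where "M = M_C n"
  define u where "u = b * h * form_adjoint (Suc N) M"
  define u' where "u' = form_adjoint (Suc N) h"
  have M: "M \<in> isometries (Suc N)"
    using M_C_isometry[OF N] by (simp add: M_def N)
  have c: "M \<in> carrier_mat (Suc N) (Suc N)" "form_adjoint (Suc N) M \<in> carrier_mat (Suc N) (Suc N)"
    "b \<in> carrier_mat (Suc N) (Suc N)" "h \<in> carrier_mat (Suc N) (Suc N)"
    "u' \<in> carrier_mat (Suc N) (Suc N)" "b * h \<in> carrier_mat (Suc N) (Suc N)"
    using b_carrier h_carrier isometries_carrier[OF M] by (auto simp: u'_def)
  have "u * M * u' = b * h * (form_adjoint (Suc N) M * M) * u'"
    unfolding u_def using assoc_mult_mat[OF c(6,2,1)] by simp
  also have "\<dots> = b * (h * u')"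
    using c isometries_left_inverse[OF M] by simp
  also have "h * u' = 1\<^sub>m (Suc N)"
    unfolding u'_def by (rule isometries_right_inverse[OF h_isometry])
  finally have eq: "b = u * M * u'" using c by simp
  have "u \<in> U_plus n"
    unfolding U_plus_def Sp_group_eq N u_def
    using bhM_upper M b_isometry h_isometry
    by (auto simp: M_def intro!: isometries_mult isometries_adjoint)
  moreover have "u' \<in> U_plus n"
    unfolding U_plus_def Sp_group_eq N u'_def
    using isometries_adjoint[OF h_isometry] upper_unitriangular_adjoint[OF h_carrier h_upper] by simp
  moreover have "b \<in> B_minus n"
    unfolding B_minus_def Sp_group_eq N using b_isometry b_lower by simp
  ultimately show ?thesis
    unfolding S_C_def using eq by (auto simp: M_def)
qed

lemma eta_b: "eta_C n b = proj_pt (vec (Suc N) p)"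
proof -
  have "row (b * J_C n) N = vec (Suc N) p"
  proof (rule eq_vecI)
    fix j assume "j < dim_vec (vec (Suc N) p)"
    then have j: "j \<le> N" by simp
    have "row (b * J_C n) N $ j = (-1) ^ (N - j) * b $$ (N, N - j)"
      using row_mult_J_C[OF _ N j] b_carrier N by simp
    \<comment> \<open>Since \<open>s N = 1\<close> and \<open>D N = x N\<close>, the diagonal entry
      continues the pattern of the last row.\<close>
    also have "b $$ (N, N - j) = x (N - j)"
      using j N_pos by (cases "j = 0") (auto simp: b_entry D_def s_def)
    also have "(-1) ^ (N - j) * x (N - j) = p j"
      using j by (simp add: x_def flip: mult.assoc)
    finally show "row (b * J_C n) N $ j = vec (Suc N) p $ j" using j by simp
  qed (use b_carrier in \<open>simp add: J_C_def N\<close>)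
  then show ?thesis using N by (simp add: eta_C_def)
qed

end

section \<open>Forms and squarefree divisors\<close>

text \<open>Weights are arbitrary so that one argument covers both the total degree and the degree
  in the variables beyond \<open>p_N\<close>.\<close>

definition wdeg :: "(nat \<Rightarrow> nat) \<Rightarrow> (nat \<Rightarrow>\<^sub>0 nat) \<Rightarrow> nat" where
  "wdeg w m = (\<Sum>i\<in>Poly_Mapping.keys m. w i * Poly_Mapping.lookup m i)"

definition monom_eval :: "(nat \<Rightarrow> 'a :: comm_monoid_mult) \<Rightarrow> (nat \<Rightarrow>\<^sub>0 nat) \<Rightarrow> 'a" where
  "monom_eval x m = (\<Prod>i\<in>Poly_Mapping.keys m. x i ^ Poly_Mapping.lookup m i)"

lemma wdeg_superset:
  assumes "finite A" "Poly_Mapping.keys m \<subseteq> A"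
  shows "wdeg w m = (\<Sum>i\<in>A. w i * Poly_Mapping.lookup m i)"
  unfolding wdeg_def using assms by (intro sum.mono_neutral_left) (auto simp: in_keys_iff)

lemma monom_eval_superset:
  assumes "finite A" "Poly_Mapping.keys m \<subseteq> A"
  shows "monom_eval x m = (\<Prod>i\<in>A. x i ^ Poly_Mapping.lookup m i)"
  unfolding monom_eval_def using assms by (intro prod.mono_neutral_left) (auto simp: in_keys_iff)

lemma wdeg_zero [simp]: "wdeg w 0 = 0"
  by (simp add: wdeg_def)

lemma monom_eval_zero [simp]: "monom_eval x 0 = 1"
  by (simp add: monom_eval_def)

lemma wdeg_add: "wdeg w (m + m') = wdeg w m + wdeg w m'"
  using Poly_Mapping.keys_add[of m m']
  by (simp add: wdeg_superset[of "Poly_Mapping.keys m \<union> Poly_Mapping.keys m'"] lookup_add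
      distrib_left sum.distrib)

lemma monom_eval_add: "monom_eval x (m + m') = monom_eval x m * monom_eval x m'"
  using Poly_Mapping.keys_add[of m m']
  by (simp add: monom_eval_superset[of "Poly_Mapping.keys m \<union> Poly_Mapping.keys m'"] lookup_add
      power_add prod.distrib)

lemma monom_eval_single [simp]: "monom_eval x (Poly_Mapping.single i (Suc 0)) = x i"
  by (simp add: monom_eval_def)

lemma sum_single_keys:
  fixes f :: "'a \<Rightarrow>\<^sub>0 'b :: comm_monoid_add"
  shows "(\<Sum>m\<in>Poly_Mapping.keys f. Poly_Mapping.single m (Poly_Mapping.lookup f m)) = f"
  by (rule poly_mapping_eqI) (auto simp: lookup_sum lookup_single when_def sum.delta in_keys_iff)

text \<open>A map on coefficients and a map on monomials combine to a ring homomorphism. It is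
  instantiated for evaluation at a point, restriction to a line \<open>a + T v\<close>, and a
  grading.\<close>

locale poly_hom =
  fixes c :: "complex \<Rightarrow> 'a :: comm_ring_1" and h :: "(nat \<Rightarrow>\<^sub>0 nat) \<Rightarrow> 'a"
  assumes c_0: "c 0 = 0" and c_1: "c 1 = 1" and c_add: "c (x + y) = c x + c y"
    and c_mult: "c (x * y) = c x * c y"
    and h_0: "h 0 = 1" and h_add: "h (m + m') = h m * h m'"
begin

definition ev :: "cpoly \<Rightarrow> 'a" where
  "ev f = (\<Sum>m\<in>Poly_Mapping.keys f. c (Poly_Mapping.lookup f m) * h m)"

lemma ev_superset:
  assumes "finite A" "Poly_Mapping.keys f \<subseteq> A"
  shows "ev f = (\<Sum>m\<in>A. c (Poly_Mapping.lookup f m) * h m)"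
  unfolding ev_def using assms by (intro sum.mono_neutral_left) (auto simp: in_keys_iff c_0)

lemma ev_zero [simp]: "ev 0 = 0"
  by (simp add: ev_def)

lemma ev_single: "ev (Poly_Mapping.single m x) = c x * h m"
  by (cases "x = 0") (auto simp: ev_def c_0)

lemma ev_one [simp]: "ev 1 = 1"
  using ev_single[of 0 1] by (simp add: c_1 h_0)

lemma ev_pvar: "ev (pvar i) = h (Poly_Mapping.single i 1)"
  by (simp add: pvar_def ev_single c_1)

lemma ev_add: "ev (f + g) = ev f + ev g"
  using Poly_Mapping.keys_add[of f g]
  by (simp add: ev_superset[of "Poly_Mapping.keys f \<union> Poly_Mapping.keys g"] lookup_add
      c_add distrib_right sum.distrib)

lemma ev_sum: "ev (\<Sum>i\<in>A. f i) = (\<Sum>i\<in>A. ev (f i))"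
  by (induction A rule: infinite_finite_induct) (auto simp: ev_add)

lemma ev_mult: "ev (f * g) = ev f * ev g"
proof -
  have "f * g = (\<Sum>m\<in>Poly_Mapping.keys f. \<Sum>m'\<in>Poly_Mapping.keys g.
      Poly_Mapping.single (m + m') (Poly_Mapping.lookup f m * Poly_Mapping.lookup g m'))"
    by (subst (1) sum_single_keys[of f, symmetric], subst (1) sum_single_keys[of g, symmetric])
      (simp add: sum_product mult_single)
  then show ?thesis
    by (simp add: ev_sum ev_single c_mult h_add) (simp add: ev_def sum_product mult_ac)
qed

lemma ev_minus_one: "ev (-1) = -1"
proof -
  have "ev (-1) + 1 = 0" using ev_add[of "-1" 1] by simp
  then show ?thesis by (rule eq_neg_iff_add_eq_0[THEN iffD2])
qed

lemma ev_diff: "ev (f - g) = ev f - ev g"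
  using ev_add[of "f - g" g] by simp

lemma ev_power: "ev (f ^ k) = ev f ^ k"
  by (induction k) (auto simp: ev_mult)

lemma ev_prod: "ev (\<Prod>i\<in>A. f i) = (\<Prod>i\<in>A. ev (f i))"
  by (induction A rule: infinite_finite_induct) (auto simp: ev_mult)

lemma ev_dvd: "f dvd g \<Longrightarrow> ev f dvd ev g"
  by (auto simp: ev_mult elim!: dvdE)

end

interpretation at_point: poly_hom "\<lambda>c. c" "monom_eval x" for x
  by unfold_locales (auto simp: monom_eval_add)

lemma peval_eq: "peval f x = at_point.ev x f"
  by (simp add: peval_def at_point.ev_def monom_eval_def)

interpretation on_line: poly_hom "\<lambda>c. [:c:]" "monom_eval (\<lambda>i. [:a i, v i:])" for a v :: "nat \<Rightarrow> complex"
  by unfold_locales (auto simp: monom_eval_add one_pCons)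

text \<open>Multiplies each term by \<open>T\<close> to the power of its weight; weighted
  homogeneous polynomials are recognized by having a single power of \<open>T\<close> as
  image.\<close>

interpretation graded: poly_hom "\<lambda>c. [:Poly_Mapping.single 0 c:]"
  "\<lambda>m. Polynomial.monom (Poly_Mapping.single m 1) (wdeg w m) :: cpoly poly" for w
  by unfold_locales
    (auto simp: single_add mult_single mult_monom add_monom wdeg_add one_pCons simp flip: single_one monom_0)

section \<open>Gradings and factors of forms\<close>

definition wt_homogeneous :: "(nat \<Rightarrow> nat) \<Rightarrow> nat \<Rightarrow> cpoly \<Rightarrow> bool" where
  "wt_homogeneous w k f \<longleftrightarrow> (\<forall>m\<in>Poly_Mapping.keys f. wdeg w m = k)"

lemma graded_ev: "graded.ev w f =
    (\<Sum>m\<in>Poly_Mapping.keys f. Polynomial.monom (Poly_Mapping.single m (Poly_Mapping.lookup f m)) (wdeg w m))"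
  unfolding graded.ev_def by (simp add: smult_monom mult_single)

lemma graded_ev_homogeneous:
  assumes "wt_homogeneous w k f"
  shows "graded.ev w f = Polynomial.monom f k"
proof -
  have "graded.ev w f =
      (\<Sum>m\<in>Poly_Mapping.keys f. Polynomial.monom (Poly_Mapping.single m (Poly_Mapping.lookup f m)) k)"
    unfolding graded_ev using assms by (intro sum.cong) (auto simp: wt_homogeneous_def)
  also have "\<dots> = Polynomial.monom (\<Sum>m\<in>Poly_Mapping.keys f. Poly_Mapping.single m (Poly_Mapping.lookup f m)) k"
    by (rule poly_eqI) (simp add: coeff_sum)
  finally show ?thesis by (simp only: sum_single_keys)
qed

lemma homogeneous_of_graded_ev:
  assumes "graded.ev w f = Polynomial.monom a k"
  shows "wt_homogeneous w k f"
  unfolding wt_homogeneous_def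
proof
  fix m assume m: "m \<in> Poly_Mapping.keys f"
  have "Poly_Mapping.lookup (coeff (graded.ev w f) (wdeg w m)) m =
      (\<Sum>m'\<in>Poly_Mapping.keys f. if m' = m then Poly_Mapping.lookup f m else 0)"
    unfolding graded_ev coeff_sum lookup_sum
    by (intro sum.cong) (auto simp: lookup_single when_def)
  then have "Poly_Mapping.lookup (coeff (graded.ev w f) (wdeg w m)) m \<noteq> 0"
    using m by (simp add: in_keys_iff)
  then show "wdeg w m = k" unfolding assms by (auto split: if_splits)
qed

text \<open>Degree and order of vanishing at 0 are both additive and agree for the product. The
  order never exceeds the degree, so they agree for each factor.\<close>

lemma monom_factors:
  fixes p q :: "'a :: idom poly"
  assumes "p * q = Polynomial.monom c k" "c \<noteq> 0"
  shows "\<exists>a i b j. p = Polynomial.monom a i \<and> q = Polynomial.monom b j \<and> i + j = k"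
proof -
  have nz: "p \<noteq> 0" "q \<noteq> 0" "p * q \<noteq> 0" using assms by auto
  have "order 0 p + order 0 q = k"
    using order_mult[OF nz(3), of 0] assms by (simp add: order_0_monom)
  moreover have "degree p + degree q = k"
    using degree_mult_eq[OF nz(1,2)] assms by (simp add: degree_monom_eq)
  ultimately have ord: "order 0 p = degree p" "order 0 q = degree q"
    using order_degree[OF nz(1), of 0] order_degree[OF nz(2), of 0] by linarith+
  have "\<exists>a. r = Polynomial.monom a (degree r)" if r: "order 0 r = degree r" "r \<noteq> 0" for r :: "'a poly"
  proof -
    have "[:0, 1:] ^ degree r dvd r" using order_1[of 0 r] r by simp
    then obtain s where s: "r = [:0, 1:] ^ degree r * s" by (rule dvdE)
    then have "s \<noteq> 0" using r by auto
    then have "degree r = degree r + degree s"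
      using s degree_mult_eq[of "[:0, 1:] ^ degree r" s] by (simp add: degree_power_eq)
    then obtain a where "s = [:a:]" by (auto elim: degree_eq_zeroE)
    then show ?thesis using s by (metis monom_altdef mult.commute mult_pCons_left mult_zero_left pCons_0_0 add.right_neutral)
  qed
  then show ?thesis using ord nz \<open>degree p + degree q = k\<close> by blast
qed

lemma homogeneous_factors:
  assumes "wt_homogeneous w k (f * g)" "f * g \<noteq> 0"
  shows "\<exists>i j. wt_homogeneous w i f \<and> wt_homogeneous w j g \<and> i + j = k"
proof -
  have "graded.ev w f * graded.ev w g = Polynomial.monom (f * g) k"
    using graded_ev_homogeneous[OF assms(1)] by (simp add: graded.ev_mult)
  from monom_factors[OF this assms(2)] obtain a i b j where
    "graded.ev w f = Polynomial.monom a i" "graded.ev w g = Polynomial.monom b j" "i + j = k"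
    by blast
  then show ?thesis by (blast intro: homogeneous_of_graded_ev)
qed

text \<open>The absence of variables beyond \<open>p_N\<close> is itself a homogeneity condition, so
  both conditions pass to factors by \<open>homogeneous_factors\<close>.\<close>

lemma is_form_iff: "is_form N d f \<longleftrightarrow>
    wt_homogeneous (\<lambda>i. if i \<le> N then 0 else 1) 0 f \<and> wt_homogeneous (\<lambda>_. 1) d f"
  by (auto simp: is_form_def wt_homogeneous_def wdeg_def sum_eq_0_iff in_keys_iff subset_iff split: if_splits)

lemma is_form_factors:
  assumes "is_form N d (f * g)" "f * g \<noteq> 0"
  shows "\<exists>i j. is_form N i f \<and> is_form N j g \<and> i + j = d"
proof -
  obtain i j where "wt_homogeneous (\<lambda>_. 1) i f" "wt_homogeneous (\<lambda>_. 1) j g" "i + j = d"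
    using homogeneous_factors[of _ d f g] assms by (force simp: is_form_iff)
  moreover have "wt_homogeneous (\<lambda>i. if i \<le> N then 0 else 1) 0 f \<and>
      wt_homogeneous (\<lambda>i. if i \<le> N then 0 else 1) 0 g"
    using homogeneous_factors[of "\<lambda>i. if i \<le> N then 0 else 1" 0 f g] assms by (auto simp: is_form_iff)
  ultimately show ?thesis by (auto simp: is_form_iff)
qed

lemma wt_homogeneous_mult:
  assumes "wt_homogeneous w i f" "wt_homogeneous w j g"
  shows "wt_homogeneous w (i + j) (f * g)"
  unfolding wt_homogeneous_def
proof
  fix m assume "m \<in> Poly_Mapping.keys (f * g)"
  then obtain a b where "a \<in> Poly_Mapping.keys f" "b \<in> Poly_Mapping.keys g" "m = a + b"
    using keys_mult[of f g] by auto
  then show "wdeg w m = i + j" using assms by (simp add: wdeg_add wt_homogeneous_def)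
qed

lemma wt_homogeneous_add: "wt_homogeneous w i f \<Longrightarrow> wt_homogeneous w i g \<Longrightarrow> wt_homogeneous w i (f + g)"
  using Poly_Mapping.keys_add[of f g] by (auto simp: wt_homogeneous_def)

lemma is_form_mult: "is_form N i f \<Longrightarrow> is_form N j g \<Longrightarrow> is_form N (i + j) (f * g)"
  using wt_homogeneous_mult[of _ 0 f 0 g] wt_homogeneous_mult[of _ i f j g] by (auto simp: is_form_iff)

lemma is_form_sum: "(\<And>i. i \<in> A \<Longrightarrow> is_form N d (f i)) \<Longrightarrow> is_form N d (\<Sum>i\<in>A. f i)"
  by (induction A rule: infinite_finite_induct)
    (auto simp: is_form_iff intro!: wt_homogeneous_add, auto simp: wt_homogeneous_def)

lemma is_form_minus_one_power: "is_form N 0 ((-1) ^ j)"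
  by (cases "even j") (auto simp: is_form_def)

lemma is_form_pvar: "i \<le> N \<Longrightarrow> is_form N 1 (pvar i)"
  by (auto simp: is_form_def pvar_def)

lemma is_form_prod: "(\<And>i. i \<in> A \<Longrightarrow> is_form N (d i) (f i)) \<Longrightarrow> finite A \<Longrightarrow>
    is_form N (\<Sum>i\<in>A. d i) (\<Prod>i\<in>A. f i)"
proof (induction A rule: infinite_finite_induct)
  case empty
  then show ?case by (simp add: is_form_def)
qed (auto intro: is_form_mult)

lemma is_form_zero_degree_unit:
  assumes "is_form N 0 f" "f \<noteq> 0"
  shows "f dvd 1"
proof -
  have "m = 0" if "m \<in> Poly_Mapping.keys f" for m
  proof -
    have "(\<Sum>i\<in>Poly_Mapping.keys m. Poly_Mapping.lookup m i) = 0"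
      using assms that by (simp add: is_form_def)
    then show ?thesis by (intro poly_mapping_eqI) (auto simp: in_keys_iff)
  qed
  then have "Poly_Mapping.keys f \<subseteq> {0}" by auto
  then have f: "f = Poly_Mapping.single 0 (Poly_Mapping.lookup f 0)"
    by (intro poly_mapping_eqI) (auto simp: lookup_single when_def in_keys_iff subset_iff)
  then have "Poly_Mapping.lookup f 0 \<noteq> 0" using assms by (metis single_zero)
  then have "Poly_Mapping.single 0 (Poly_Mapping.lookup f 0) *
      Poly_Mapping.single 0 (1 / Poly_Mapping.lookup f 0) = (1 :: cpoly)"
    by (simp add: mult_single)
  then show ?thesis using f by (metis dvd_triv_left)
qed

text \<open>A reducible form splits into two forms of smaller degree, one of which vanishes at
  \<open>x\<close>; the descent ends at an irreducible form.\<close>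

lemma prime_form_through_zero:
  assumes "is_form N d f" "f \<noteq> 0" "peval f x = 0"
  shows "\<exists>p. prime_form N p \<and> p dvd f \<and> peval p x = 0"
  using assms
proof (induction d arbitrary: f rule: less_induct)
  case (less d)
  \<comment> \<open>A unit takes invertible values, so it has no zero.\<close>
  have nonunit: "\<not> f dvd 1"
    using at_point.ev_dvd[of f 1 x] less.prems by (auto simp: peval_eq)
  show ?case
  proof (cases "irreducible f")
    case True
    then show ?thesis using less.prems by (auto simp: prime_form_def)
  next
    case False
    then obtain g h where gh: "f = g * h" "\<not> g dvd 1" "\<not> h dvd 1"
      using less.prems nonunit by (auto simp: irreducible_def)
    then obtain i j where ij: "is_form N i g" "is_form N j h" "i + j = d"
      using is_form_factors[of N d g h] less.prems by auto
    have "g \<noteq> 0" "h \<noteq> 0" using gh less.prems by auto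
    then have "i \<noteq> 0" "j \<noteq> 0"
      using ij gh is_form_zero_degree_unit by metis+
    moreover have "peval g x = 0 \<or> peval h x = 0"
      using less.prems gh by (simp add: peval_eq at_point.ev_mult)
    ultimately show ?thesis
      using less.IH[of i g] less.IH[of j h] ij gh less.prems by (auto intro: dvd_mult dvd_mult2)
  qed
qed

section \<open>Restriction to a line\<close>

lemma coeff_mult_top:
  fixes p q :: "'a :: comm_ring_1 poly"
  assumes "degree p \<le> a" "degree q \<le> b"
  shows "coeff (p * q) (a + b) = coeff p a * coeff q b"
proof -
  have "coeff (p * q) (a + b) = (\<Sum>i\<in>{a}. coeff p i * coeff q (a + b - i))"
    unfolding coeff_mult
  proof (rule sum.mono_neutral_right)
    show "\<forall>i\<in>{..a + b} - {a}. coeff p i * coeff q (a + b - i) = 0"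
    proof
      fix i assume "i \<in> {..a + b} - {a}"
      then consider "degree p < i" | "degree q < a + b - i" using assms by fastforce
      then show "coeff p i * coeff q (a + b - i) = 0" by cases (auto simp: coeff_eq_0)
    qed
  qed auto
  then show ?thesis by simp
qed

lemma coeff_prod_top:
  fixes P :: "'i \<Rightarrow> 'a :: comm_ring_1 poly"
  assumes "finite A" "\<And>i. i \<in> A \<Longrightarrow> degree (P i) \<le> e i"
  shows "degree (\<Prod>i\<in>A. P i) \<le> (\<Sum>i\<in>A. e i) \<and>
    coeff (\<Prod>i\<in>A. P i) (\<Sum>i\<in>A. e i) = (\<Prod>i\<in>A. coeff (P i) (e i))"
  using assms
proof (induction A rule: finite_induct)
  case (insert i A)
  then show ?case
    using degree_mult_le[of "P i" "\<Prod>i\<in>A. P i"] by (fastforce simp: coeff_mult_top)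
qed auto

text \<open>The top coefficient of \<open>f (a + T v)\<close> sees only the direction: it is the
  value at the point at infinity of the line.\<close>

lemma line_top_coeff:
  assumes "is_form N d f"
  shows "degree (on_line.ev a v f) \<le> d" and "coeff (on_line.ev a v f) d = peval f v"
proof -
  have m: "degree (monom_eval (\<lambda>i. [:a i, v i:]) m) \<le> d \<and>
      coeff (monom_eval (\<lambda>i. [:a i, v i:]) m) d = monom_eval v m"
    if "m \<in> Poly_Mapping.keys f" for m
  proof -
    have pw: "degree ([:a i, v i:] ^ k) \<le> k \<and> coeff ([:a i, v i:] ^ k) k = v i ^ k" for i k
      using coeff_prod_top[of "{..<k}" "\<lambda>_. [:a i, v i:]" "\<lambda>_. 1"] by simp
    have "(\<Sum>i\<in>Poly_Mapping.keys m. Poly_Mapping.lookup m i) = d"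
      using that assms by (simp add: is_form_def)
    then show ?thesis
      using coeff_prod_top[of "Poly_Mapping.keys m" "\<lambda>i. [:a i, v i:] ^ Poly_Mapping.lookup m i"
          "Poly_Mapping.lookup m"] pw
      by (simp add: monom_eval_def)
  qed
  show "degree (on_line.ev a v f) \<le> d"
    unfolding on_line.ev_def
  proof (rule degree_sum_le)
    fix k assume "k \<in> Poly_Mapping.keys f"
    then show "degree ([:Poly_Mapping.lookup f k:] * monom_eval (\<lambda>i. [:a i, v i:]) k) \<le> d"
      using m[of k] degree_mult_le[of "[:Poly_Mapping.lookup f k:]"] by fastforce
  qed simp
  show "coeff (on_line.ev a v f) d = peval f v"
    unfolding on_line.ev_def peval_eq at_point.ev_def coeff_sum
    using m by (intro sum.cong) auto
qed

text \<open>With \<open>g\<close> also \<open>p\<close> is nonzero at \<open>v\<close>, so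
  \<open>p\<close> keeps its positive degree on the line and has a complex root there, which
  \<open>p ^ 2\<close> makes double.\<close>

lemma square_factor_on_line:
  assumes g: "is_form N e g" and p: "prime_form N p" and dvd: "p ^ 2 dvd g" and v: "peval g v \<noteq> 0"
  shows "\<exists>t. [:- t, 1:] ^ 2 dvd on_line.ev a v g"
proof -
  obtain d where d: "is_form N d p" using p by (auto simp: prime_form_def)
  have "peval p v \<noteq> 0"
  proof
    assume "peval p v = 0"
    moreover have "at_point.ev v (p ^ 2) dvd at_point.ev v g"
      using dvd by (rule at_point.ev_dvd)
    ultimately show False using v by (simp add: peval_eq at_point.ev_power)
  qed
  moreover have "d \<noteq> 0"
    using is_form_zero_degree_unit d p unfolding prime_form_def irreducible_def by metis
  ultimately have "degree (on_line.ev a v p) \<noteq> 0"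
    using line_top_coeff[OF d, of a v] by (metis le_degree le_zero_eq)
  then have "\<not> constant (poly (on_line.ev a v p))"
    by (simp add: constant_degree)
  then obtain t where "poly (on_line.ev a v p) t = 0"
    using fundamental_theorem_of_algebra by blast
  then have "[:- t, 1:] dvd on_line.ev a v p" by (simp add: poly_eq_0_iff_dvd)
  then have "[:- t, 1:] ^ 2 dvd on_line.ev a v p ^ 2" by (rule dvd_power_same)
  also have "on_line.ev a v p ^ 2 dvd on_line.ev a v g"
    using on_line.ev_dvd[OF dvd, of a v] by (simp add: on_line.ev_power)
  finally show ?thesis by blast
qed

section \<open>Zero loci and squarefree divisors\<close>

text \<open>Equality is asked only for \<open>i <= N\<close>: beyond the dimension the entries of a
  vector are unspecified, and a form does not see them.\<close>

lemma peval_scale: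
  assumes f: "is_form N d f" and y: "\<And>i. i \<le> N \<Longrightarrow> y i = c * x i"
  shows "peval f y = c ^ d * peval f x"
proof -
  have "monom_eval y m = c ^ d * monom_eval x m" if "m \<in> Poly_Mapping.keys f" for m
  proof -
    have m: "Poly_Mapping.keys m \<subseteq> {..N}" "(\<Sum>i\<in>Poly_Mapping.keys m. Poly_Mapping.lookup m i) = d"
      using f that by (auto simp: is_form_def)
    have "monom_eval y m = (\<Prod>i\<in>Poly_Mapping.keys m. c ^ Poly_Mapping.lookup m i * x i ^ Poly_Mapping.lookup m i)"
      unfolding monom_eval_def using m y by (intro prod.cong) (auto simp: power_mult_distrib)
    also have "\<dots> = c ^ d * monom_eval x m"
      by (simp add: prod.distrib monom_eval_def m(2) flip: power_sum)
    finally show ?thesis .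
  qed
  then show ?thesis
    by (simp add: peval_eq at_point.ev_def sum_distrib_left mult_ac)
qed

lemma zero_locus_iff:
  assumes f: "is_form N d f" and v: "v \<in> carrier_vec (N + 1)" "v \<noteq> 0\<^sub>v (N + 1)"
  shows "proj_pt v \<in> zero_locus N f \<longleftrightarrow> peval f (\<lambda>i. v $ i) = 0"
proof -
  have "peval f (\<lambda>i. (c \<cdot>\<^sub>v v) $ i) = c ^ d * peval f (\<lambda>i. v $ i)" for c
    using v by (intro peval_scale[OF f]) auto
  moreover have "\<exists>c. v = c \<cdot>\<^sub>v v \<and> c \<noteq> 0" by (rule exI[of _ 1]) simp
  ultimately show ?thesis
    using v by (auto simp: zero_locus_def proj_pt_def proj_space_def)
qed

text \<open>The exponents are bounded by 1, so \<open>GREATEST\<close> ranges over a bounded set and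
  returns a true maximum.\<close>

lemma form_divisor_squarefree:
  assumes "\<And>p. prime_form N p \<Longrightarrow> \<not> p ^ 2 dvd g"
  shows "form_divisor N g = (\<lambda>p. if prime_form N p \<and> p dvd g then 1 else 0)"
proof
  fix p
  show "form_divisor N g p = (if prime_form N p \<and> p dvd g then 1 else 0)"
  proof (cases "prime_form N p")
    case True
    have le: "k \<le> 1" if "p ^ k dvd g" for k
    proof (rule ccontr)
      assume "\<not> k \<le> 1"
      then have "p ^ 2 dvd p ^ k" by (intro le_imp_power_dvd) auto
      then show False using assms[OF True] that dvd_trans by blast
    qed
    have "(GREATEST k. p ^ k dvd g) = (if p dvd g then 1 else 0)"
    proof (cases "p dvd g")
      case True
      then show ?thesis using le by (intro Greatest_equality) auto
    next
      case False
      have "k = 0" if "p ^ k dvd g" for k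
        using le[OF that] that False by (cases k) auto
      then show ?thesis using False by (intro Greatest_equality) auto
    qed
    then show ?thesis using True by (simp add: form_divisor_def)
  qed (simp add: form_divisor_def)
qed

text \<open>One inclusion is divisibility, the other is
  \<open>prime_form_through_zero\<close>.\<close>

lemma divisor_support_squarefree:
  assumes g: "is_form N e g" "g \<noteq> 0" and sqf: "\<And>p. prime_form N p \<Longrightarrow> \<not> p ^ 2 dvd g"
  shows "divisor_support N (form_divisor N g) = zero_locus N g"
proof -
  have supp: "divisor_support N (form_divisor N g) = (\<Union>p\<in>{p. prime_form N p \<and> p dvd g}. zero_locus N p)"
  proof -
    have "form_divisor N g = (\<lambda>p. if prime_form N p \<and> p dvd g then 1 else 0)"
      by (rule form_divisor_squarefree) (rule sqf)
    then show ?thesis by (auto simp: divisor_support_def)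
  qed
  show ?thesis
  proof (intro equalityI subsetI)
    fix L assume "L \<in> divisor_support N (form_divisor N g)"
    then obtain p where p: "p dvd g" "L \<in> zero_locus N p" by (auto simp: supp)
    have "peval g x = 0" if "peval p x = 0" for x
      using at_point.ev_dvd[OF p(1), of x] that by (simp add: peval_eq)
    then show "L \<in> zero_locus N g" using p by (auto simp: zero_locus_def)
  next
    fix L assume L: "L \<in> zero_locus N g"
    then obtain v where v: "v \<in> carrier_vec (N + 1)" "v \<noteq> 0\<^sub>v (N + 1)" "L = proj_pt v"
      by (auto simp: zero_locus_def proj_space_def)
    then have "peval g (\<lambda>i. v $ i) = 0" using L zero_locus_iff[OF g(1) v(1,2)] by simp
    then obtain p where p: "prime_form N p" "p dvd g" "peval p (\<lambda>i. v $ i) = 0"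
      using prime_form_through_zero[OF g] by blast
    then obtain d where "is_form N d p" by (auto simp: prime_form_def)
    then have "L \<in> zero_locus N p" using v p zero_locus_iff by simp
    then show "L \<in> divisor_support N (form_divisor N g)" using p by (auto simp: supp)
  qed
qed

section \<open>The boundary form\<close>

lemma peval_F_C: "peval (F_C N r) x = (\<Sum>j=0..r. (-1) ^ j * x (r - j) * x (N - r + j))"
  by (simp add: peval_eq F_C_def at_point.ev_sum at_point.ev_mult at_point.ev_power
      at_point.ev_minus_one at_point.ev_pvar)

lemma F_C_0: "F_C N 0 = pvar 0 * pvar N"
  by (simp add: F_C_def)

lemma F_C_Suc:
  assumes "Suc r \<le> N"
  shows "F_C N (Suc r) = pvar (Suc r) * pvar (N - Suc r) - F_C N r"
proof -
  have "N - Suc r + Suc j = N - r + j" for j using assms by simp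
  then show ?thesis
    unfolding F_C_def
    by (simp add: sum.atLeast0_atMost_Suc_shift sum_negf[symmetric] del: sum.cl_ivl_Suc)
qed

lemma is_form_F_C:
  assumes "r \<le> N"
  shows "is_form N 2 (F_C N r)"
  unfolding F_C_def
proof (rule is_form_sum)
  fix j assume j: "j \<in> {0..r}"
  have "is_form N (0 + 1 + 1) ((-1) ^ j * pvar (r - j) * pvar (N - r + j))"
    by (intro is_form_mult is_form_minus_one_power is_form_pvar) (use assms j in auto)
  then show "is_form N 2 ((-1) ^ j * pvar (r - j) * pvar (N - r + j))" by (simp add: numeral_2_eq_2)
qed

text \<open>The factor \<open>p_0 p_N\<close> is counted as \<open>F_C N 0\<close>, which gives
  \<open>n\<close> quadrics of one family and the total degree \<open>2 n = N + 1\<close>.\<close>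

definition boundary_form :: "nat \<Rightarrow> cpoly" where
  "boundary_form n = (\<Prod>r<n. F_C (2 * n - 1) r)"

lemma boundary_form_eq:
  assumes "n \<ge> 1"
  shows "pvar 0 * pvar (2 * n - 1) * (\<Prod>r=1..n-1. F_C (2 * n - 1) r) = boundary_form n"
proof -
  have "{..<n} = insert 0 {1..n-1}" using assms by auto
  then show ?thesis by (simp add: boundary_form_def F_C_0)
qed

lemma is_form_boundary_form: "is_form (2 * n - 1) (2 * n) (boundary_form n)"
proof -
  have "is_form (2 * n - 1) (\<Sum>r<n. 2) (boundary_form n)"
    unfolding boundary_form_def by (intro is_form_prod is_form_F_C) auto
  then show ?thesis by (simp add: mult.commute)
qed

text \<open>On the line below every \<open>F_C N r\<close> restricts to \<open>X\<^sup>2 - (r + 1)\<close>: as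
  \<open>F_C N r + F_C N (r - 1) = p\<^sub>r p\<^sub>N\<^sub>-\<^sub>r\<close>, it suffices to factor \<open>2 X\<^sup>2 - (2 r + 1)\<close>.\<close>

definition test_base :: "nat \<Rightarrow> nat \<Rightarrow> complex" where
  "test_base n i = (let N = 2 * n - 1; \<sigma> = (\<lambda>i. if i = 0 then 1 else csqrt (2 * of_nat i + 1))
     in if i < n then - \<sigma> i else \<sigma> (N - i))"

definition test_direction :: "nat \<Rightarrow> nat \<Rightarrow> complex" where
  "test_direction n i = (if i = 0 \<or> i = 2 * n - 1 then 1 else csqrt 2)"

lemma F_C_test_line:
  assumes "r < n"
  shows "on_line.ev (test_base n) (test_direction n) (F_C (2 * n - 1) r) = [:- of_nat (r + 1), 0, 1:]"
  using assms
proof (induction r)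
  case 0
  then show ?case
    by (simp add: F_C_0 on_line.ev_mult on_line.ev_pvar test_base_def test_direction_def Let_def)
next
  case (Suc r)
  have i: "\<not> 2 * n - 1 - Suc r < n" "2 * n - 1 - (2 * n - 1 - Suc r) = Suc r"
    "Suc r \<noteq> 2 * n - 1" "2 * n - 1 - Suc r \<noteq> 0" "2 * n - 1 - Suc r \<noteq> 2 * n - 1" "Suc r \<le> 2 * n - 1"
    using Suc.prems by auto
  define s where "s = csqrt (2 * of_nat (Suc r) + 1)"
  have s: "s * s = 2 * of_nat (Suc r) + 1" unfolding s_def using power2_csqrt by (simp only: power2_eq_square)
  have t: "csqrt 2 * csqrt 2 = 2" using power2_csqrt by (simp only: power2_eq_square)
  have "on_line.ev (test_base n) (test_direction n) (pvar (Suc r)) = [:- s, csqrt 2:]"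
    "on_line.ev (test_base n) (test_direction n) (pvar (2 * n - 1 - Suc r)) = [:s, csqrt 2:]"
    using i Suc.prems unfolding on_line.ev_pvar One_nat_def monom_eval_single test_base_def test_direction_def Let_def s_def
    by simp_all
  then have "on_line.ev (test_base n) (test_direction n) (F_C (2 * n - 1) (Suc r)) =
      [:- s, csqrt 2:] * [:s, csqrt 2:] - [:- of_nat (r + 1), 0, 1:]"
    using Suc i by (simp add: F_C_Suc on_line.ev_mult on_line.ev_diff)
  also have "\<dots> = [:- of_nat (Suc r + 1), 0, 1:]"
    using s t by (simp add: algebra_simps)
  finally show ?case .
qed

text \<open>A root \<open>t\<close> of the factor with index \<open>r\<close> satisfies
  \<open>t^2 = r + 1\<close>. There the other factors take the values \<open>r - s\<close>, and the
  remaining linear factor the value \<open>2 t\<close>; none of them is zero.\<close>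

lemma no_double_root:
  fixes t :: complex
  assumes "finite A"
  shows "\<not> [:- t, 1:] ^ 2 dvd (\<Prod>r\<in>A. [:- of_nat (r + 1), 0, 1:])"
proof
  let ?q = "\<lambda>r. [:- of_nat (r + 1), 0, 1:] :: complex poly"
  assume dvd: "[:- t, 1:] ^ 2 dvd (\<Prod>r\<in>A. ?q r)"
  have "[:- t, 1:] dvd (\<Prod>r\<in>A. ?q r)"
    using dvd by (metis dvd_mult_left power2_eq_square)
  then have "poly (\<Prod>r\<in>A. ?q r) t = 0" by (simp add: poly_eq_0_iff_dvd)
  then obtain r where r: "r \<in> A" "t * t = of_nat (r + 1)"
    using assms by (auto simp: poly_prod prod_zero_iff algebra_simps)
  have "?q r = [:- t, 1:] * [:t, 1:]" using r by simp
  moreover have "(\<Prod>r\<in>A. ?q r) = ?q r * (\<Prod>r\<in>A - {r}. ?q r)"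
    using assms r by (simp add: prod.remove)
  ultimately have "[:- t, 1:] * [:- t, 1:] dvd [:- t, 1:] * ([:t, 1:] * (\<Prod>r\<in>A - {r}. ?q r))"
    using dvd by (simp only: power2_eq_square mult.assoc)
  then have "[:- t, 1:] dvd [:t, 1:] * (\<Prod>r\<in>A - {r}. ?q r)"
    by (subst (asm) dvd_mult_cancel_left) auto
  then have "poly ([:t, 1:] * (\<Prod>r\<in>A - {r}. ?q r)) t = 0" by (simp only: poly_eq_0_iff_dvd)
  then have "2 * t * (\<Prod>s\<in>A - {r}. t * t - of_nat (s + 1)) = 0"
    by (simp add: poly_prod algebra_simps)
  moreover have "t \<noteq> 0"
  proof
    assume "t = 0"
    then have "of_nat (r + 1) = (0 :: complex)" using r by simp
    then show False by (simp only: of_nat_eq_0_iff)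
  qed
  ultimately obtain s where "s \<in> A - {r}" "of_nat (r + 1) = (of_nat (s + 1) :: complex)"
    using assms r by (auto simp: prod_zero_iff)
  then show False by (simp only: of_nat_eq_iff) simp
qed

text \<open>All factors are monic on the test line. This supplies the direction needed in
  \<open>square_factor_on_line\<close> and shows that the form is nonzero.\<close>

lemma boundary_form_test_direction: "peval (boundary_form n) (test_direction n) = 1"
proof -
  have "coeff [:x, 0, 1 :: complex:] 2 = 1" for x by (simp add: numeral_2_eq_2)
  then have "peval (F_C (2 * n - 1) r) (test_direction n) = 1" if "r < n" for r
    using line_top_coeff(2)[OF is_form_F_C, of r "2 * n - 1" "test_base n" "test_direction n"] that
      F_C_test_line[OF that] by simp
  then show ?thesis by (simp add: boundary_form_def peval_eq at_point.ev_prod)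
qed

lemma boundary_form_nonzero: "boundary_form n \<noteq> 0"
  using boundary_form_test_direction[of n] by (auto simp: peval_eq)

lemma boundary_form_squarefree:
  assumes "prime_form (2 * n - 1) p"
  shows "\<not> p ^ 2 dvd boundary_form n"
proof
  assume "p ^ 2 dvd boundary_form n"
  from square_factor_on_line[OF is_form_boundary_form assms this, of "test_direction n" "test_base n"]
  obtain t where "[:- t, 1:] ^ 2 dvd on_line.ev (test_base n) (test_direction n) (boundary_form n)"
    by (auto simp: boundary_form_test_direction)
  also have "on_line.ev (test_base n) (test_direction n) (boundary_form n) =
      (\<Prod>r<n. [:- of_nat (r + 1), 0, 1:])"
    unfolding boundary_form_def on_line.ev_prod by (intro prod.cong F_C_test_line) auto
  finally show False using no_double_root[of "{..<n}" t] by simp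
qed

lemma D_C_eq:
  assumes "n \<ge> 1"
  shows "D_C n = form_divisor (2 * n - 1) (boundary_form n)"
proof -
  have "D_C n = reduced_divisor (form_divisor (2 * n - 1) (boundary_form n))"
    unfolding D_C_def Let_def using boundary_form_eq[OF assms] by simp
  moreover have "form_divisor (2 * n - 1) (boundary_form n) =
      (\<lambda>p. if prime_form (2 * n - 1) p \<and> p dvd boundary_form n then 1 else 0)"
    by (rule form_divisor_squarefree) (rule boundary_form_squarefree)
  ultimately show ?thesis
    by (simp add: reduced_divisor_def fun_eq_iff)
qed

lemma D_C_anticanonical:
  assumes "n \<ge> 1"
  shows "anticanonical (2 * n - 1) (D_C n)"
  unfolding anticanonical_def using assms is_form_boundary_form[of n] boundary_form_nonzero D_C_eq
  by auto

lemma D_C_support: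
  assumes "n \<ge> 1"
  shows "divisor_support (2 * n - 1) (D_C n) = zero_locus (2 * n - 1) (boundary_form n)"
  unfolding D_C_eq[OF assms]
  by (intro divisor_support_squarefree[OF is_form_boundary_form] boundary_form_nonzero boundary_form_squarefree)

section \<open>The dual group\<close>

lemma pow_mat_nilpotent:
  fixes A :: "complex mat"
  assumes A: "A \<in> carrier_mat d d" and cube: "A * A * A = 0\<^sub>m d d"
  shows "A ^\<^sub>m (k + 3) = 0\<^sub>m d d"
proof (induction k)
  case 0
  have "A ^\<^sub>m (0 + 3) = A * A * A" using A by (simp add: numeral_3_eq_3)
  then show ?case using cube by simp
next
  case (Suc k)
  have "A ^\<^sub>m (Suc k + 3) = A ^\<^sub>m (k + 3) * A" by (simp only: add_Suc pow_mat.simps)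
  then show ?case using A Suc by simp
qed

text \<open>The root vectors have vanishing cube, so the series stops after the quadratic term,
  which survives only for \<open>e_n\<close>.\<close>

lemma mat_exp_nilpotent:
  assumes A: "A \<in> carrier_mat d d" and cube: "A * A * A = 0\<^sub>m d d" and ij: "i < d" "j < d"
  shows "mat_exp A $$ (i, j) = (if i = j then 1 else 0) + A $$ (i, j) + (A * A) $$ (i, j) / 2"
proof -
  have "mat_exp A $$ (i, j) = suminf (\<lambda>k. (A ^\<^sub>m k) $$ (i, j) / fact k)"
    using A ij by (simp add: mat_exp_def)
  also have "\<dots> = (\<Sum>k<3. (A ^\<^sub>m k) $$ (i, j) / fact k)"
  proof (rule suminf_finite)
    fix k :: nat assume "k \<notin> {..<3}"
    then have "k = (k - 3) + 3" by simp
    then have "A ^\<^sub>m k = 0\<^sub>m d d" using pow_mat_nilpotent[OF A cube, of "k - 3"] by simp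
    then show "(A ^\<^sub>m k) $$ (i, j) / fact k = 0" using ij by simp
  qed simp
  also have "\<dots> = (A ^\<^sub>m 0) $$ (i, j) + (A ^\<^sub>m 1) $$ (i, j) + (A ^\<^sub>m 2) $$ (i, j) / 2"
  proof -
    have "(\<Sum>k<3. f k) = f 0 + f 1 + f 2" for f :: "nat \<Rightarrow> complex"
      by (simp add: numeral_3_eq_3 numeral_2_eq_2)
    then show ?thesis by simp
  qed
  also have "A ^\<^sub>m 2 = A * A" using A by (simp add: numeral_2_eq_2)
  finally show ?thesis using A ij by simp
qed

lemma mat_unit_entry:
  "r < d \<Longrightarrow> c < d \<Longrightarrow> mat_unit d k l $$ (r, c) = (if Suc r = k \<and> Suc c = l then 1 else 0)"
  by (simp add: mat_unit_def mat1_def)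

lemma mat_unit_carrier: "mat_unit d k l \<in> carrier_mat d d"
  by (simp add: mat_unit_def mat1_def)

lemma mat_unit_add_entry:
  assumes "r < d" "c < d"
  shows "(mat_unit d k l + mat_unit d k' l') $$ (r, c) =
    (if Suc r = k \<and> Suc c = l then 1 else 0) + (if Suc r = k' \<and> Suc c = l' then 1 else 0)"
  using assms mat_unit_carrier[of d k l] mat_unit_carrier[of d k' l']
  by (subst index_add_mat(1)) (simp_all only: mat_unit_entry carrier_matD)

text \<open>With indices from 0, the two units lie on the superdiagonal in columns \<open>i\<close>
  and \<open>2 n + 1 - i\<close>. These differ by parity, so no entries are added up.\<close>

lemma e_dual_entry:
  assumes i: "1 \<le> i" "i \<le> n" and rc: "r < Suc (2 * n)" "c < Suc (2 * n)"
  shows "e_dual n i $$ (r, c) = (if c = Suc r \<and> (c = i \<or> r + i = 2 * n)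
     then (if i = n then complex_of_real (sqrt 2) else 1) else 0)"
proof -
  let ?d = "Suc (2 * n)"
  define A where "A = mat_unit ?d i (i + 1) + mat_unit ?d (?d - i) (?d + 1 - i)"
  have Ac: "A \<in> carrier_mat ?d ?d" by (simp add: A_def mat_unit_carrier)
  have "Suc r = i \<and> Suc c = i + 1 \<longleftrightarrow> c = Suc r \<and> c = i" by auto
  moreover have "Suc r = ?d - i \<and> Suc c = ?d + 1 - i \<longleftrightarrow> c = Suc r \<and> r + i = 2 * n"
    using i by auto
  moreover have "\<not> (c = i \<and> r + i = 2 * n)" if "c = Suc r"
  proof
    assume "c = i \<and> r + i = 2 * n"
    then have "2 * r + 1 = 2 * n" using that by simp
    then show False by presburger
  qed
  ultimately have A: "A $$ (r, c) = (if c = Suc r \<and> (c = i \<or> r + i = 2 * n) then 1 else 0)"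
    unfolding A_def mat_unit_add_entry[OF rc] by simp
  have "e_dual n i = (if i = n then complex_of_real (sqrt 2) else 1) \<cdot>\<^sub>m A"
  proof -
    have "1 \<cdot>\<^sub>m B = B" for B :: "complex mat" by (rule eq_matI) auto
    then show ?thesis using i by (simp add: e_dual_def A_def)
  qed
  then have "e_dual n i $$ (r, c) = (if i = n then complex_of_real (sqrt 2) else 1) * A $$ (r, c)"
    using rc Ac by (simp only:) (subst index_smult_mat(1), auto)
  then show ?thesis
    unfolding A by (simp only: mult_1_right mult_zero_right if_distrib[of "\<lambda>x. _ * x"])
qed

lemma e_dual_carrier: "e_dual n i \<in> carrier_mat (Suc (2 * n)) (Suc (2 * n))"
  by (simp add: e_dual_def Let_def mat_unit_def mat1_def)

lemma x_dual_carrier: "x_dual n i s \<in> carrier_mat (Suc (2 * n)) (Suc (2 * n))"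
  using e_dual_carrier[of n i] by (simp add: x_dual_def mat_exp_def)

text \<open>For \<open>i = n\<close> the quadratic term is
  \<open>(sqrt 2 * s)^2 / 2 = s^2\<close>.\<close>

lemma x_dual_entry:
  assumes i: "1 \<le> i" "i \<le> n" and rc: "r \<le> 2 * n" "c \<le> 2 * n"
  shows "x_dual n i s $$ (r, c) =
    (if r = c then 1
     else if c = Suc r \<and> (c = i \<or> r + i = 2 * n) then (if i = n then complex_of_real (sqrt 2) * s else s)
     else if i = n \<and> Suc r = n \<and> c = Suc n then s ^ 2 else 0)"
proof -
  let ?d = "Suc (2 * n)"
  define A where "A = s \<cdot>\<^sub>m e_dual n i"
  define \<kappa> where "\<kappa> = (if i = n then complex_of_real (sqrt 2) * s else s)"
  have Ac: "A \<in> carrier_mat ?d ?d" using e_dual_carrier by (simp add: A_def)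
  have A: "A $$ (r, c) = (if c = Suc r \<and> (c = i \<or> r + i = 2 * n) then \<kappa> else 0)"
    if "r \<le> 2 * n" "c \<le> 2 * n" for r c
  proof -
    have rc: "r < ?d" "c < ?d" using that by auto
    have "A $$ (r, c) = s * e_dual n i $$ (r, c)"
      unfolding A_def using rc e_dual_carrier[of n i] by (subst index_smult_mat(1)) auto
    also have "\<dots> = (if c = Suc r \<and> (c = i \<or> r + i = 2 * n) then \<kappa> else 0)"
      unfolding e_dual_entry[OF i rc] \<kappa>_def
      by (cases "c = Suc r \<and> (c = i \<or> r + i = 2 * n)"; simp only: if_True if_False) simp_all
    finally show ?thesis .
  qed
  have AA: "(A * A) $$ (r, c) = (if i = n \<and> Suc r = n \<and> c = Suc n then \<kappa> ^ 2 else 0)"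
    if "r \<le> 2 * n" "c \<le> 2 * n" for r c
  proof -
    have eq: "(A * A) $$ (r, c) = (\<Sum>k<?d. A $$ (r, k) * A $$ (k, c))"
      using that by (intro mult_mat_entry[OF Ac Ac]) auto
    show ?thesis
    proof (cases "i = n \<and> Suc r = n \<and> c = Suc n")
      case True
      have "(\<Sum>k<?d. A $$ (r, k) * A $$ (k, c)) = A $$ (r, n) * A $$ (n, c)"
        using that True by (intro sum_eq_single) (auto simp: A)
      then show ?thesis using eq that True by (simp add: A power2_eq_square)
    next
      case False
      have "A $$ (r, k) * A $$ (k, c) = 0" if "k < ?d" for k
      proof (rule ccontr)
        assume "A $$ (r, k) * A $$ (k, c) \<noteq> 0"
        then have "k = Suc r" "k = i \<or> r + i = 2 * n" "c = Suc k" "c = i \<or> k + i = 2 * n"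
          using that \<open>r \<le> 2 * n\<close> \<open>c \<le> 2 * n\<close> by (auto simp: A split: if_splits)
        then have "i = n \<and> Suc r = n \<and> c = Suc n" using i by auto
        then show False using False by simp
      qed
      then have "(\<Sum>k<?d. A $$ (r, k) * A $$ (k, c)) = 0" by (intro sum.neutral) simp
      then show ?thesis unfolding eq if_not_P[OF False] .
    qed
  qed
  have AAc: "A * A \<in> carrier_mat ?d ?d" using Ac by simp
  have cube: "A * A * A = 0\<^sub>m ?d ?d"
  proof (rule eq_matI)
    fix r c assume "r < dim_row (0\<^sub>m ?d ?d)" "c < dim_col (0\<^sub>m ?d ?d)"
    then have rc: "r < ?d" "c < ?d" by auto
    have "(A * A * A) $$ (r, c) = (\<Sum>k<?d. (A * A) $$ (r, k) * A $$ (k, c))"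
      by (rule mult_mat_entry[OF AAc Ac rc])
    also have "\<dots> = 0"
    proof (intro sum.neutral ballI)
      fix k assume "k \<in> {..<?d}"
      then show "(A * A) $$ (r, k) * A $$ (k, c) = 0"
        using rc by (cases "i = n \<and> Suc r = n \<and> k = Suc n") (auto simp: AA A)
    qed
    finally show "(A * A * A) $$ (r, c) = 0\<^sub>m ?d ?d $$ (r, c)" using rc by simp
  qed (use Ac in auto)
  have "x_dual n i s $$ (r, c) = (if r = c then 1 else 0) + A $$ (r, c) + (A * A) $$ (r, c) / 2"
    unfolding x_dual_def A_def[symmetric] using rc by (intro mat_exp_nilpotent[OF Ac cube]) auto
  also have "\<dots> = (if r = c then 1 else 0) + (if c = Suc r \<and> (c = i \<or> r + i = 2 * n) then \<kappa> else 0)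
      + (if i = n \<and> Suc r = n \<and> c = Suc n then \<kappa> ^ 2 / 2 else 0)"
    using rc by (simp add: A AA)
  also have "\<dots> = (if r = c then 1 else if c = Suc r \<and> (c = i \<or> r + i = 2 * n) then \<kappa>
     else if i = n \<and> Suc r = n \<and> c = Suc n then \<kappa> ^ 2 / 2 else 0)"
  proof -
    have "Suc (r + r) \<noteq> 2 * n" by presburger
    then show ?thesis by auto
  qed
  also have "\<kappa> ^ 2 / 2 = s ^ 2" if "i = n"
  proof -
    have "complex_of_real (sqrt 2) ^ 2 = 2" by (simp flip: of_real_power)
    then show ?thesis using that by (simp add: \<kappa>_def power_mult_distrib)
  qed
  ultimately show ?thesis by (auto simp: \<kappa>_def)
qed

lemma x_dual_upper:
  assumes "1 \<le> i" "i \<le> n"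
  shows "upper_unitriangular (x_dual n i s)"
  by (auto simp: upper_unitriangular_iff[OF x_dual_carrier] x_dual_entry[OF assms])

lemma x_dual_mult_entry:
  assumes k: "1 \<le> k" "k < n" and R: "R \<in> carrier_mat (Suc (2 * n)) (Suc (2 * n))"
    and ij: "i \<le> 2 * n" "j \<le> 2 * n"
  shows "(x_dual n k s * R) $$ (i, j) =
    R $$ (i, j) + (if Suc i = k \<or> i + k = 2 * n then s * R $$ (Suc i, j) else 0)"
proof -
  have k': "1 \<le> k" "k \<le> n" "k \<noteq> n" using k by auto
  have eq: "(x_dual n k s * R) $$ (i, j) = (\<Sum>l<Suc (2 * n). x_dual n k s $$ (i, l) * R $$ (l, j))"
    using ij by (intro mult_mat_entry[OF x_dual_carrier R]) auto
  show ?thesis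
  proof (cases "Suc i = k \<or> i + k = 2 * n")
    case True
    then have i: "Suc i \<le> 2 * n" using k by auto
    have "(\<Sum>l<Suc (2 * n). x_dual n k s $$ (i, l) * R $$ (l, j)) =
        x_dual n k s $$ (i, i) * R $$ (i, j) + x_dual n k s $$ (i, Suc i) * R $$ (Suc i, j)"
      using ij i k' by (intro sum_eq_pair) (auto simp: x_dual_entry)
    then show ?thesis using eq True ij i k' by (simp add: x_dual_entry)
  next
    case False
    have "(\<Sum>l<Suc (2 * n). x_dual n k s $$ (i, l) * R $$ (l, j)) = x_dual n k s $$ (i, i) * R $$ (i, j)"
      using ij k' False by (intro sum_eq_single) (auto simp: x_dual_entry)
    then show ?thesis using eq False ij k' by (simp add: x_dual_entry)
  qed
qed

lemma mult_x_dual_entry: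
  assumes k: "1 \<le> k" "k < n" and R: "R \<in> carrier_mat (Suc (2 * n)) (Suc (2 * n))"
    and ij: "i \<le> 2 * n" "j \<le> 2 * n"
  shows "(R * x_dual n k s) $$ (i, j) =
    R $$ (i, j) + (if j = k \<or> j + k = Suc (2 * n) then s * R $$ (i, j - 1) else 0)"
proof -
  have k': "1 \<le> k" "k \<le> n" "k \<noteq> n" using k by auto
  have eq: "(R * x_dual n k s) $$ (i, j) = (\<Sum>l<Suc (2 * n). R $$ (i, l) * x_dual n k s $$ (l, j))"
    using ij by (intro mult_mat_entry[OF R x_dual_carrier]) auto
  show ?thesis
  proof (cases "j = k \<or> j + k = Suc (2 * n)")
    case True
    then obtain j' where j': "j = Suc j'" using k by (cases j) auto
    have "(\<Sum>l<Suc (2 * n). R $$ (i, l) * x_dual n k s $$ (l, j)) =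
        R $$ (i, j) * x_dual n k s $$ (j, j) + R $$ (i, j') * x_dual n k s $$ (j', j)"
      using ij k' j' by (intro sum_eq_pair) (auto simp: x_dual_entry)
    then show ?thesis using eq True ij k' j' by (auto simp: x_dual_entry)
  next
    case False
    have "(\<Sum>l<Suc (2 * n). R $$ (i, l) * x_dual n k s $$ (l, j)) = R $$ (i, j) * x_dual n k s $$ (j, j)"
      using ij k' False by (intro sum_eq_single) (auto simp: x_dual_entry)
    then show ?thesis using eq False ij k' by (simp add: x_dual_entry)
  qed
qed

text \<open>The \<open>e_i\<close> are skew for the form, so taking adjoints negates the parameter;
  being an isometry then means that the two exponentials are inverse.\<close>

lemma x_dual_adjoint:
  assumes i: "1 \<le> i" "i \<le> n"
  shows "form_adjoint (Suc (2 * n)) (x_dual n i s) = x_dual n i (- s)"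
proof (rule eq_matI)
  fix r c assume "r < dim_row (x_dual n i (- s))" "c < dim_col (x_dual n i (- s))"
  then have rc: "r \<le> 2 * n" "c \<le> 2 * n" using x_dual_carrier[of n i "- s"] by auto
  have "form_adjoint (Suc (2 * n)) (x_dual n i s) $$ (r, c) =
      (-1) ^ (r + c) * x_dual n i s $$ (2 * n - c, 2 * n - r)"
    using rc by (simp add: form_adjoint_entry)
  also have "\<dots> = x_dual n i (- s) $$ (r, c)"
  proof -
    have eqs: "2 * n - c = 2 * n - r \<longleftrightarrow> r = c"
      "2 * n - r = Suc (2 * n - c) \<and> (2 * n - r = i \<or> 2 * n - c + i = 2 * n) \<longleftrightarrow>
       c = Suc r \<and> (c = i \<or> r + i = 2 * n)"
      "i = n \<and> Suc (2 * n - c) = n \<and> 2 * n - r = Suc n \<longleftrightarrow> i = n \<and> Suc r = n \<and> c = Suc n"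
      using rc i by auto
    have "x_dual n i s $$ (2 * n - c, 2 * n - r) =
      (if r = c then 1
       else if c = Suc r \<and> (c = i \<or> r + i = 2 * n) then (if i = n then complex_of_real (sqrt 2) * s else s)
       else if i = n \<and> Suc r = n \<and> c = Suc n then s ^ 2 else 0)"
      using rc by (subst x_dual_entry[OF i]) (simp_all only: eqs diff_le_self)
    then show ?thesis
      using rc by (auto simp: x_dual_entry[OF i])
  qed
  finally show "form_adjoint (Suc (2 * n)) (x_dual n i s) $$ (r, c) = x_dual n i (- s) $$ (r, c)" .
qed (use x_dual_carrier[of n i "- s"] in auto)

lemma x_dual_n_isometry:
  assumes n: "1 \<le> n"
  shows "x_dual n n s \<in> isometries (Suc (2 * n))"
proof -
  let ?d = "Suc (2 * n)"
  have nn: "1 \<le> n" "n \<le> n" using n by auto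
  have "x_dual n n (- s) * x_dual n n s = 1\<^sub>m ?d"
  proof (rule unitriangular_lower_eq_one)
    show "x_dual n n (- s) * x_dual n n s \<in> carrier_mat ?d ?d"
      by (rule mult_carrier_mat[OF x_dual_carrier x_dual_carrier])
    show "upper_unitriangular (x_dual n n (- s) * x_dual n n s)"
      by (rule upper_unitriangular_mult[OF x_dual_carrier x_dual_upper[OF nn] x_dual_carrier x_dual_upper[OF nn]])
    have two: "complex_of_real (sqrt 2) * complex_of_real (sqrt 2) = 2"
      by (simp flip: of_real_mult)
    show "lower_triangular (x_dual n n (- s) * x_dual n n s)"
      unfolding lower_triangular_iff[OF mult_carrier_mat[OF x_dual_carrier x_dual_carrier]]
    proof (intro allI impI)
      fix r c assume rc: "r < ?d" "c < ?d" "r < c"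
      let ?t = "\<lambda>k. x_dual n n (- s) $$ (r, k) * x_dual n n s $$ (k, c)"
      have E: "x_dual n n \<sigma> $$ (i, j) = (if i = j then 1 else if j = Suc i \<and> (j = n \<or> i = n) then complex_of_real (sqrt 2) * \<sigma>
        else if Suc i = n \<and> j = Suc n then \<sigma> ^ 2 else 0)" if "i < ?d" "j < ?d" for \<sigma> i j
        using x_dual_entry[OF nn, of i j \<sigma>] that by auto
      have "(x_dual n n (- s) * x_dual n n s) $$ (r, c) = (\<Sum>k<?d. ?t k)"
        by (rule mult_mat_entry[OF x_dual_carrier x_dual_carrier rc(1,2)])
      also have "\<dots> = 0"
      proof (cases "Suc r = n \<and> c = Suc n")
        case True
        \<comment> \<open>The only position with three contributions:
          \<open>s^2 - 2 s^2 + s^2\<close>.\<close>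
        have "(\<Sum>k<?d. ?t k) = sum ?t {r, n, c}"
          using rc True by (intro sum.mono_neutral_right) (auto simp: E)
        also have "\<dots> = ?t r + ?t n + ?t c" using True by auto
        also have "\<dots> = s ^ 2 - (complex_of_real (sqrt 2) * complex_of_real (sqrt 2)) * (s * s) + s ^ 2"
          using rc True by (simp add: E)
        finally show ?thesis by (simp add: two power2_eq_square)
      next
        case False
        have "(\<Sum>k<?d. ?t k) = ?t r + ?t c"
          using rc False by (intro sum_eq_pair) (auto simp: E)
        also have "\<dots> = x_dual n n s $$ (r, c) + x_dual n n (- s) $$ (r, c)"
          using rc by (simp add: x_dual_entry[OF nn])
        also have "\<dots> = 0"
          unfolding E[OF rc(1,2)] using rc False by auto
        finally show ?thesis .
      qed
      finally show "(x_dual n n (- s) * x_dual n n s) $$ (r, c) = 0" .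
    qed
  qed
  then show ?thesis
    using x_dual_carrier by (simp add: isometries_def x_dual_adjoint[OF nn])
qed

lemma x_dual_isometry:
  assumes i: "1 \<le> i" "i \<le> n"
  shows "x_dual n i s \<in> isometries (Suc (2 * n))"
proof (cases "i = n")
  case False
  then have i': "1 \<le> i" "i < n" using i by auto
  have "x_dual n i (- s) * x_dual n i s = 1\<^sub>m (Suc (2 * n))"
  proof (rule eq_matI)
    fix r c assume "r < dim_row (1\<^sub>m (Suc (2 * n)))" "c < dim_col (1\<^sub>m (Suc (2 * n)))"
    then have rc: "r \<le> 2 * n" "c \<le> 2 * n" by auto
    have "(x_dual n i (- s) * x_dual n i s) $$ (r, c) = x_dual n i s $$ (r, c) +
        (if Suc r = i \<or> r + i = 2 * n then - s * x_dual n i s $$ (Suc r, c) else 0)"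
      by (rule x_dual_mult_entry[OF i' x_dual_carrier rc])
    also have "\<dots> = 1\<^sub>m (Suc (2 * n)) $$ (r, c)"
    proof (cases "Suc r = i \<or> r + i = 2 * n")
      case True
      then have r: "Suc r \<le> 2 * n" using i' by auto
      \<comment> \<open>Row \<open>Suc r\<close> of \<open>x_dual n i s\<close> is a unit vector, so
        the two superdiagonal contributions cancel.\<close>
      have "\<not> (c = Suc (Suc r) \<and> (c = i \<or> Suc r + i = 2 * n))" using True i' by auto
      then show ?thesis
        using True rc r i' False by (auto simp: x_dual_entry[OF i])
    next
      case no: False
      then show ?thesis using rc False by (auto simp: x_dual_entry[OF i])
    qed
    finally show "(x_dual n i (- s) * x_dual n i s) $$ (r, c) = 1\<^sub>m (Suc (2 * n)) $$ (r, c)" .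
  qed (use x_dual_carrier[of n i s] x_dual_carrier[of n i "- s"] in auto)
  then show ?thesis
    using x_dual_carrier by (simp add: isometries_def x_dual_adjoint[OF i])
qed (use x_dual_n_isometry i in auto)

lemma upper_unitriangular_det:
  assumes "g \<in> carrier_mat d d" "upper_unitriangular g"
  shows "det g = 1"
proof -
  have "det g = prod_list (diag_mat g)"
    using assms by (intro det_upper_triangular) (auto simp: upper_unitriangular_def)
  also have "\<dots> = 1"
    using assms by (simp add: prod_list_diag_prod upper_unitriangular_def)
  finally show ?thesis .
qed

section \<open>The unipotent group and its character\<close>

lemma U_dual_eq: "U_dual n = {g \<in> isometries (Suc (2 * n)). upper_unitriangular g}"
  unfolding U_dual_def SO_group_eq
  using upper_unitriangular_det[of _ "Suc (2 * n)"] isometries_carrier[of _ "Suc (2 * n)"] by auto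

lemma U_dual_mult: "u \<in> U_dual n \<Longrightarrow> v \<in> U_dual n \<Longrightarrow> u * v \<in> U_dual n"
  unfolding U_dual_eq
  by (auto intro: isometries_mult upper_unitriangular_mult dest: isometries_carrier)

lemma U_dual_adjoint: "u \<in> U_dual n \<Longrightarrow> form_adjoint (Suc (2 * n)) u \<in> U_dual n"
  unfolding U_dual_eq
  by (auto intro: isometries_adjoint upper_unitriangular_adjoint dest: isometries_carrier)

lemma U_dual_carrier: "u \<in> U_dual n \<Longrightarrow> u \<in> carrier_mat (Suc (2 * n)) (Suc (2 * n))"
  unfolding U_dual_eq by (auto dest: isometries_carrier)

lemma x_dual_in_U_dual: "1 \<le> i \<Longrightarrow> i \<le> n \<Longrightarrow> x_dual n i s \<in> U_dual n"
  unfolding U_dual_eq by (simp add: x_dual_isometry x_dual_upper)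

text \<open>It is additive on \<open>U_dual\<close> and returns the parameter on each root subgroup,
  so on a Lusztig word it is the sum of all parameters.\<close>

definition eps_sum :: "nat \<Rightarrow> complex mat \<Rightarrow> complex" where
  "eps_sum n u = (\<Sum>i=1..n. eps_dual n i u)"

lemma eps_dual_eq: "eps_dual n i u = (if i < n then 1 else 1 / complex_of_real (sqrt 2)) *
    (if i < n then u $$ (i - 1, i) else u $$ (n - 1, n))"
  by (simp add: eps_dual_def entry1_def)

lemma eps_sum_mult:
  assumes "u \<in> U_dual n" "v \<in> U_dual n"
  shows "eps_sum n (u * v) = eps_sum n u + eps_sum n v"
  unfolding eps_sum_def sum.distrib[symmetric]
proof (rule sum.cong)
  fix i assume i: "i \<in> {1..n}"
  have "(u * v) $$ (i - 1, Suc (i - 1)) = u $$ (i - 1, Suc (i - 1)) + v $$ (i - 1, Suc (i - 1))"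
    using assms i unfolding U_dual_eq
    by (intro upper_unitriangular_mult_superdiagonal[of _ "Suc (2 * n)"]) (auto dest: isometries_carrier)
  then show "eps_dual n i (u * v) = eps_dual n i u + eps_dual n i v"
    using i by (cases "i = n") (auto simp: eps_dual_eq add_divide_distrib)
qed simp

lemma eps_sum_x_dual:
  assumes i: "1 \<le> i" "i \<le> n"
  shows "eps_sum n (x_dual n i s) = s"
proof -
  have "eps_dual n k (x_dual n i s) = (if k = i then s else 0)" if k: "k \<in> {1..n}" for k
  proof -
    obtain j where j: "k = Suc j" using k by (cases k) auto
    have "x_dual n i s $$ (j, k) = (if k = i then (if i = n then complex_of_real (sqrt 2) * s else s) else 0)"
      using i k j by (subst x_dual_entry[OF i]) auto
    then show ?thesis using k j i by (auto simp: eps_dual_eq)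
  qed
  then have "eps_sum n (x_dual n i s) = (\<Sum>k=1..n. if k = i then s else 0)"
    unfolding eps_sum_def by (intro sum.cong) auto
  then show ?thesis using i by simp
qed

section \<open>The superpotential on the Lusztig torus\<close>

lemma U_dual_entry:
  assumes "u \<in> U_dual n" "i \<le> 2 * n" "j \<le> i"
  shows "u $$ (i, j) = (if j = i then 1 else 0)"
  using assms upper_unitriangular_iff[OF U_dual_carrier[OF assms(1)]] by (auto simp: U_dual_eq)

text \<open>Applied to the inner subwords \<open>x\<^sub>k(a\<^sub>k)\<cdots>x\<^sub>n(b)\<cdots>x\<^sub>k(c\<^sub>k)\<close> of the Lusztig word with \<open>t = k - 1\<close>
  and \<open>t + \<tau> = 2 n\<close>.\<close>

definition subword_shape :: "nat \<Rightarrow> nat \<Rightarrow> nat \<Rightarrow> complex \<Rightarrow> complex \<Rightarrow> complex mat \<Rightarrow> bool" where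
  "subword_shape n t \<tau> P s R \<longleftrightarrow> R \<in> U_dual n \<and>
     (\<forall>i\<le>2*n. \<forall>j\<le>2*n. i \<noteq> j \<longrightarrow> i < t \<or> \<tau> < j \<longrightarrow> R $$ (i, j) = 0) \<and>
     R $$ (t, \<tau>) = P \<and>
     (\<exists>r. \<forall>i j. t < i \<longrightarrow> i < j \<longrightarrow> j \<le> \<tau> \<longrightarrow> R $$ (i, j) = r i * R $$ (t, j)) \<and>
     eps_sum n R = s"

text \<open>Below row \<open>t\<close> the block has a single entry above the diagonal, at
  \<open>(n, n + 1)\<close>; its quotient by the entry above it is
  \<open>sqrt 2 * b / b^2\<close>.\<close>

lemma subword_shape_base:
  assumes b: "b \<noteq> 0" and t: "n = Suc t"
  shows "subword_shape n t (Suc n) (b ^ 2) b (x_dual n n b)"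
proof -
  have n: "1 \<le> n" "n \<le> n" using t by auto
  have E: "x_dual n n b $$ (i, j) = (if i = j then 1
     else if j = Suc i \<and> (j = n \<or> i = n) then complex_of_real (sqrt 2) * b
     else if i = t \<and> j = Suc n then b ^ 2 else 0)" if "i \<le> 2 * n" "j \<le> 2 * n" for i j
    using x_dual_entry[OF n that, of b] t by auto
  have "\<forall>i\<le>2*n. \<forall>j\<le>2*n. i \<noteq> j \<longrightarrow> i < t \<or> Suc n < j \<longrightarrow> x_dual n n b $$ (i, j) = 0"
  proof (intro allI impI)
    fix i j assume "i \<le> 2 * n" "j \<le> 2 * n" "i \<noteq> j" "i < t \<or> Suc n < j"
    then show "x_dual n n b $$ (i, j) = 0" using E[of i j] t by auto
  qed
  moreover have "x_dual n n b $$ (t, Suc n) = b ^ 2"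
    using E[of t "Suc n"] t by auto
  moreover have "x_dual n n b $$ (i, j) = (complex_of_real (sqrt 2) / b) * x_dual n n b $$ (t, j)"
    if "t < i" "i < j" "j \<le> Suc n" for i j
  proof -
    have "i = n" "j = Suc n" using that t by auto
    moreover have "x_dual n n b $$ (n, Suc n) = complex_of_real (sqrt 2) * b"
      using E[of n "Suc n"] t by auto
    moreover have "x_dual n n b $$ (t, Suc n) = b ^ 2"
      using E[of t "Suc n"] t by auto
    ultimately show ?thesis using b by (simp add: power2_eq_square)
  qed
  ultimately show ?thesis
    unfolding subword_shape_def using x_dual_in_U_dual[OF n] eps_sum_x_dual[OF n]
    by (auto intro!: exI[of _ "\<lambda>_. complex_of_real (sqrt 2) / b"])
qed

text \<open>The left factor adds \<open>a\<close> times rows \<open>t + 1\<close> and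
  \<open>\<tau> + 1\<close> to the rows before them, the right factor adds \<open>c\<close> times
  columns \<open>t\<close> and \<open>\<tau>\<close> to the columns after them. Up to the factors
  \<open>a\<close> and \<open>c\<close>, the old top row and the old last column reappear as the new
  ones, and so the rank-one relation survives.\<close>

lemma subword_shape_step:
  assumes R: "subword_shape n (Suc t) \<tau> P s R" and t: "Suc t < n" "Suc t + \<tau> = 2 * n"
    and nz: "a \<noteq> 0" "P \<noteq> 0" "c \<noteq> 0"
  defines "R' \<equiv> x_dual n (Suc t) a * (R * x_dual n (Suc t) c)"
  shows "subword_shape n t (Suc \<tau>) (a * P * c) (a + s + c) R'" and "R' $$ (\<tau>, Suc \<tau>) = a + c"
proof -
  have k: "1 \<le> Suc t" "Suc t < n" "Suc t \<le> n" using t by auto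
  have U: "R \<in> U_dual n" using R by (simp add: subword_shape_def)
  have Z: "R $$ (i, j) = 0" if "i \<noteq> j" "i \<le> t \<or> \<tau> < j" "i \<le> 2 * n" "j \<le> 2 * n" for i j
    using R that by (auto simp: subword_shape_def)
  have P: "R $$ (Suc t, \<tau>) = P" using R by (simp add: subword_shape_def)
  obtain r where r: "\<And>i j. Suc t < i \<Longrightarrow> i < j \<Longrightarrow> j \<le> \<tau> \<Longrightarrow> R $$ (i, j) = r i * R $$ (Suc t, j)"
    using R unfolding subword_shape_def by blast
  have D: "R $$ (i, i) = 1" if "i \<le> 2 * n" for i using U_dual_entry[OF U that, of i] by simp
  have L: "R $$ (i, j) = 0" if "j < i" "i \<le> 2 * n" for i j using U_dual_entry[OF U that(2), of j] that by simp
  have \<tau>: "t + 3 \<le> \<tau>" "\<tau> < 2 * n" using t by auto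
  define R1 where "R1 i j = R $$ (i, j) + (if j = Suc t \<or> j = Suc \<tau> then c * R $$ (i, j - 1) else 0)" for i j
  have E: "R' $$ (i, j) = R1 i j + (if i = t \<or> i = \<tau> then a * R1 (Suc i) j else 0)"
    if ij: "i \<le> 2 * n" "j \<le> 2 * n" for i j
  proof -
    have c: "R * x_dual n (Suc t) c \<in> carrier_mat (Suc (2 * n)) (Suc (2 * n))"
      by (rule mult_carrier_mat[OF U_dual_carrier[OF U] x_dual_carrier])
    have iff: "i + Suc t = 2 * n \<longleftrightarrow> i = \<tau>" "j + Suc t = Suc (2 * n) \<longleftrightarrow> j = Suc \<tau>" for i j
      using t by auto
    have 1: "(R * x_dual n (Suc t) c) $$ (i, j) = R1 i j" if "i \<le> 2 * n" "j \<le> 2 * n" for i j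
      unfolding R1_def mult_x_dual_entry[OF k(1,2) U_dual_carrier[OF U] that] iff ..
    have "R' $$ (i, j) = R1 i j + (if Suc i = Suc t \<or> i = \<tau> then a * (R * x_dual n (Suc t) c) $$ (Suc i, j) else 0)"
      unfolding R'_def x_dual_mult_entry[OF k(1,2) c ij] iff 1[OF ij] ..
    moreover have "Suc i \<le> 2 * n" if "i = t \<or> i = \<tau>" using that \<tau> by auto
    ultimately show ?thesis using 1[of "Suc i" j] ij by auto
  qed
  have t_next: "R' $$ (t, Suc t) = a + c"
    using \<tau> by (simp add: E R1_def Z D L)
  have t_mid: "R' $$ (t, j) = a * R $$ (Suc t, j)" if "Suc t < j" "j \<le> \<tau>" for j
    using \<tau> that by (simp add: E R1_def Z)
  have t_last: "R' $$ (t, Suc \<tau>) = a * P * c"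
    using \<tau> by (simp add: E R1_def Z P)
  have last: "R' $$ (\<tau>, Suc \<tau>) = a + c"
    using \<tau> by (simp add: E R1_def Z D L)
  then show "R' $$ (\<tau>, Suc \<tau>) = a + c" .
  \<comment> \<open>Row \<open>\<tau>\<close> has only one entry in range, so its quotient is read
    off directly; the outermost instance becomes the \<open>q\<close>-term. Row \<open>t + 1\<close>
    is the old top row.\<close>
  define r' where "r' i = (if i = \<tau> then (a + c) / (a * P * c) else if i = Suc t then 1 / a else r i / a)" for i
  have rank: "R' $$ (i, j) = r' i * R' $$ (t, j)" if ij: "t < i" "i < j" "j \<le> Suc \<tau>" for i j
  proof -
    consider "i = \<tau>" "j = Suc \<tau>" | "i = Suc t" "j \<le> \<tau>" | "i = Suc t" "j = Suc \<tau>"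
      | "Suc t < i" "i < \<tau>" "j \<le> \<tau>" | "Suc t < i" "i < \<tau>" "j = Suc \<tau>"
      using ij by linarith
    then show ?thesis
    proof cases
      case 1
      then show ?thesis using nz by (simp add: last t_last r'_def)
    next
      case 2
      have "R' $$ (i, j) = R $$ (Suc t, j)"
        using 2 ij \<tau> by (simp add: E R1_def)
      then show ?thesis using 2 ij \<tau> nz by (simp add: t_mid r'_def)
    next
      case 3
      have "R' $$ (i, j) = c * P"
        using 3 ij \<tau> by (simp add: E R1_def Z P)
      then show ?thesis using 3 \<tau> nz by (simp add: t_last r'_def)
    next
      case 4
      have "R' $$ (i, j) = R $$ (i, j)"
        using 4 ij \<tau> by (simp add: E R1_def)
      then show ?thesis using 4 ij nz r[of i j] by (simp add: t_mid r'_def)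
    next
      case 5
      have "R' $$ (i, j) = c * R $$ (i, \<tau>)"
        using 5 ij \<tau> by (simp add: E R1_def Z)
      then show ?thesis using 5 nz r[of i \<tau>] by (simp add: t_last r'_def P)
    qed
  qed
  have out: "R' $$ (i, j) = 0" if "i \<noteq> j" "i < t \<or> Suc \<tau> < j" "i \<le> 2 * n" "j \<le> 2 * n" for i j
  proof -
    have "R1 i' j = 0" if "i' \<noteq> j" "i' = i \<or> (i = t \<or> i = \<tau>) \<and> i' = Suc i" for i'
    proof -
      have "i' \<le> 2 * n" using that \<open>i \<le> 2 * n\<close> \<tau> by auto
      moreover have "i' \<le> t \<or> \<tau> < j"
        using that \<open>i < t \<or> Suc \<tau> < j\<close> by auto
      moreover have "j = Suc t \<or> j = Suc \<tau> \<Longrightarrow> i' < t \<and> i' \<noteq> j - 1 \<and> j - 1 \<le> 2 * n"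
        using that \<open>i < t \<or> Suc \<tau> < j\<close> \<open>j \<le> 2 * n\<close> \<tau> by auto
      ultimately show ?thesis using that \<open>j \<le> 2 * n\<close> by (auto simp: R1_def Z)
    qed
    then show ?thesis using that \<tau> by (auto simp: E)
  qed
  have U': "R' \<in> U_dual n"
    unfolding R'_def using U x_dual_in_U_dual[OF k(1,3)] by (intro U_dual_mult)
  have "eps_sum n R' = a + s + c"
    unfolding R'_def using R U x_dual_in_U_dual[OF k(1,3)] eps_sum_x_dual[OF k(1,3)]
    by (simp add: eps_sum_mult U_dual_mult subword_shape_def)
  then show "subword_shape n t (Suc \<tau>) (a * P * c) (a + s + c) R'"
    unfolding subword_shape_def using U' out t_last rank by blast
qed

text \<open>Pulls a right factor out of the fold, so that the last letter of a word can be split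
  off.\<close>

lemma foldr_mult_mat:
  fixes z :: "complex mat"
  assumes "\<And>x. x \<in> set xs \<Longrightarrow> x \<in> carrier_mat d d" "z \<in> carrier_mat d d"
  shows "foldr (*) xs z = foldr (*) xs (1\<^sub>m d) * z \<and> foldr (*) xs z \<in> carrier_mat d d"
  using assms
proof (induction xs)
  case (Cons x xs)
  have c: "foldr (*) xs (1\<^sub>m d) \<in> carrier_mat d d"
    using Cons.prems by (induction xs) (auto intro!: mult_carrier_mat)
  then show ?case
    using Cons assoc_mult_mat[of x d d "foldr (*) xs (1\<^sub>m d)" d z d] by (auto intro: mult_carrier_mat)
qed simp

definition lusztig_subword ::
    "nat \<Rightarrow> (nat \<Rightarrow> complex) \<Rightarrow> complex \<Rightarrow> (nat \<Rightarrow> complex) \<Rightarrow> nat \<Rightarrow> complex mat" where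
  "lusztig_subword n a b c k = foldr (*)
     (map (\<lambda>i. x_dual n i (a i)) [k..<n] @ [x_dual n n b] @
      map (\<lambda>i. x_dual n i (c i)) (rev [k..<n]))
     (1\<^sub>m (2 * n + 1))"

lemma lusztig_subword_n: "lusztig_subword n a b c n = x_dual n n b"
  using x_dual_carrier[of n n b] by (simp add: lusztig_subword_def)

lemma lusztig_subword_step:
  assumes "k < n"
  shows "lusztig_subword n a b c k =
    x_dual n k (a k) * (lusztig_subword n a b c (Suc k) * x_dual n k (c k))"
proof -
  define L where "L = map (\<lambda>i. x_dual n i (a i)) [Suc k..<n] @ [x_dual n n b] @
      map (\<lambda>i. x_dual n i (c i)) (rev [Suc k..<n])"
  let ?d = "Suc (2 * n)"
  have "lusztig_subword n a b c k = x_dual n k (a k) * foldr (*) L (x_dual n k (c k))"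
    using assms x_dual_carrier[of n k "c k"]
    by (simp add: lusztig_subword_def L_def upt_conv_Cons)
  moreover have "foldr (*) L (x_dual n k (c k)) = foldr (*) L (1\<^sub>m ?d) * x_dual n k (c k)"
    by (rule foldr_mult_mat[THEN conjunct1]) (auto simp: L_def x_dual_carrier)
  moreover have "foldr (*) L (1\<^sub>m ?d) = lusztig_subword n a b c (Suc k)"
    by (simp add: lusztig_subword_def L_def)
  ultimately show ?thesis by simp
qed

lemma prod_sum_interval_step:
  fixes a :: "nat \<Rightarrow> complex"
  assumes "Suc t < n"
  shows "(\<Prod>i=Suc t..<n. a i) = a (Suc t) * (\<Prod>i=Suc (Suc t)..<n. a i)"
    and "(\<Sum>i=Suc t..<n. a i) = a (Suc t) + (\<Sum>i=Suc (Suc t)..<n. a i)"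
  using assms by (simp_all add: prod.atLeast_Suc_lessThan sum.atLeast_Suc_lessThan)

text \<open>Induction outwards from the middle letter: \<open>t\<close> runs from
  \<open>n - 1\<close> down to 0.\<close>

lemma lusztig_subword_shape:
  assumes b: "b \<noteq> 0" and ac: "\<And>i. 1 \<le> i \<Longrightarrow> i < n \<Longrightarrow> a i \<noteq> 0 \<and> c i \<noteq> 0"
  shows "t < n \<Longrightarrow> subword_shape n t (2 * n - t)
    ((\<Prod>i=Suc t..<n. a i) * b ^ 2 * (\<Prod>i=Suc t..<n. c i))
    ((\<Sum>i=Suc t..<n. a i) + b + (\<Sum>i=Suc t..<n. c i)) (lusztig_subword n a b c (Suc t))"
proof (induction "n - Suc t" arbitrary: t)
  case 0
  then have "n = Suc t" by simp
  moreover have "2 * n - t = Suc n" using calculation by simp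
  ultimately show ?case
    using subword_shape_base[OF b, of n t] by (simp add: lusztig_subword_n[of "Suc t"])
next
  case (Suc m)
  then have t: "Suc t < n" by simp
  have \<tau>: "Suc t + (2 * n - Suc t) = 2 * n" "Suc (2 * n - Suc t) = 2 * n - t" using t by auto
  have IH: "subword_shape n (Suc t) (2 * n - Suc t)
    ((\<Prod>i=Suc (Suc t)..<n. a i) * b ^ 2 * (\<Prod>i=Suc (Suc t)..<n. c i))
    ((\<Sum>i=Suc (Suc t)..<n. a i) + b + (\<Sum>i=Suc (Suc t)..<n. c i)) (lusztig_subword n a b c (Suc (Suc t)))"
    using Suc t by (intro Suc.hyps(1)) auto
  have nz: "a (Suc t) \<noteq> 0" "c (Suc t) \<noteq> 0"
    "(\<Prod>i=Suc (Suc t)..<n. a i) * b ^ 2 * (\<Prod>i=Suc (Suc t)..<n. c i) \<noteq> 0"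
    using ac b t by (auto simp: prod_zero_iff)
  show ?case
    using subword_shape_step(1)[OF IH t \<tau>(1) nz(1,3,2)]
    unfolding lusztig_subword_step[OF t] prod_sum_interval_step[OF t] \<tau>(2)
    by (simp add: mult_ac add_ac)
qed

section \<open>The matrix t(q) M of the dual side\<close>

definition dual_middle :: "nat \<Rightarrow> complex \<Rightarrow> complex mat" where
  "dual_middle n q = t_dual n q * M_dual n"

lemma dual_middle_carrier: "dual_middle n q \<in> carrier_mat (Suc (2 * n)) (Suc (2 * n))"
  unfolding dual_middle_def by (rule mult_carrier_mat[of _ _ "Suc (2 * n)"]) (simp_all add: t_dual_def M_dual_def mat1_def)

lemma dual_middle_entry:
  assumes "i \<le> 2 * n" "j \<le> 2 * n"
  shows "dual_middle n q $$ (i, j) = (if i = 0 \<and> j = 2 * n then q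
    else if i = 2 * n \<and> j = 0 then inverse q
    else if i = j \<and> i \<noteq> 0 \<and> i \<noteq> 2 * n then -1 else 0)"
proof -
  have c: "t_dual n q \<in> carrier_mat (Suc (2 * n)) (Suc (2 * n))"
    "M_dual n \<in> carrier_mat (Suc (2 * n)) (Suc (2 * n))"
    by (simp_all add: t_dual_def M_dual_def mat1_def)
  have t: "t_dual n q $$ (i, k) = (if k \<noteq> i then 0 else if i = 0 then q else if i = 2 * n then inverse q else 1)"
    if "k \<le> 2 * n" for k
    using that assms by (auto simp: t_dual_def mat1_def)
  have M: "M_dual n $$ (i, j) = (if i = 0 \<and> j = 2 * n \<or> i = 2 * n \<and> j = 0 then 1
    else if i = j \<and> i \<noteq> 0 \<and> i \<noteq> 2 * n then -1 else 0)"
    using assms by (auto simp: M_dual_def mat1_def)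
  have "dual_middle n q $$ (i, j) = (\<Sum>k<Suc (2 * n). t_dual n q $$ (i, k) * M_dual n $$ (k, j))"
    unfolding dual_middle_def using assms by (intro mult_mat_entry[OF c]) auto
  also have "\<dots> = t_dual n q $$ (i, i) * M_dual n $$ (i, j)"
    using assms by (intro sum_eq_single) (auto simp: t)
  also have "\<dots> = (if i = 0 \<and> j = 2 * n then q
    else if i = 2 * n \<and> j = 0 then inverse q
    else if i = j \<and> i \<noteq> 0 \<and> i \<noteq> 2 * n then -1 else 0)"
    using assms(1) unfolding M t[OF assms(1)] by auto
  finally show ?thesis .
qed

lemma dual_middle_mult_entry:
  assumes n: "n \<ge> 1" and X: "X \<in> carrier_mat (Suc (2 * n)) (Suc (2 * n))" and ij: "i \<le> 2 * n" "j \<le> 2 * n"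
  shows "(dual_middle n q * X) $$ (i, j) = (if i = 0 then q * X $$ (2 * n, j)
    else if i = 2 * n then inverse q * X $$ (0, j) else - X $$ (i, j))"
proof -
  define k where "k = (if i = 0 then 2 * n else if i = 2 * n then 0 else i)"
  have k: "k \<le> 2 * n" using ij by (simp add: k_def)
  have "(dual_middle n q * X) $$ (i, j) = (\<Sum>k<Suc (2 * n). dual_middle n q $$ (i, k) * X $$ (k, j))"
    using ij by (intro mult_mat_entry[OF dual_middle_carrier X]) auto
  also have "\<dots> = dual_middle n q $$ (i, k) * X $$ (k, j)"
  proof (rule sum_eq_single)
    fix l assume "l \<in> {..<Suc (2 * n)}" "l \<noteq> k"
    then have "dual_middle n q $$ (i, l) = 0"
      using ij by (auto simp: dual_middle_entry k_def split: if_splits)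
    then show "dual_middle n q $$ (i, l) * X $$ (l, j) = 0" by simp
  qed (use k in auto)
  also have "dual_middle n q $$ (i, k) = (if i = 0 then q else if i = 2 * n then inverse q else -1)"
    unfolding dual_middle_entry[OF ij(1) k] using n by (simp add: k_def)
  finally show ?thesis by (simp add: k_def)
qed

lemma mult_dual_middle_entry:
  assumes n: "n \<ge> 1" and X: "X \<in> carrier_mat (Suc (2 * n)) (Suc (2 * n))" and ij: "i \<le> 2 * n" "j \<le> 2 * n"
  shows "(X * dual_middle n q) $$ (i, j) = (if j = 0 then inverse q * X $$ (i, 2 * n)
    else if j = 2 * n then q * X $$ (i, 0) else - X $$ (i, j))"
proof -
  define k where "k = (if j = 0 then 2 * n else if j = 2 * n then 0 else j)"
  have k: "k \<le> 2 * n" using ij by (simp add: k_def)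
  have "(X * dual_middle n q) $$ (i, j) = (\<Sum>k<Suc (2 * n). X $$ (i, k) * dual_middle n q $$ (k, j))"
    using ij by (intro mult_mat_entry[OF X dual_middle_carrier]) auto
  also have "\<dots> = X $$ (i, k) * dual_middle n q $$ (k, j)"
  proof (rule sum_eq_single)
    fix l assume "l \<in> {..<Suc (2 * n)}" "l \<noteq> k"
    then have "dual_middle n q $$ (l, j) = 0"
      using ij by (auto simp: dual_middle_entry k_def split: if_splits)
    then show "X $$ (i, l) * dual_middle n q $$ (l, j) = 0" by simp
  qed (use k in auto)
  also have "dual_middle n q $$ (k, j) = (if j = 0 then inverse q else if j = 2 * n then q else -1)"
    unfolding dual_middle_entry[OF k ij(2)] using n by (simp add: k_def)
  finally show ?thesis by (simp add: k_def)
qed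

lemma dual_middle_isometry:
  assumes n: "n \<ge> 1" and q: "q \<noteq> 0"
  shows "dual_middle n q \<in> isometries (Suc (2 * n))"
proof (rule isometriesI[OF dual_middle_carrier])
  fix j l assume "j < Suc (2 * n)" "l < Suc (2 * n)"
  then have jl: "j \<le> 2 * n" "l \<le> 2 * n" by auto
  let ?g = "dual_middle n q"
  define k where "k = (if j = 0 then 2 * n else if j = 2 * n then 0 else j)"
  have k: "k \<le> 2 * n" using jl by (simp add: k_def)
  have "(\<Sum>i<Suc (2 * n). (-1) ^ i * ?g $$ (i, j) * ?g $$ (2 * n - i, l)) =
      (-1) ^ k * ?g $$ (k, j) * ?g $$ (2 * n - k, l)"
  proof (rule sum_eq_single)
    fix i assume "i \<in> {..<Suc (2 * n)}" "i \<noteq> k"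
    then have "?g $$ (i, j) = 0" using jl by (auto simp: dual_middle_entry k_def split: if_splits)
    then show "(-1) ^ i * ?g $$ (i, j) * ?g $$ (2 * n - i, l) = 0" by simp
  qed (use k in auto)
  also have "\<dots> = (if j + l = 2 * n then (-1) ^ j else 0)"
  proof -
    have "?g $$ (k, j) = (if j = 0 then inverse q else if j = 2 * n then q else -1)"
      unfolding dual_middle_entry[OF k jl(1)] using n by (simp add: k_def)
    moreover have "?g $$ (2 * n - k, l) = (if j + l \<noteq> 2 * n then 0
        else if j = 0 then q else if j = 2 * n then inverse q else -1)"
      using n jl by (subst dual_middle_entry) (auto simp: k_def)
    ultimately show ?thesis using q by (simp add: k_def)
  qed
  finally show "(\<Sum>i<Suc (2 * n). (-1) ^ i * ?g $$ (i, j) * ?g $$ (Suc (2 * n) - 1 - i, l)) =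
      (if j + l + 1 = Suc (2 * n) then (-1) ^ j else 0)" by simp
qed

text \<open>Exchanging the first and last rows gives a diagonal matrix with entries
  \<open>q^-1\<close>, \<open>q\<close> and \<open>2 n - 1\<close> times \<open>-1\<close>; the
  exchange contributes the other sign.\<close>

lemma det_dual_middle:
  assumes n: "n \<ge> 1" and q: "q \<noteq> 0"
  shows "det (dual_middle n q) = 1"
proof -
  let ?d = "Suc (2 * n)" and ?g = "dual_middle n q"
  define A where "A = swaprows 0 (2 * n) ?g"
  have c: "A \<in> carrier_mat ?d ?d"
    using dual_middle_carrier by (simp add: A_def)
  have E: "A $$ (i, j) = (if i \<noteq> j then 0
      else if i = 0 then inverse q else if i = 2 * n then q else -1)" if "i \<le> 2 * n" "j \<le> 2 * n" for i j
    using that n dual_middle_carrier[of n q] unfolding A_def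
    by (subst index_mat_swaprows(1)) (auto simp: dual_middle_entry)
  have "det A = prod_list (diag_mat A)"
    using c by (intro det_upper_triangular[OF _ c]) (auto simp: upper_triangular_def E)
  also have "\<dots> = (\<Prod>i<?d. if i = 0 then inverse q else if i = 2 * n then q else -1)"
    using c unfolding prod_list_diag_prod by (intro prod.cong) (auto simp: E)
  also have "\<dots> = -1"
  proof -
    obtain m where m: "2 * n = Suc m" using n by (cases "2 * n") auto
    have "odd m" using m by presburger
    have "(\<Prod>i<?d. if i = 0 then inverse q else if i = 2 * n then q else -1) =
        (\<Prod>i<Suc m. if i = 0 then inverse q else -1) * q"
    proof -
      have "(\<Prod>i<Suc m. if i = 0 then inverse q else if i = Suc m then q else -1) =
          (\<Prod>i<Suc m. if i = 0 then inverse q else -1)"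
        by (intro prod.cong) auto
      then show ?thesis unfolding m prod.lessThan_Suc[of _ "Suc m"] by simp
    qed
    also have "(\<Prod>i<Suc m. if i = 0 then inverse q else -1) = inverse q * (-1) ^ m"
      by (simp only: prod.lessThan_Suc_shift) simp
    finally show ?thesis using q \<open>odd m\<close> by simp
  qed
  finally show ?thesis
    using det_swaprows[of 0 ?d "2 * n" ?g] n dual_middle_carrier[of n q] by (simp add: A_def)
qed

section \<open>The superpotential is well defined\<close>

text \<open>Such a pair measures the difference of two decompositions of one point. Inner
  superdiagonal entries agree directly, while entry \<open>(0, 1)\<close> of either matrix is
  matched with a vanishing entry \<open>(2 n, 1)\<close> of the other.\<close>

lemma eps_sum_conjugate:
  assumes n: "n \<ge> 2" and w: "w \<in> U_dual n" and w': "w' \<in> U_dual n"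
    and eq: "w * dual_middle n q = dual_middle n q * w'" and q: "q \<noteq> 0"
  shows "eps_sum n w = eps_sum n w'"
  unfolding eps_sum_def
proof (rule sum.cong)
  have n1: "n \<ge> 1" using n by simp
  fix i assume i: "i \<in> {1..n}"
  then obtain j where j: "i = Suc j" by (cases i) auto
  have E: "(if l = 0 then inverse q * w $$ (k, 2 * n) else if l = 2 * n then q * w $$ (k, 0) else - w $$ (k, l)) =
      (if k = 0 then q * w' $$ (2 * n, l) else if k = 2 * n then inverse q * w' $$ (0, l) else - w' $$ (k, l))"
    if "k \<le> 2 * n" "l \<le> 2 * n" for k l
    using mult_dual_middle_entry[OF n1 U_dual_carrier[OF w] that, of q]
      dual_middle_mult_entry[OF n1 U_dual_carrier[OF w'] that, of q] eq by simp
  have "w $$ (j, Suc j) = w' $$ (j, Suc j)"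
  proof (cases "j = 0")
    case True
    have "w $$ (0, 1) = 0"
      using E[of 0 1] U_dual_entry[OF w', of "2 * n" 1] n by auto
    moreover have "w' $$ (0, 1) = 0"
      using E[of "2 * n" 1] U_dual_entry[OF w, of "2 * n" 1] n q by auto
    ultimately show ?thesis using True by simp
  next
    case False
    then show ?thesis using E[of j "Suc j"] i j n by auto
  qed
  then show "eps_dual n i w = eps_dual n i w'"
    using i j by (auto simp: eps_dual_eq)
qed simp

lemma isometry_cancel:
  assumes "v1 \<in> isometries d" "u2 \<in> isometries d" and c: "u1 \<in> carrier_mat d d" "g \<in> carrier_mat d d" "v2 \<in> carrier_mat d d"
    and eq: "u1 * g * u2 = v1 * g * v2"
  shows "form_adjoint d v1 * u1 * g = g * (v2 * form_adjoint d u2)"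
proof -
  have c': "v1 \<in> carrier_mat d d" "u2 \<in> carrier_mat d d" using assms by (auto dest: isometries_carrier)
  let ?v = "form_adjoint d v1" and ?u = "form_adjoint d u2"
  have f: "?v \<in> carrier_mat d d" "?u \<in> carrier_mat d d" by auto
  have "?v * u1 * g = ?v * u1 * g * (u2 * ?u)"
    using c f isometries_right_inverse[OF assms(2)] by simp
  also have "\<dots> = ?v * (u1 * g * u2) * ?u"
    using c c' f by (simp add: assoc_mult_mat[of _ d d _ d _ d])
  also have "\<dots> = ?v * (v1 * g * v2) * ?u" unfolding eq ..
  also have "\<dots> = (?v * v1) * (g * (v2 * ?u))"
    using c c' f by (simp add: assoc_mult_mat[of _ d d _ d _ d])
  also have "\<dots> = g * (v2 * ?u)"
    using c f isometries_left_inverse[OF assms(1)] by simp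
  finally show ?thesis .
qed

text \<open>Another decomposition has \<open>u1 = v1 w\<close> and \<open>v2 = w' u2\<close>. The
  character takes equal values on \<open>w\<close> and \<open>w'\<close>, so the two sums
  agree.\<close>

lemma W_Lie_eq:
  assumes n: "n \<ge> 2" and q: "q \<noteq> 0" and u: "u1 \<in> U_dual n" "u2 \<in> U_dual n"
  shows "W_Lie n q (u1 * t_dual n q * M_dual n * u2) = eps_sum n u1 + eps_sum n u2"
proof -
  let ?d = "Suc (2 * n)" and ?g = "dual_middle n q"
  have tM: "t_dual n q \<in> carrier_mat ?d ?d" "M_dual n \<in> carrier_mat ?d ?d"
    by (simp_all add: t_dual_def M_dual_def mat1_def)
  have assoc: "v * t_dual n q * M_dual n = v * ?g" if "v \<in> U_dual n" for v
    unfolding dual_middle_def by (rule assoc_mult_mat[OF U_dual_carrier[OF that] tM])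
  have unique: "eps_sum n u1 + eps_sum n u2 = eps_sum n v1 + eps_sum n v2"
    if v: "v1 \<in> U_dual n" "v2 \<in> U_dual n" and eq: "u1 * ?g * u2 = v1 * ?g * v2" for v1 v2
  proof -
    define w where "w = form_adjoint ?d v1 * u1"
    define w' where "w' = v2 * form_adjoint ?d u2"
    have iso: "u1 \<in> isometries ?d" "u2 \<in> isometries ?d" "v1 \<in> isometries ?d" "v2 \<in> isometries ?d"
      using u v by (auto simp: U_dual_eq)
    have c: "u1 \<in> carrier_mat ?d ?d" "u2 \<in> carrier_mat ?d ?d" "v1 \<in> carrier_mat ?d ?d" "v2 \<in> carrier_mat ?d ?d"
      using u v U_dual_carrier by auto
    have wU: "w \<in> U_dual n" "w' \<in> U_dual n"
      unfolding w_def w'_def using u v U_dual_adjoint U_dual_mult by auto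
    have "w * ?g = ?g * w'"
      unfolding w_def w'_def by (rule isometry_cancel[OF iso(3,2) c(1) dual_middle_carrier c(4) eq])
    then have "eps_sum n w = eps_sum n w'"
      by (rule eps_sum_conjugate[OF n wU _ q])
    moreover have "u1 = v1 * w"
      unfolding w_def using c isometries_right_inverse[OF iso(3)]
      by (simp add: assoc_mult_mat[of v1 ?d ?d "form_adjoint ?d v1" ?d u1 ?d, symmetric])
    then have "eps_sum n u1 = eps_sum n v1 + eps_sum n w"
      using eps_sum_mult[OF v(1) wU(1)] by simp
    moreover have "v2 = w' * u2"
      unfolding w'_def using c isometries_left_inverse[OF iso(2)]
      by (simp add: assoc_mult_mat[of v2 ?d ?d "form_adjoint ?d u2" ?d u2 ?d])
    then have "eps_sum n v2 = eps_sum n w' + eps_sum n u2"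
      using eps_sum_mult[OF wU(2) u(2)] by simp
    ultimately show ?thesis by simp
  qed
  show ?thesis
    unfolding W_Lie_def eps_sum_def[symmetric]
  proof (rule the_equality)
    show "\<exists>u1'\<in>U_dual n. \<exists>u2'\<in>U_dual n. u1 * t_dual n q * M_dual n * u2 = u1' * t_dual n q * M_dual n * u2' \<and>
        eps_sum n u1 + eps_sum n u2 = eps_sum n u1' + eps_sum n u2'"
      using u by blast
  next
    fix w assume "\<exists>v1\<in>U_dual n. \<exists>v2\<in>U_dual n. u1 * t_dual n q * M_dual n * u2 = v1 * t_dual n q * M_dual n * v2 \<and>
        w = eps_sum n v1 + eps_sum n v2"
    then obtain v1 v2 where v: "v1 \<in> U_dual n" "v2 \<in> U_dual n"
      and eq: "u1 * t_dual n q * M_dual n * u2 = v1 * t_dual n q * M_dual n * v2"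
      and w: "w = eps_sum n v1 + eps_sum n v2" by blast
    have "u1 * ?g * u2 = v1 * ?g * v2"
      using eq unfolding assoc[OF u(1)] assoc[OF v(1)] .
    then show "w = eps_sum n u1 + eps_sum n u2"
      using unique[OF v] w by simp
  qed
qed

section \<open>The factor u1 and the value of the superpotential\<close>

text \<open>The unitriangular matrix \<open>v1 u1^-1\<close> equals \<open>(v1 G) (u1 G)^-1\<close>,
  which is lower triangular.\<close>

lemma dual_factor_unique:
  assumes u: "u1 \<in> U_dual n" "v1 \<in> U_dual n" and G: "G \<in> isometries (Suc (2 * n))"
    and B: "u1 * G \<in> B_dual n" "v1 * G \<in> B_dual n"
  shows "v1 = u1"
proof -
  let ?d = "Suc (2 * n)"
  have c: "u1 \<in> carrier_mat ?d ?d" "v1 \<in> carrier_mat ?d ?d" "G \<in> carrier_mat ?d ?d"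
    using u G U_dual_carrier isometries_carrier by auto
  have iso: "u1 * G \<in> isometries ?d" "u1 \<in> isometries ?d"
    using u G by (auto simp: U_dual_eq isometries_mult)
  define w where "w = v1 * form_adjoint ?d u1"
  have w: "w \<in> U_dual n" unfolding w_def using u U_dual_adjoint U_dual_mult by auto
  have wu: "w * u1 = v1"
    unfolding w_def using c isometries_left_inverse[OF iso(2)]
    by (simp add: assoc_mult_mat[of v1 ?d ?d "form_adjoint ?d u1" ?d u1 ?d])
  then have "w * (u1 * G) = v1 * G"
    using assoc_mult_mat[OF U_dual_carrier[OF w] c(1,3)] by simp
  then have "v1 * G * form_adjoint ?d (u1 * G) = w * (u1 * G * form_adjoint ?d (u1 * G))"
    using assoc_mult_mat[OF U_dual_carrier[OF w] isometries_carrier[OF iso(1)] form_adjoint_carrier] by simp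
  then have eq: "w = v1 * G * form_adjoint ?d (u1 * G)"
    using isometries_right_inverse[OF iso(1)] U_dual_carrier[OF w] by simp
  have "lower_triangular w"
  proof -
    have l: "lower_triangular (u1 * G)" "lower_triangular (v1 * G)" using B by (auto simp: B_dual_def)
    have vG: "v1 * G \<in> carrier_mat ?d ?d" using c by (intro mult_carrier_mat)
    show ?thesis
      unfolding eq
      by (rule lower_triangular_mult[OF vG l(2) form_adjoint_carrier
            lower_triangular_adjoint[OF isometries_carrier[OF iso(1)] l(1)]])
  qed
  then have "w = 1\<^sub>m ?d"
    using w U_dual_carrier[OF w] by (intro unitriangular_lower_eq_one) (auto simp: U_dual_eq)
  then show ?thesis using wu c by simp
qed

text \<open>The form controls the first row. The last column is isotropic, so twice the product of
  its two end entries is zero; then orthogonality to the last column clears the rest of row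
  0.\<close>

lemma lower_of_middle_rows:
  assumes B: "B \<in> isometries (Suc (2 * n))" and n: "n \<ge> 1"
    and mid: "\<And>i j. 0 < i \<Longrightarrow> i < 2 * n \<Longrightarrow> i < j \<Longrightarrow> j \<le> 2 * n \<Longrightarrow> B $$ (i, j) = 0"
    and corner: "B $$ (2 * n, 2 * n) \<noteq> 0"
  shows "lower_triangular B"
proof -
  let ?N = "2 * n"
  have gram: "(\<Sum>i<Suc ?N. (-1) ^ i * B $$ (i, j) * B $$ (?N - i, l)) = (if j + l = ?N then (-1) ^ j else 0)"
    if "j \<le> ?N" "l \<le> ?N" for j l
    using isometries_gram[OF B, of j l] that by simp
  have "(\<Sum>i<Suc ?N. (-1) ^ i * B $$ (i, ?N) * B $$ (?N - i, ?N)) =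
      B $$ (0, ?N) * B $$ (?N, ?N) + B $$ (?N, ?N) * B $$ (0, ?N)"
    using n mid by (subst sum_eq_pair[of _ 0 "?N"]) auto
  then have corner0: "B $$ (0, ?N) = 0"
    using gram[of ?N ?N] n corner by simp
  have row0: "B $$ (0, j) = 0" if j: "0 < j" "j \<le> ?N" for j
  proof -
    have "(\<Sum>i<Suc ?N. (-1) ^ i * B $$ (i, j) * B $$ (?N - i, ?N)) = (-1) ^ 0 * B $$ (0, j) * B $$ (?N - 0, ?N)"
    proof (rule sum_eq_single)
      fix i assume "i \<in> {..<Suc ?N}" "i \<noteq> 0"
      then have "B $$ (?N - i, ?N) = 0"
        using corner0 mid[of "?N - i" ?N] by (cases "i = ?N") auto
      then show "(-1) ^ i * B $$ (i, j) * B $$ (?N - i, ?N) = 0" by simp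
    qed auto
    then show ?thesis using gram[of j ?N] j corner by simp
  qed
  show ?thesis
    unfolding lower_triangular_iff[OF isometries_carrier[OF B]]
  proof (intro allI impI)
    fix i j assume "i < Suc ?N" "j < Suc ?N" "i < j"
    then show "B $$ (i, j) = 0" using row0[of j] mid[of i j] by (cases "i = 0") auto
  qed
qed

text \<open>In \<open>t(q) M u2\<close> an inner row \<open>i\<close> is minus that of
  \<open>u2\<close>, and the last row is the first row of \<open>u2\<close> divided by
  \<open>q\<close>. Adding \<open>q * r i\<close> times the last row clears row \<open>i\<close> to
  the right of the diagonal.\<close>

lemma dual_factor_exists:
  assumes n: "n \<ge> 2" and q: "q \<noteq> 0" and u2: "u2 \<in> U_dual n"
    and r: "\<And>i j. 0 < i \<Longrightarrow> i < j \<Longrightarrow> j \<le> 2 * n \<Longrightarrow> u2 $$ (i, j) = r i * u2 $$ (0, j)"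
    and corner: "u2 $$ (0, 2 * n) \<noteq> 0"
  shows "\<exists>u1\<in>U_dual n. u1 * (dual_middle n q * u2) \<in> B_dual n \<and> eps_sum n u1 = q * r (2 * n - 1)"
proof -
  let ?N = "2 * n" and ?d = "Suc (2 * n)"
  define y where "y i = q * r i" for i
  \<comment> \<open>Makes the last column isotropic: its pairing with itself is \<open>2 z\<close>
    plus the inner sum.\<close>
  define z where "z = - (\<Sum>i\<in>{1..<?N}. (-1) ^ i * y i * y (?N - i)) / 2"
  \<comment> \<open>The first row is forced by orthogonality of the inner columns to the last one;
    its entry \<open>(0, 1)\<close> is \<open>y (2 n - 1)\<close>.\<close>
  define u1 where "u1 = mat ?d ?d (\<lambda>(i, j). if i = j then 1
     else if i = 0 then (if j = ?N then z else - ((-1) ^ j) * y (?N - j))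
     else if j = ?N then y i else 0)"
  have c1: "u1 \<in> carrier_mat ?d ?d" by (simp add: u1_def)
  have E: "u1 $$ (i, j) = (if i = j then 1
     else if i = 0 then (if j = ?N then z else - ((-1) ^ j) * y (?N - j))
     else if j = ?N then y i else 0)" if "i \<le> ?N" "j \<le> ?N" for i j
    using that by (simp add: u1_def)
  have up: "upper_unitriangular u1"
    by (auto simp: upper_unitriangular_iff[OF c1] E)
  have iso1: "u1 \<in> isometries ?d"
  proof (rule isometriesI_le[OF c1])
    fix j l assume "j \<le> l" "l < ?d"
    then have jl: "j \<le> l" "l \<le> ?N" by auto
    let ?t = "\<lambda>i. (-1) ^ i * u1 $$ (i, j) * u1 $$ (?N - i, l)"
    have "(\<Sum>i<?d. ?t i) = (if j + l = ?N then (-1) ^ j else 0)"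
    proof (cases "j = ?N")
      case True
      then have l: "l = ?N" using jl by simp
      have "(\<Sum>i<?d. ?t i) = (\<Sum>i\<in>insert 0 (insert ?N {1..<?N}). ?t i)"
        using n by (intro sum.cong) auto
      also have "\<dots> = ?t 0 + (?t ?N + (\<Sum>i\<in>{1..<?N}. ?t i))"
        using n by (subst sum.insert, simp, simp)+ simp
      also have "(\<Sum>i\<in>{1..<?N}. ?t i) = (\<Sum>i\<in>{1..<?N}. (-1) ^ i * y i * y (?N - i))"
        unfolding True l by (intro sum.cong) (auto simp: E)
      also have "?t 0 = z" using n unfolding True l by (simp add: E)
      also have "?t ?N = z" using n unfolding True l by (simp add: E)
      finally show ?thesis using n True l by (simp add: z_def)
    next
      case False
      show ?thesis
      proof (cases "j = 0")
        case True
        then have "(\<Sum>i<?d. ?t i) = ?t 0"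
          using n by (intro sum_eq_single) (auto simp: E)
        then show ?thesis using True jl n by (auto simp: E)
      next
        case j0: False
        have "(\<Sum>i<?d. ?t i) = ?t 0 + ?t j"
          using j0 False jl by (intro sum_eq_pair) (auto simp: E)
        also have "\<dots> = - ((-1) ^ j) * y (?N - j) * u1 $$ (?N, l) + (-1) ^ j * u1 $$ (?N - j, l)"
          using j0 False jl by (simp add: E)
        also have "\<dots> = (if j + l = ?N then (-1) ^ j else 0)"
        proof (cases "l = ?N")
          case True
          then show ?thesis using j0 jl \<open>j \<noteq> ?N\<close> by (simp add: E)
        next
          case l: False
          have "?N - j = l \<longleftrightarrow> j + l = ?N" using jl by auto
          moreover have "?N - j \<noteq> 0" using False jl by simp
          ultimately show ?thesis using l jl by (simp add: E)
        qed
        finally show ?thesis .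
      qed
    qed
    then show "(\<Sum>i<?d. (-1) ^ i * u1 $$ (i, j) * u1 $$ (?d - 1 - i, l)) =
        (if j + l + 1 = ?d then (-1) ^ j else 0)"
      by simp
  qed
  have U1: "u1 \<in> U_dual n" using iso1 up by (simp add: U_dual_eq)
  have n1: "n \<ge> 1" using n by simp
  define A where "A = dual_middle n q * u2"
  have Ac: "A \<in> carrier_mat ?d ?d"
    unfolding A_def by (rule mult_carrier_mat[OF dual_middle_carrier U_dual_carrier[OF u2]])
  have A: "A $$ (i, j) = (if i = 0 then q * u2 $$ (?N, j)
    else if i = ?N then inverse q * u2 $$ (0, j) else - u2 $$ (i, j))" if "i \<le> ?N" "j \<le> ?N" for i j
    unfolding A_def by (rule dual_middle_mult_entry[OF n1 U_dual_carrier[OF u2] that])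
  have isoB: "u1 * A \<in> isometries ?d"
    unfolding A_def using iso1 u2 dual_middle_isometry[OF n1 q] by (auto simp: U_dual_eq intro: isometries_mult)
  have mult: "(u1 * A) $$ (i, j) = (\<Sum>k<?d. u1 $$ (i, k) * A $$ (k, j))" if "i \<le> ?N" "j \<le> ?N" for i j
    using that by (intro mult_mat_entry[OF c1 Ac]) auto
  have "lower_triangular (u1 * A)"
  proof (rule lower_of_middle_rows[OF isoB n1])
    fix i j assume ij: "0 < i" "i < ?N" "i < j" "j \<le> ?N"
    have "(\<Sum>k<?d. u1 $$ (i, k) * A $$ (k, j)) = u1 $$ (i, i) * A $$ (i, j) + u1 $$ (i, ?N) * A $$ (?N, j)"
      using ij by (intro sum_eq_pair) (auto simp: E)
    then show "(u1 * A) $$ (i, j) = 0"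
      using ij q r[of i j] by (simp add: mult E A y_def)
  next
    have "(\<Sum>k<?d. u1 $$ (?N, k) * A $$ (k, ?N)) = u1 $$ (?N, ?N) * A $$ (?N, ?N)"
      using n by (intro sum_eq_single) (auto simp: E)
    then have "(u1 * A) $$ (?N, ?N) = inverse q * u2 $$ (0, ?N)"
      using n by (simp add: mult E A)
    then show "(u1 * A) $$ (?N, ?N) \<noteq> 0" using q corner by simp
  qed
  moreover have "det (u1 * A) = 1"
  proof -
    have "det A = 1"
      unfolding A_def using det_mult[OF dual_middle_carrier U_dual_carrier[OF u2]] det_dual_middle[OF n1 q] u2
      by (simp add: U_dual_def SO_group_def)
    then show ?thesis using det_mult[OF c1 Ac] upper_unitriangular_det[OF c1 up] by simp
  qed
  ultimately have "u1 * A \<in> B_dual n"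
    using isoB by (simp add: B_dual_def SO_group_eq)
  moreover have "eps_sum n u1 = q * r (?N - 1)"
  proof -
    have "eps_dual n i u1 = (if i = 1 then y (?N - 1) else 0)" if i: "i \<in> {1..n}" for i
    proof -
      obtain j where j: "i = Suc j" using i by (cases i) auto
      have "u1 $$ (j, i) = (if j = 0 then y (?N - 1) else 0)"
        using i j n by (auto simp: E)
      then show ?thesis using i j n by (auto simp: eps_dual_eq)
    qed
    then have "eps_sum n u1 = (\<Sum>i=1..n. if i = 1 then y (?N - 1) else 0)"
      unfolding eps_sum_def by (intro sum.cong) auto
    then show ?thesis using n by (simp add: y_def)
  qed
  ultimately show ?thesis using U1 unfolding A_def by blast
qed

lemma W_Lus_formula:
  assumes n: "n \<ge> 2" and q: "q \<noteq> 0" and b: "b \<noteq> 0"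
    and a: "\<forall>i\<in>{1..n-1}. a i \<noteq> 0" and c: "\<forall>i\<in>{1..n-1}. c i \<noteq> 0"
  shows "(\<exists>!u1. u1 \<in> U_dual n \<and> u1 * t_dual n q * M_dual n * lusztig_u2 n a b c \<in> B_dual n) \<and>
       W_Lus n q a b c =
         (\<Sum>i=1..n-1. a i) + b + (\<Sum>i=1..n-1. c i)
         + q * (a 1 + c 1) / ((\<Prod>i=1..n-1. a i) * b^2 * (\<Prod>i=1..n-1. c i))"
proof -
  let ?d = "Suc (2 * n)"
  have ac: "a i \<noteq> 0 \<and> c i \<noteq> 0" if "1 \<le> i" "i < n" for i using a c that by auto
  define u2 where "u2 = lusztig_u2 n a b c"
  have u2_eq: "u2 = lusztig_subword n a b c (Suc 0)"
    by (simp add: u2_def lusztig_u2_def lusztig_subword_def)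
  have iv: "{Suc 0..<n} = {1..n-1}" using n by auto
  define P where "P = (\<Prod>i=1..n-1. a i) * b^2 * (\<Prod>i=1..n-1. c i)"
  define s where "s = (\<Sum>i=1..n-1. a i) + b + (\<Sum>i=1..n-1. c i)"
  have shape: "subword_shape n 0 (2 * n) P s u2"
  proof -
    have "subword_shape n 0 (2 * n - 0)
      ((\<Prod>i=Suc 0..<n. a i) * b ^ 2 * (\<Prod>i=Suc 0..<n. c i))
      ((\<Sum>i=Suc 0..<n. a i) + b + (\<Sum>i=Suc 0..<n. c i)) (lusztig_subword n a b c (Suc 0))"
      by (rule lusztig_subword_shape) (use b ac n in auto)
    then show ?thesis unfolding P_def s_def u2_eq iv by simp
  qed
  then have u2U: "u2 \<in> U_dual n" and corner: "u2 $$ (0, 2 * n) = P" and eps2: "eps_sum n u2 = s"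
    by (auto simp: subword_shape_def)
  obtain r where r: "\<And>i j. 0 < i \<Longrightarrow> i < j \<Longrightarrow> j \<le> 2 * n \<Longrightarrow> u2 $$ (i, j) = r i * u2 $$ (0, j)"
    using shape by (auto simp: subword_shape_def)
  have P0: "P \<noteq> 0" using a b c by (auto simp: P_def prod_zero_iff)
  \<comment> \<open>Splitting off the outermost letters gives the last superdiagonal entry, which
    determines the one quotient \<open>r\<close> that enters the superpotential.\<close>
  have "u2 $$ (2 * n - 1, 2 * n) = a 1 + c 1"
  proof -
    have t: "Suc 0 < n" "Suc 0 + (2 * n - Suc 0) = 2 * n" "Suc (2 * n - Suc 0) = 2 * n" using n by auto
    have "(\<Prod>i=Suc (Suc 0)..<n. a i) * b ^ 2 * (\<Prod>i=Suc (Suc 0)..<n. c i) \<noteq> 0"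
      using ac b by (auto simp: prod_zero_iff)
    moreover have "subword_shape n (Suc 0) (2 * n - Suc 0)
      ((\<Prod>i=Suc (Suc 0)..<n. a i) * b ^ 2 * (\<Prod>i=Suc (Suc 0)..<n. c i))
      ((\<Sum>i=Suc (Suc 0)..<n. a i) + b + (\<Sum>i=Suc (Suc 0)..<n. c i)) (lusztig_subword n a b c (Suc (Suc 0)))"
      by (rule lusztig_subword_shape) (use b ac t in auto)
    ultimately show ?thesis
      using subword_shape_step(2)[of n 0 "2 * n - Suc 0" _ _ _ "a 1" "c 1"] ac[of 1] t
      unfolding u2_eq lusztig_subword_step[OF t(1)] by simp
  qed
  then have r_last: "r (2 * n - 1) = (a 1 + c 1) / P"
    using r[of "2 * n - 1" "2 * n"] corner P0 n by (simp add: field_simps)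
  obtain u1 where u1: "u1 \<in> U_dual n" "u1 * (dual_middle n q * u2) \<in> B_dual n"
    "eps_sum n u1 = q * r (2 * n - 1)"
    using dual_factor_exists[OF n q u2U r] corner P0 by blast
  have assoc: "v * t_dual n q * M_dual n * u2 = v * (dual_middle n q * u2)" if "v \<in> U_dual n" for v
  proof -
    have tM: "t_dual n q \<in> carrier_mat ?d ?d" "M_dual n \<in> carrier_mat ?d ?d"
      by (simp_all add: t_dual_def M_dual_def mat1_def)
    show ?thesis
      unfolding dual_middle_def using U_dual_carrier[OF that] U_dual_carrier[OF u2U] tM
      by (simp add: assoc_mult_mat[of _ ?d ?d _ ?d _ ?d])
  qed
  have G: "dual_middle n q * u2 \<in> isometries ?d"
    using dual_middle_isometry[of n q] n q u2U by (auto simp: U_dual_eq intro: isometries_mult)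
  have sol: "v = u1" if "v \<in> U_dual n" "v * t_dual n q * M_dual n * u2 \<in> B_dual n" for v
    using dual_factor_unique[OF u1(1) that(1) G u1(2)] that assoc by simp
  have u1_sol: "u1 * t_dual n q * M_dual n * u2 \<in> B_dual n" using u1 assoc by simp
  then have ex1: "\<exists>!u1. u1 \<in> U_dual n \<and> u1 * t_dual n q * M_dual n * u2 \<in> B_dual n"
    using sol u1(1) by blast
  have the: "(THE u1. u1 \<in> U_dual n \<and> u1 * t_dual n q * M_dual n * u2 \<in> B_dual n) = u1"
    by (rule the1_equality[OF ex1 conjI[OF u1(1) u1_sol]])
  have "W_Lus n q a b c = W_Lie n q (u1 * t_dual n q * M_dual n * u2)"
    unfolding W_Lus_def Let_def u2_def[symmetric] the ..
  also have "\<dots> = q * ((a 1 + c 1) / P) + s"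
    using W_Lie_eq[OF n q u1(1) u2U] u1(3) eps2 r_last by simp
  finally show ?thesis
    using ex1 unfolding u2_def P_def s_def by simp
qed

section \<open>The boundary of the open locus\<close>

lemma proj_pt_smult:
  assumes "e \<noteq> 0"
  shows "proj_pt (e \<cdot>\<^sub>v v) = proj_pt v"
proof (intro equalityI subsetI)
  fix w assume "w \<in> proj_pt (e \<cdot>\<^sub>v v)"
  then obtain c where "w = c \<cdot>\<^sub>v (e \<cdot>\<^sub>v v)" "c \<noteq> 0" by (auto simp: proj_pt_def)
  then have "w = (c * e) \<cdot>\<^sub>v v" "c * e \<noteq> 0" using assms by (auto simp: smult_smult_assoc)
  then show "w \<in> proj_pt v" unfolding proj_pt_def by blast
next
  fix w assume "w \<in> proj_pt v"
  then obtain c where "w = c \<cdot>\<^sub>v v" "c \<noteq> 0" by (auto simp: proj_pt_def)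
  then have "w = (c / e) \<cdot>\<^sub>v (e \<cdot>\<^sub>v v)" "c / e \<noteq> 0" using assms by (auto simp: smult_smult_assoc)
  then show "w \<in> proj_pt (e \<cdot>\<^sub>v v)" unfolding proj_pt_def by blast
qed

lemma open_locus_iff:
  assumes n: "n \<ge> 1" and v: "v \<in> carrier_vec (2 * n)"
  shows "proj_pt v \<in> open_locus_C n \<longleftrightarrow> (\<forall>r<n. peval (F_C (2 * n - 1) r) (\<lambda>i. v $ i) \<noteq> 0)"
proof -
  define N where "N = 2 * n - 1"
  have N: "2 * n = Suc N" and odd: "odd N" using n by (auto simp: N_def)
  have F: "tail_pairing N p (N - r) = (-1) ^ (N - r) * peval (F_C N r) p" if "r < n" for r p
    using that N by (simp add: peval_F_C tail_pairing_alternating_sum)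
  \<comment> \<open>The forms with \<open>r < n\<close> account for the indices
    \<open>k = n, ..., N\<close>; the flip supplies the lower half.\<close>
  have tails: "tail_pairing N p k \<noteq> 0"
    if nz: "\<forall>r<n. peval (F_C N r) p \<noteq> 0" and k: "1 \<le> k" "k \<le> N" for p k
  proof (cases "n \<le> k")
    case True
    then have "N - (N - k) = k" "N - k < n" using k N by auto
    then show ?thesis using F[of "N - k" p] nz by simp
  next
    case False
    have "N - (k - 1) = N + 1 - k" "k - 1 < n" using k False by auto
    then have "tail_pairing N p (N + 1 - k) \<noteq> 0" using F[of "k - 1" p] nz by simp
    then show ?thesis using tail_pairing_flip[OF odd, of k p] k by simp
  qed
  have scale: "peval (F_C N r) (\<lambda>i. w $ i) \<noteq> 0"
    if "peval (F_C N r) (\<lambda>i. u $ i) \<noteq> 0" "w = e \<cdot>\<^sub>v u" "e \<noteq> 0" "u \<in> carrier_vec (2 * n)" "r < n" for r u w e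
  proof -
    have "peval (F_C N r) (\<lambda>i. w $ i) = e ^ 2 * peval (F_C N r) (\<lambda>i. u $ i)"
      using that N by (intro peval_scale[OF is_form_F_C]) auto
    then show ?thesis using that by simp
  qed
  have F0: "peval (F_C N 0) p = p 0 * p N" for p by (simp add: peval_F_C)
  show ?thesis
    unfolding N_def[symmetric]
  proof
    assume "proj_pt v \<in> open_locus_C n"
    then obtain b where b: "b \<in> S_C n" "proj_pt v = eta_C n b" by (auto simp: open_locus_C_def)
    define u where "u = row (b * J_C n) N"
    have u: "u \<in> carrier_vec (2 * n)"
      using row_carrier[of "b * J_C n" N] by (simp add: u_def J_C_def)
    have "\<exists>c. v = c \<cdot>\<^sub>v v \<and> c \<noteq> 0" by (rule exI[of _ 1]) simp
    then have "v \<in> proj_pt v" by (simp add: proj_pt_def)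
    then obtain c where c: "v = c \<cdot>\<^sub>v u" "c \<noteq> 0"
      unfolding b eta_C_def N_def[symmetric] u_def[symmetric] by (auto simp: proj_pt_def)
    show "\<forall>r<n. peval (F_C N r) (\<lambda>i. v $ i) \<noteq> 0"
    proof (intro allI impI)
      fix r assume r: "r < n"
      have "tail_pairing N (\<lambda>i. u $ i) (N - r) \<noteq> 0"
        using r N unfolding u_def by (intro open_locus_nonvanishing(2)[OF N b(1)]) auto
      then have "peval (F_C N r) (\<lambda>i. u $ i) \<noteq> 0" using F[OF r] by simp
      then show "peval (F_C N r) (\<lambda>i. v $ i) \<noteq> 0" using scale c u r by blast
    qed
  next
    assume nz: "\<forall>r<n. peval (F_C N r) (\<lambda>i. v $ i) \<noteq> 0"
    \<comment> \<open>The factor with \<open>r = 0\<close> is \<open>p_0 p_N\<close>, so the last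
      coordinate can be scaled to 1.\<close>
    have "v $ N \<noteq> 0" using nz n F0[of "\<lambda>i. v $ i"] by auto
    define u where "u = (1 / v $ N) \<cdot>\<^sub>v v"
    have uN: "u $ N = 1" using v N \<open>v $ N \<noteq> 0\<close> by (simp add: u_def)
    have "\<forall>r<n. peval (F_C N r) (\<lambda>i. u $ i) \<noteq> 0"
      using scale[OF _ u_def _ v] nz \<open>v $ N \<noteq> 0\<close> by simp
    then interpret open_locus_point n N "\<lambda>i. u $ i"
      using N uN tails by unfold_locales
    have "vec (Suc N) (\<lambda>i. u $ i) = u" using v N by (intro eq_vecI) (auto simp: u_def)
    then have "eta_C n b = proj_pt u" using eta_b by simp
    also have "\<dots> = proj_pt v"
      unfolding u_def using \<open>v $ N \<noteq> 0\<close> by (intro proj_pt_smult) simp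
    finally show "proj_pt v \<in> open_locus_C n"
      using b_in_S_C unfolding open_locus_C_def by blast
  qed
qed

lemma boundary_eq_zero_locus:
  assumes n: "n \<ge> 1"
  shows "proj_space (2 * n - 1) - open_locus_C n = zero_locus (2 * n - 1) (boundary_form n)"
proof -
  have d: "2 * n - 1 + 1 = 2 * n" using n by simp
  have "proj_pt v \<in> open_locus_C n \<longleftrightarrow> proj_pt v \<notin> zero_locus (2 * n - 1) (boundary_form n)"
    if v: "v \<in> carrier_vec (2 * n)" "v \<noteq> 0\<^sub>v (2 * n)" for v
  proof -
    have "peval (boundary_form n) (\<lambda>i. v $ i) = (\<Prod>r<n. peval (F_C (2 * n - 1) r) (\<lambda>i. v $ i))"
      by (simp add: boundary_form_def peval_eq at_point.ev_prod)
    then show ?thesis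
      using zero_locus_iff[OF is_form_boundary_form, of v n] v d open_locus_iff[OF n v(1)]
      by (auto simp: prod_zero_iff)
  qed
  moreover have "zero_locus (2 * n - 1) (boundary_form n) \<subseteq> proj_space (2 * n - 1)"
    by (auto simp: zero_locus_def)
  ultimately show ?thesis
    unfolding proj_space_def d by blast
qed

theorem theorem1p1:
  fixes n N :: nat
  assumes "n \<ge> 2" and "N = 2*n - 1"
  shows "(proj_space N - open_locus_C n = divisor_support N (D_C n) \<and> anticanonical N (D_C n)) \<and>
    (\<forall>(q::complex) (a::nat \<Rightarrow> complex) (b::complex) (c::nat \<Rightarrow> complex).
       q \<noteq> 0 \<and> (\<forall>i\<in>{1..n-1}. a i \<noteq> 0) \<and> b \<noteq> 0 \<and> (\<forall>i\<in>{1..n-1}. c i \<noteq> 0) \<longrightarrow>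
       (\<exists>!u1. u1 \<in> U_dual n \<and> u1 * t_dual n q * M_dual n * lusztig_u2 n a b c \<in> B_dual n) \<and>
       W_Lus n q a b c =
         (\<Sum>i=1..n-1. a i) + b + (\<Sum>i=1..n-1. c i)
         + q * (a 1 + c 1) / ((\<Prod>i=1..n-1. a i) * b^2 * (\<Prod>i=1..n-1. c i)))"
proof -
  have n: "n \<ge> 1" using assms by simp
  have "proj_space N - open_locus_C n = divisor_support N (D_C n)" "anticanonical N (D_C n)"
    unfolding assms(2) using boundary_eq_zero_locus[OF n] D_C_support[OF n] D_C_anticanonical[OF n] by auto
  then show ?thesis
    by (intro conjI[OF conjI] allI impI W_Lus_formula[OF assms(1)]) auto
qed

end
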